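(* Let $G$ be a unimodular locally compact group with Haar measure $dg$, and let $\phi_1,\phi_2\colon G\to[0,1]$ be integrable functions satisfying $\|\phi_1\|\le\|\phi_2\|$ and $\|\phi_1\|+\|\phi_2\|\le m(G)$. Then for every convex function $f\colon[0,\|\phi_1\|]\to\mathbb{R}$ with $f(0)=0$ (no continuity at the endpoints is assumed), one has $$\int_G f\circ(\phi_1*\phi_2)(g)\,dg\;\le\;2\int_0^{\|\phi_1\|}f(y)\,dy+(\|\phi_2\|-\|\phi_1\|)\,f(\|\phi_1\|).$$ Here the integral on the left is understood in the extended sense, with value in $[-\infty,\infty)$.
   Context: $\|\cdot\|$ is the $L^1$-norm with respect to the fixed Haar measure $dg$ on $G$, and $\mathrm{vol}$ is the corresponding Haar volume. $m(G):=\inf_{G'}\mathrm{vol}(G')\in[0,\infty]$, where $G'$ ranges over all open subgroups of $G$. The convolution is $\phi_1*\phi_2(g):=\int_G\phi_1(g')\phi_2(g'^{-1}g)\,dg'$. Since $0\le\phi_1*\phi_2\le\|\phi_1\|$, the composition $f\circ(\phi_1*\phi_2)$ is well defined. *)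

theory Defs
  imports "HOL-Analysis.Analysis"
begin

text \<open>
  Topological groups are taken from the library class \<open>topological_group_add\<close>. It extends
  \<open>group_add\<close>, which does not assume commutativity: the group law is merely written additively, so
  that \<open>g + h\<close>, \<open>- g\<close> and \<open>0\<close> stand for the product, the inverse and the neutral element of an
  arbitrary, possibly non-abelian, group.
\<close>

definition radon_measure :: "'a::t2_space measure \<Rightarrow> bool" where
  "radon_measure M \<longleftrightarrow>
     sets M = sets borel \<and>
     (\<forall>K. compact K \<longrightarrow> emeasure M K < \<infinity>) \<and>
     (\<forall>A\<in>sets borel. emeasure M A = (INF U\<in>{U. open U \<and> A \<subseteq> U}. emeasure M U)) \<and>
     (\<forall>U. open U \<longrightarrow> emeasure M U = (SUP K\<in>{K. compact K \<and> K \<subseteq> U}. emeasure M K))"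

definition haar_measure :: "'a::{topological_group_add, t2_space} measure \<Rightarrow> bool" where
  "haar_measure M \<longleftrightarrow>
     radon_measure M \<and> emeasure M UNIV \<noteq> 0 \<and>
     (\<forall>g. \<forall>A\<in>sets borel. emeasure M ((\<lambda>x. g + x) ` A) = emeasure M A)"

text \<open>
  By uniqueness of the left Haar measure up to scaling, right invariance of one left Haar measure is
  a property of the group alone.
\<close>

definition unimodular :: "'a::{topological_group_add, t2_space} measure \<Rightarrow> bool" where
  "unimodular M \<longleftrightarrow> (\<forall>g. \<forall>A\<in>sets borel. emeasure M ((\<lambda>x. x + g) ` A) = emeasure M A)"

definition open_subgroup :: "'a::topological_group_add set \<Rightarrow> bool" where
  "open_subgroup H \<longleftrightarrow>
     open H \<and> 0 \<in> H \<and> (\<forall>x\<in>H. \<forall>y\<in>H. x + y \<in> H) \<and> (\<forall>x\<in>H. - x \<in> H)"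

definition min_open_subgroup_vol :: "'a::topological_group_add measure \<Rightarrow> ennreal" where
  "min_open_subgroup_vol M = (INF H\<in>{H. open_subgroup H}. emeasure M H)"

definition L1_norm :: "'a measure \<Rightarrow> ('a \<Rightarrow> real) \<Rightarrow> real" where
  "L1_norm M \<phi> = (LINT x|M. \<bar>\<phi> x\<bar>)"

definition group_convolution ::
    "'a::group_add measure \<Rightarrow> ('a \<Rightarrow> real) \<Rightarrow> ('a \<Rightarrow> real) \<Rightarrow> 'a \<Rightarrow> real" where
  "group_convolution M \<phi>\<^sub>1 \<phi>\<^sub>2 g = (LINT g'|M. \<phi>\<^sub>1 g' * \<phi>\<^sub>2 (- g' + g))"

text \<open>
  The Lebesgue integral with values in \<open>[-\<infinity>, \<infinity>)\<close> exists when the function is measurable and its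
  positive part has finite integral; it is then the difference of the integrals of the positive and
  the negative part (\<open>ennreal\<close> truncates negative reals to \<open>0\<close>).
\<close>

definition upper_integrable :: "'a measure \<Rightarrow> ('a \<Rightarrow> real) \<Rightarrow> bool" where
  "upper_integrable M h \<longleftrightarrow>
     h \<in> borel_measurable M \<and> (\<integral>\<^sup>+ x. ennreal (h x) \<partial>M) < \<infinity>"

definition extended_integral :: "'a measure \<Rightarrow> ('a \<Rightarrow> real) \<Rightarrow> ereal" where
  "extended_integral M h =
     enn2ereal (\<integral>\<^sup>+ x. ennreal (h x) \<partial>M) - enn2ereal (\<integral>\<^sup>+ x. ennreal (- h x) \<partial>M)"

end

(*
  Chord interpolation reduces the theorem to f(y) = y, where it is Fubini's theorem, and to
  f(y) = max 0 (y - t), where it says that the integral of min (phi * psi) t is at least t (a + b - t)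
  with a, b the norms of phi and psi.
  For functions supported in an open subgroup H of volume m(G), which exists if m(G) > 0, fix psi
  and t. The functional D(phi) = integral of min (phi * psi) t, minus t a, is invariant under
  translation and submodular, so that D is bounded below by a mean of the values of D at two
  functions of norms a - d and a + d. Small d > 0 can be prescribed, because every neighbourhood of 0
  in H generates a subgroup of full volume. Hence the infimum of D as a function of a behaves like a
  concave function, and it suffices to bound it at the ends of an interval, where this is elementary.
  Functions on G are then cut into pieces supported in single cosets of H.
*)
theory Submission
  imports Defs
begin

section \<open>Radon measures and lower semicontinuous functions\<close>

text \<open>On combinations of y and hinges \<open>max 0 (y - t)\<close> both sides are linear in f.
  For a hinge the right-hand side is (a - t)^2 + (b - a)(a - t) = (a - t)(b - t), that is ab - t(a +
  b - t); this is the origin of the bound for the truncated convolution. Subtracting t a turns that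
  bound into t(b - t), a constant in a, to which a minimum principle can apply. The interval is
  [t, m(G) - b + t]: at its left end the convolution never exceeds t, at its right end it is at
  least t on all of H. If m(G) is infinite there is no right end, and D + \<nu> a with small \<nu> >
  0 replaces D because it is large for large a. Two obstacles shape the proof. The infimum of D need
  not be attained and d can be prescribed only within a factor 2, so the minimum principle works
  with almost minimisers and a quadratic perturbation. And the Haar measure need not be
  \<sigma>-finite, so integrals are interchanged for open sets only and the result is transferred by
  regularity.\<close>

lemma radon_sets: "radon_measure M \<Longrightarrow> sets M = sets borel"
  by (simp add: radon_measure_def)

lemma directed_finite_subfamily:
  assumes "finite F" "F \<subseteq> I" "I \<noteq> {}"
    and "\<And>i j. i \<in> I \<Longrightarrow> j \<in> I \<Longrightarrow> \<exists>k\<in>I. U i \<union> U j \<subseteq> U k"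
  shows "\<exists>k\<in>I. (\<Union>i\<in>F. U i) \<subseteq> U k"
  using assms(1,2)
proof (induction F rule: finite_induct)
  case empty
  then show ?case using assms(3) by auto
next
  case (insert i F)
  then obtain k where "k \<in> I" "(\<Union>i\<in>F. U i) \<subseteq> U k" by auto
  moreover obtain l where "l \<in> I" "U i \<union> U k \<subseteq> U l"
    using assms(4)[of i k] insert.prems \<open>k \<in> I\<close> by auto
  ultimately show ?case by (intro bexI[of _ l]) auto
qed

text \<open>Takes the place of continuity from below for families that are not sequences: inner
  regularity reduces the union to a compact subset, and compactness with directedness puts that
  subset inside a single \<open>U k\<close>.\<close>

lemma emeasure_directed_Union_open:
  assumes M: "radon_measure M" and ne: "I \<noteq> {}"
    and op: "\<And>i. i \<in> I \<Longrightarrow> open (U i)"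
    and dir: "\<And>i j. i \<in> I \<Longrightarrow> j \<in> I \<Longrightarrow> \<exists>k\<in>I. U i \<union> U j \<subseteq> U k"
  shows "emeasure M (\<Union>i\<in>I. U i) = (SUP i\<in>I. emeasure M (U i))"
proof (rule antisym)
  have o: "open (\<Union>i\<in>I. U i)" using op by blast
  have "emeasure M (\<Union>i\<in>I. U i) = (SUP K\<in>{K. compact K \<and> K \<subseteq> (\<Union>i\<in>I. U i)}. emeasure M K)"
    using M o unfolding radon_measure_def by blast
  also have "\<dots> \<le> (SUP i\<in>I. emeasure M (U i))"
  proof (rule SUP_least)
    fix K assume "K \<in> {K. compact K \<and> K \<subseteq> (\<Union>i\<in>I. U i)}"
    then have K: "compact K" "K \<subseteq> (\<Union>i\<in>I. U i)" by auto
    obtain F where F: "F \<subseteq> I" "finite F" "K \<subseteq> (\<Union>i\<in>F. U i)"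
      using compactE_image[OF K(1), of I U] op K(2) by metis
    obtain k where k: "k \<in> I" "(\<Union>i\<in>F. U i) \<subseteq> U k"
      using directed_finite_subfamily[OF F(2,1) ne dir] by blast
    have "U k \<in> sets M" using op[OF k(1)] radon_sets[OF M] by simp
    then have "emeasure M K \<le> emeasure M (U k)"
      using F k by (intro emeasure_mono) auto
    then show "emeasure M K \<le> (SUP i\<in>I. emeasure M (U i))"
      using k(1) by (rule_tac SUP_upper2)
  qed
  finally show "emeasure M (\<Union>i\<in>I. U i) \<le> (SUP i\<in>I. emeasure M (U i))" .
  show "(SUP i\<in>I. emeasure M (U i)) \<le> emeasure M (\<Union>i\<in>I. U i)"
    using o radon_sets[OF M] by (intro SUP_least emeasure_mono) auto
qed

text \<open>Riemann sum with mesh \<open>1 / Suc n\<close> for the layer-cake formula: y is the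
  length of the set of all s \<ge> 0 with s < y. The strict inequality lets only superlevel sets {c
  < f} enter, which are open for lower semicontinuous f. The \<open>(Suc n)^2\<close> grid points
  reach height \<open>Suc n\<close>, so every finite value is eventually covered.\<close>

definition stairs :: "nat \<Rightarrow> ennreal \<Rightarrow> ennreal" where
  "stairs n y = (\<Sum>k\<in>{1..(Suc n)^2}. ennreal (1 / Suc n) * (if ennreal (k / Suc n) < y then 1 else 0))"

lemma stairs_card:
  "stairs n y = ennreal (card {k\<in>{1..(Suc n)^2}. ennreal (k / Suc n) < y} / Suc n)"
proof -
  have "stairs n y = (\<Sum>k\<in>{k\<in>{1..(Suc n)^2}. ennreal (k / Suc n) < y}. ennreal (1 / Suc n))"
    unfolding stairs_def by (subst sum.inter_filter) (auto intro!: sum.cong)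
  also have "\<dots> = ennreal (\<Sum>k\<in>{k\<in>{1..(Suc n)^2}. ennreal (k / Suc n) < y}. 1 / Suc n)"
    by (subst sum_ennreal) auto
  finally show ?thesis by simp
qed

lemma stairs_le: "stairs n y \<le> y"
proof (cases y)
  case (real r)
  let ?S = "{k\<in>{1..(Suc n)^2}. ennreal (k / Suc n) < y}"
  have "?S \<subseteq> {1..nat \<lfloor>r * Suc n\<rfloor>}"
  proof
    fix k assume k: "k \<in> ?S"
    then have "real k / Suc n < r" using real by (simp add: ennreal_less_iff)
    then have "real k \<le> r * Suc n" by (simp add: field_simps)
    then show "k \<in> {1..nat \<lfloor>r * Suc n\<rfloor>}" using k by (auto simp: le_nat_floor)
  qed
  then have "card ?S \<le> nat \<lfloor>r * Suc n\<rfloor>"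
    using card_mono[of "{1..nat \<lfloor>r * Suc n\<rfloor>}" ?S] by simp
  moreover have "0 \<le> r * Suc n" using real by simp
  ultimately have "real (card ?S) \<le> r * Suc n" by linarith
  then have "card ?S / Suc n \<le> r" by (simp only: pos_divide_le_eq of_nat_0_less_iff zero_less_Suc)
  then show ?thesis unfolding stairs_card using real by (simp add: ennreal_leI)
qed simp

lemma stairs_ge:
  assumes "0 \<le> c" "ennreal c < y" "c \<le> real (Suc n)"
  shows "ennreal (c - 1 / Suc n) \<le> stairs n y"
proof -
  let ?S = "{k\<in>{1..(Suc n)^2}. ennreal (k / Suc n) < y}"
  have "{1..nat \<lfloor>c * Suc n\<rfloor>} \<subseteq> ?S"
  proof
    fix k assume "k \<in> {1..nat \<lfloor>c * Suc n\<rfloor>}"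
    then have k: "1 \<le> k" "real k \<le> c * Suc n" by (auto simp: le_floor_iff) linarith
    then have "real k / Suc n \<le> c" by (simp add: field_simps)
    then have "ennreal (real k / Suc n) \<le> ennreal c" by (rule ennreal_leI)
    moreover have "real k \<le> real ((Suc n)^2)"
      using k(2) mult_right_mono[OF assms(3), of "real (Suc n)"] unfolding power2_eq_square of_nat_mult by linarith
    then have "k \<le> (Suc n)^2" by (simp only: of_nat_le_iff)
    ultimately show "k \<in> ?S" using k(1) assms(2) by auto
  qed
  then have "nat \<lfloor>c * Suc n\<rfloor> \<le> card ?S" using card_mono[of ?S "{1..nat \<lfloor>c * Suc n\<rfloor>}"] by simp
  moreover have "c * Suc n - 1 \<le> nat \<lfloor>c * Suc n\<rfloor>" by linarith
  ultimately have "c * Suc n - 1 \<le> card ?S" by linarith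
  then have "(c * Suc n - 1) / Suc n \<le> card ?S / Suc n" by (intro divide_right_mono) auto
  moreover have "(c * Suc n - 1) / Suc n = c - 1 / Suc n" by (simp add: field_simps)
  ultimately have "c - 1 / Suc n \<le> card ?S / Suc n" by simp
  then show ?thesis unfolding stairs_card by (rule ennreal_leI)
qed

text \<open>The grids for different \<open>n\<close> are not nested and \<open>stairs n y\<close> is
  not monotone in \<open>n\<close>; hence the liminf, and Fatou's lemma instead of monotone
  convergence where this is applied.\<close>

lemma le_liminf_stairs: "y \<le> liminf (\<lambda>n. stairs n y)"
  unfolding le_Liminf_iff
proof (intro allI impI)
  fix z assume "z < y"
  then obtain w where w: "z < w" "w < y" using dense by blast
  then obtain c where c: "w = ennreal c" "0 \<le> c" by (cases w) auto
  obtain d where d: "z = ennreal d" "0 \<le> d" using w by (cases z) auto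
  have "d < c" using w c d by (simp add: ennreal_less_iff)
  have "(\<lambda>n. c - 1 / Suc n) \<longlonglongrightarrow> c"
    using LIMSEQ_inverse_real_of_nat_add_minus[of c] by (simp add: inverse_eq_divide)
  then have "eventually (\<lambda>n. d < c - 1 / Suc n) sequentially"
    using \<open>d < c\<close> by (rule order_tendstoD(1))
  moreover have "eventually (\<lambda>n. c \<le> real (Suc n)) sequentially"
    using eventually_ge_at_top[of "nat \<lceil>c\<rceil>"] by eventually_elim linarith
  ultimately show "\<forall>\<^sub>F n in sequentially. z < stairs n y"
  proof eventually_elim
    case (elim n)
    have "z < ennreal (c - 1 / Suc n)" using d elim by (simp add: ennreal_less_iff)
    also have "\<dots> \<le> stairs n y" using stairs_ge[of c y n] c w elim by simp
    finally show ?case .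
  qed
qed

text \<open>The dominating index \<open>l\<close> is common to all \<open>k\<close>; this keeps the
  partial sums directed throughout the induction.\<close>

lemma SUP_sum_directed_ennreal:
  fixes g :: "'k \<Rightarrow> 'i \<Rightarrow> ennreal"
  assumes "finite A" and ne: "I \<noteq> {}"
    and dir: "\<And>i j. i \<in> I \<Longrightarrow> j \<in> I \<Longrightarrow> \<exists>l\<in>I. \<forall>k. g k i \<le> g k l \<and> g k j \<le> g k l"
  shows "(\<Sum>k\<in>A. SUP i\<in>I. g k i) = (SUP i\<in>I. \<Sum>k\<in>A. g k i)"
  using assms(1)
proof (induction A rule: finite_induct)
  case empty
  then show ?case using ne by simp
next
  case (insert a A)
  have "(\<Sum>k\<in>insert a A. SUP i\<in>I. g k i) = (SUP i\<in>I. g a i) + (SUP i\<in>I. \<Sum>k\<in>A. g k i)"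
    using insert by simp
  also have "\<dots> = (SUP i\<in>I. g a i + (\<Sum>k\<in>A. g k i))"
  proof (rule SUP_add_directed_ennreal[symmetric])
    fix i j assume "i \<in> I" "j \<in> I"
    then obtain l where l: "l \<in> I" "\<forall>k. g k i \<le> g k l \<and> g k j \<le> g k l" using dir by blast
    show "\<exists>l\<in>I. g a i + (\<Sum>k\<in>A. g k j) \<le> g a l + (\<Sum>k\<in>A. g k l)"
      using l(2) by (intro bexI[OF _ l(1)] add_mono sum_mono) auto
  qed
  also have "\<dots> = (SUP i\<in>I. \<Sum>k\<in>insert a A. g k i)" using insert.hyps by simp
  finally show ?case .
qed

lemma open_superlevel_measurable:
  fixes f :: "'a::topological_space \<Rightarrow> ennreal"
  assumes "\<And>c. open {x. c < f x}"
  shows "f \<in> borel_measurable borel"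
proof (rule borel_measurableI_greater)
  fix c show "{x \<in> space borel. c < f x} \<in> sets borel" using assms[of c] by simp
qed

text \<open>Level sets reduce this to open sets. Tonelli's theorem for open sets will follow from it; the
  library version for product measures does not apply, because \<open>M\<close> need not be \<open>\<sigma>\<close>-finite and
  \<open>borel \<Otimes>\<^sub>M borel\<close> may be smaller than the Borel algebra of the product.\<close>
lemma nn_integral_directed_SUP_lsc:
  fixes f :: "'i \<Rightarrow> 'a::t2_space \<Rightarrow> ennreal"
  assumes M: "radon_measure M" and ne: "I \<noteq> {}"
    and op: "\<And>i c. i \<in> I \<Longrightarrow> open {x. c < f i x}"
    and dir: "\<And>i j. i \<in> I \<Longrightarrow> j \<in> I \<Longrightarrow> \<exists>k\<in>I. \<forall>x. f i x \<le> f k x \<and> f j x \<le> f k x"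
  shows "(\<integral>\<^sup>+x. (SUP i\<in>I. f i x) \<partial>M) = (SUP i\<in>I. \<integral>\<^sup>+x. f i x \<partial>M)"
proof (rule antisym)
  show "(SUP i\<in>I. \<integral>\<^sup>+x. f i x \<partial>M) \<le> (\<integral>\<^sup>+x. (SUP i\<in>I. f i x) \<partial>M)"
    by (intro SUP_least nn_integral_mono SUP_upper)
  define F where "F x = (SUP i\<in>I. f i x)" for x
  have level: "{x. c < F x} = (\<Union>i\<in>I. {x. c < f i x})" for c
    unfolding F_def by (auto simp: less_SUP_iff)
  have opF: "open {x. c < F x}" for c unfolding level using op by blast
  note [measurable_cong] = radon_sets[OF M]
  have [measurable]: "F \<in> borel_measurable borel" by (rule open_superlevel_measurable[OF opF])
  have fm [measurable]: "f i \<in> borel_measurable borel" if "i \<in> I" for i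
    by (rule open_superlevel_measurable[OF op[OF that]])
  have intS: "(\<integral>\<^sup>+x. stairs n (g x) \<partial>M) =
      (\<Sum>k\<in>{1..(Suc n)^2}. ennreal (1 / Suc n) * emeasure M {x. ennreal (k / Suc n) < g x})"
    if [measurable]: "g \<in> borel_measurable borel" for g n
  proof -
    have sp: "space M = UNIV" using sets_eq_imp_space_eq[OF radon_sets[OF M]] by simp
    have [measurable]: "{x. ennreal (k / Suc n) < g x} \<in> sets M" for k :: nat
      using sp measurable_sets[of g borel borel "{ennreal (k / Suc n)<..}"] radon_sets[OF M] that
      by (auto simp: vimage_def greaterThan_def)
    have "(\<integral>\<^sup>+x. stairs n (g x) \<partial>M) =
      (\<integral>\<^sup>+x. (\<Sum>k\<in>{1..(Suc n)^2}. ennreal (1 / Suc n) * indicator {x. ennreal (k / Suc n) < g x} x) \<partial>M)"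
      unfolding stairs_def by (intro nn_integral_cong sum.cong) (auto simp: indicator_def)
    also have "\<dots> = (\<Sum>k\<in>{1..(Suc n)^2}. \<integral>\<^sup>+x. ennreal (1 / Suc n) * indicator {x. ennreal (k / Suc n) < g x} x \<partial>M)"
      by (intro nn_integral_sum) simp
    also have "\<dots> = (\<Sum>k\<in>{1..(Suc n)^2}. ennreal (1 / Suc n) * emeasure M {x. ennreal (k / Suc n) < g x})"
      by (intro sum.cong refl nn_integral_cmult_indicator) simp
    finally show ?thesis .
  qed
  have bound: "(\<integral>\<^sup>+x. stairs n (F x) \<partial>M) \<le> (SUP i\<in>I. \<integral>\<^sup>+x. f i x \<partial>M)" for n
  proof -
    have "(\<integral>\<^sup>+x. stairs n (F x) \<partial>M) =
      (\<Sum>k\<in>{1..(Suc n)^2}. SUP i\<in>I. ennreal (1 / Suc n) * emeasure M {x. ennreal (k / Suc n) < f i x})"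
      unfolding intS[OF \<open>F \<in> borel_measurable borel\<close>]
    proof (rule sum.cong[OF refl])
      fix k :: nat
      have "emeasure M {x. ennreal (real k / real (Suc n)) < F x} =
          (SUP i\<in>I. emeasure M {x. ennreal (real k / real (Suc n)) < f i x})"
        unfolding level
      proof (rule emeasure_directed_Union_open[OF M ne op])
        fix i j assume "i \<in> I" "j \<in> I"
        then obtain l where l: "l \<in> I" "\<forall>x. f i x \<le> f l x \<and> f j x \<le> f l x" using dir by blast
        show "\<exists>l\<in>I. {x. ennreal (real k / real (Suc n)) < f i x} \<union> {x. ennreal (real k / real (Suc n)) < f j x}
            \<subseteq> {x. ennreal (real k / real (Suc n)) < f l x}"
        proof (intro bexI[OF _ l(1)] subsetI)
          fix x assume "x \<in> {x. ennreal (real k / real (Suc n)) < f i x} \<union> {x. ennreal (real k / real (Suc n)) < f j x}"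
          then show "x \<in> {x. ennreal (real k / real (Suc n)) < f l x}"
            unfolding Un_iff mem_Collect_eq using l(2) order_less_le_trans by metis
        qed
      qed
      then show "ennreal (1 / real (Suc n)) * emeasure M {x. ennreal (real k / real (Suc n)) < F x} =
         (SUP i\<in>I. ennreal (1 / real (Suc n)) * emeasure M {x. ennreal (real k / real (Suc n)) < f i x})"
        by (simp only: SUP_mult_left_ennreal[symmetric])
    qed
    also have "\<dots> = (SUP i\<in>I. \<Sum>k\<in>{1..(Suc n)^2}. ennreal (1 / Suc n) * emeasure M {x. ennreal (k / Suc n) < f i x})"
    proof (rule SUP_sum_directed_ennreal[OF _ ne])
      fix i j assume ij: "i \<in> I" "j \<in> I"
      obtain k where k: "k \<in> I" "\<forall>x. f i x \<le> f k x \<and> f j x \<le> f k x" using dir[OF ij] by blast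
      have "{x. c < f k x} \<in> sets M" for c using op[OF k(1)] radon_sets[OF M] by simp
      then have "emeasure M {x. c < f i x} \<le> emeasure M {x. c < f k x}"
          "emeasure M {x. c < f j x} \<le> emeasure M {x. c < f k x}" for c
        using k(2) by (auto intro!: emeasure_mono intro: order_less_le_trans)
      then show "\<exists>l\<in>I. \<forall>m. ennreal (1 / real (Suc n)) * emeasure M {x. ennreal (real m / real (Suc n)) < f i x}
               \<le> ennreal (1 / real (Suc n)) * emeasure M {x. ennreal (real m / real (Suc n)) < f l x} \<and>
               ennreal (1 / real (Suc n)) * emeasure M {x. ennreal (real m / real (Suc n)) < f j x}
               \<le> ennreal (1 / real (Suc n)) * emeasure M {x. ennreal (real m / real (Suc n)) < f l x}"
        using k(1) by (intro bexI[of _ k] allI conjI mult_left_mono) auto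
    qed simp
    also have "\<dots> = (SUP i\<in>I. \<integral>\<^sup>+x. stairs n (f i x) \<partial>M)"
      by (intro SUP_cong refl) (simp only: intS[OF fm])
    also have "\<dots> \<le> (SUP i\<in>I. \<integral>\<^sup>+x. f i x \<partial>M)"
      by (intro SUP_mono' nn_integral_mono stairs_le)
    finally show ?thesis .
  qed
  have [measurable]: "stairs n \<in> borel_measurable borel" for n
    unfolding stairs_def by measurable
  have "(\<integral>\<^sup>+x. F x \<partial>M) \<le> (\<integral>\<^sup>+x. liminf (\<lambda>n. stairs n (F x)) \<partial>M)"
    by (intro nn_integral_mono le_liminf_stairs)
  also have "\<dots> \<le> liminf (\<lambda>n. \<integral>\<^sup>+x. stairs n (F x) \<partial>M)"
    by (intro nn_integral_liminf) measurable
  also have "\<dots> \<le> liminf (\<lambda>n::nat. SUP i\<in>I. \<integral>\<^sup>+x. f i x \<partial>M)"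
    by (intro Liminf_mono always_eventually allI bound)
  also have "\<dots> = (SUP i\<in>I. \<integral>\<^sup>+x. f i x \<partial>M)" by (simp add: Liminf_const)
  finally show "(\<integral>\<^sup>+x. (SUP i\<in>I. f i x) \<partial>M) \<le> (SUP i\<in>I. \<integral>\<^sup>+x. f i x \<partial>M)"
    unfolding F_def .
qed

section \<open>Tonelli's theorem for open subsets of a product\<close>

lemma radon_space: "radon_measure M \<Longrightarrow> space M = UNIV"
  using sets_eq_imp_space_eq[OF radon_sets] by simp

text \<open>Atoms of the Boolean algebra generated by a finite family: membership in every
  \<open>A r\<close> is constant on each of them, which turns integrals over finite unions of
  rectangles into finite sums.\<close>

definition atom :: "('r \<Rightarrow> 'a set) \<Rightarrow> 'r set \<Rightarrow> 'r set \<Rightarrow> 'a set" where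
  "atom A R S = {x. \<forall>r\<in>R. x \<in> A r \<longleftrightarrow> r \<in> S}"

lemma sets_atom:
  assumes "finite R" "\<And>r. r \<in> R \<Longrightarrow> A r \<in> sets M" "space M = UNIV"
  shows "atom A R S \<in> sets M"
proof -
  have "{x \<in> space M. \<forall>r\<in>R. x \<in> A r \<longleftrightarrow> r \<in> S} \<in> sets M"
  proof (rule sets.sets_Collect_finite_All[OF _ assms(1)])
    fix r assume r: "r \<in> R"
    show "{x \<in> space M. (x \<in> A r) = (r \<in> S)} \<in> sets M"
    proof (cases "r \<in> S")
      case True
      then have "{x \<in> space M. (x \<in> A r) = (r \<in> S)} = A r" using assms(3) by auto
      then show ?thesis using assms(2)[OF r] by simp
    next
      case False
      then have "{x \<in> space M. (x \<in> A r) = (r \<in> S)} = space M - A r" using assms(3) by auto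
      then show ?thesis using assms(2)[OF r] by simp
    qed
  qed
  then show ?thesis using assms(3) by (simp add: atom_def)
qed

lemma emeasure_Union_atoms:
  assumes R: "finite R" "\<And>r. r \<in> R \<Longrightarrow> B r \<in> sets N" "space N = UNIV" and S: "S \<subseteq> R"
  shows "emeasure N (\<Union>r\<in>S. B r) = (\<Sum>T\<in>Pow R. if S \<inter> T = {} then 0 else emeasure N (atom B R T))"
proof -
  have "(\<Sum>T\<in>Pow R. if S \<inter> T = {} then 0 else emeasure N (atom B R T)) =
      (\<Sum>T\<in>{T\<in>Pow R. S \<inter> T \<noteq> {}}. emeasure N (atom B R T))"
    using R(1) by (subst sum.inter_filter, simp, intro sum.cong refl, simp)
  also have "\<dots> = emeasure N (\<Union>T\<in>{T\<in>Pow R. S \<inter> T \<noteq> {}}. atom B R T)"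
  proof (rule sum_emeasure)
    show "atom B R ` {T \<in> Pow R. S \<inter> T \<noteq> {}} \<subseteq> sets N"
      using sets_atom[of R B N, OF R] by blast
    show "disjoint_family_on (atom B R) {T \<in> Pow R. S \<inter> T \<noteq> {}}"
    proof (unfold disjoint_family_on_def, intro ballI impI)
      fix T T' assume T: "T \<in> {T \<in> Pow R. S \<inter> T \<noteq> {}}" "T' \<in> {T \<in> Pow R. S \<inter> T \<noteq> {}}" "T \<noteq> T'"
      then obtain r where "r \<in> R" "(r \<in> T) \<noteq> (r \<in> T')" by auto
      then show "atom B R T \<inter> atom B R T' = {}" by (auto simp: atom_def)
    qed
    show "finite {T \<in> Pow R. S \<inter> T \<noteq> {}}" using R(1) by simp
  qed
  also have "(\<Union>T\<in>{T\<in>Pow R. S \<inter> T \<noteq> {}}. atom B R T) = (\<Union>r\<in>S. B r)" (is "?L = ?R")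
  proof
    show "?L \<subseteq> ?R"
    proof
      fix y assume "y \<in> ?L"
      then obtain T r where "r \<in> S" "r \<in> T" "y \<in> atom B R T" by blast
      then show "y \<in> ?R" using S by (auto simp: atom_def)
    qed
    show "?R \<subseteq> ?L"
    proof
      fix y assume "y \<in> ?R"
      then obtain r where "r \<in> S" "y \<in> B r" by blast
      then show "y \<in> ?L" using S
        by (intro UN_I[of "{r\<in>R. y \<in> B r}"]) (auto simp: atom_def)
    qed
  qed
  finally show ?thesis by simp
qed

text \<open>The section over \<open>x\<close> of the union of the rectangles
  \<open>A r \<times> B r\<close> depends only on the atom containing \<open>x\<close>. The point of
  the formula is its symmetry: exchanging the two factors gives the same sum, which is Tonelli's
  theorem for finite unions of rectangles.\<close>

lemma nn_integral_rectangles: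
  assumes R: "finite R" "\<And>r. r \<in> R \<Longrightarrow> A r \<in> sets M" "space M = UNIV"
    "\<And>r. r \<in> R \<Longrightarrow> B r \<in> sets N" "space N = UNIV"
  shows "(\<integral>\<^sup>+x. emeasure N (\<Union>r\<in>{r\<in>R. x \<in> A r}. B r) \<partial>M) =
    (\<Sum>S\<in>Pow R. \<Sum>T\<in>Pow R. if S \<inter> T = {} then 0 else emeasure M (atom A R S) * emeasure N (atom B R T))"
proof -
  have sa [measurable]: "atom A R S \<in> sets M" for S
    using R(1-3) by (rule sets_atom)
  have "(\<integral>\<^sup>+x. emeasure N (\<Union>r\<in>{r\<in>R. x \<in> A r}. B r) \<partial>M) =
    (\<integral>\<^sup>+x. (\<Sum>S\<in>Pow R. \<Sum>T\<in>Pow R. (if S \<inter> T = {} then 0 else emeasure N (atom B R T)) * indicator (atom A R S) x) \<partial>M)"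
  proof (rule nn_integral_cong)
    fix x
    let ?S = "{r\<in>R. x \<in> A r}"
    have "emeasure N (\<Union>r\<in>?S. B r) = (\<Sum>T\<in>Pow R. if ?S \<inter> T = {} then 0 else emeasure N (atom B R T))"
      by (rule emeasure_Union_atoms[OF R(1,4,5)]) auto
    also have "\<dots> = (\<Sum>S\<in>Pow R. if S = ?S then \<Sum>T\<in>Pow R. if ?S \<inter> T = {} then 0 else emeasure N (atom B R T) else 0)"
      using R(1) by (subst sum.delta) auto
    also have "\<dots> = (\<Sum>S\<in>Pow R. \<Sum>T\<in>Pow R. (if S \<inter> T = {} then 0 else emeasure N (atom B R T)) * indicator (atom A R S) x)"
    proof (rule sum.cong[OF refl])
      fix S assume "S \<in> Pow R"
      then have "indicator (atom A R S) x = (if S = ?S then 1 else 0 :: ennreal)"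
        by (auto simp: atom_def indicator_def)
      then show "(if S = ?S then \<Sum>T\<in>Pow R. if ?S \<inter> T = {} then 0 else emeasure N (atom B R T) else 0) =
          (\<Sum>T\<in>Pow R. (if S \<inter> T = {} then 0 else emeasure N (atom B R T)) * indicator (atom A R S) x)"
        by (cases "S = ?S") simp_all
    qed
    finally show "emeasure N (\<Union>r\<in>?S. B r) = \<dots>" .
  qed
  also have "\<dots> = (\<Sum>S\<in>Pow R. \<integral>\<^sup>+x. (\<Sum>T\<in>Pow R.
      (if S \<inter> T = {} then 0 else emeasure N (atom B R T)) * indicator (atom A R S) x) \<partial>M)"
    by (intro nn_integral_sum) measurable
  also have "\<dots> = (\<Sum>S\<in>Pow R. \<Sum>T\<in>Pow R. \<integral>\<^sup>+x.
      (if S \<inter> T = {} then 0 else emeasure N (atom B R T)) * indicator (atom A R S) x \<partial>M)"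
    by (intro sum.cong refl nn_integral_sum) measurable
  also have "\<dots> = (\<Sum>S\<in>Pow R. \<Sum>T\<in>Pow R.
      (if S \<inter> T = {} then 0 else emeasure N (atom B R T)) * emeasure M (atom A R S))"
    by (intro sum.cong refl nn_integral_cmult_indicator sa)
  also have "\<dots> = (\<Sum>S\<in>Pow R. \<Sum>T\<in>Pow R. if S \<inter> T = {} then 0 else emeasure M (atom A R S) * emeasure N (atom B R T))"
    by (intro sum.cong refl) (simp add: ac_simps)
  finally show ?thesis .
qed

text \<open>The measure of the section at \<open>x\<close> is lower semicontinuous in
  \<open>x\<close>: a point in all those \<open>A r\<close> that contain \<open>x\<close> has a
  section at least as large, and finiteness of \<open>R\<close> makes these points a neighbourhood.
  Hence both the inner measure and the outer integral commute with the directed union.\<close>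

lemma nn_integral_sections_directed:
  fixes M :: "'a::t2_space measure" and N :: "'b::t2_space measure"
  assumes M: "radon_measure M" and N: "radon_measure N" and ne: "\<R> \<noteq> {}"
    and op: "\<And>R r. R \<in> \<R> \<Longrightarrow> r \<in> R \<Longrightarrow> open (A r) \<and> open (B r)"
    and fin: "\<And>R. R \<in> \<R> \<Longrightarrow> finite R"
    and un: "\<And>R R'. R \<in> \<R> \<Longrightarrow> R' \<in> \<R> \<Longrightarrow> R \<union> R' \<in> \<R>"
  shows "(\<integral>\<^sup>+x. emeasure N (\<Union>R\<in>\<R>. \<Union>r\<in>{r\<in>R. x \<in> A r}. B r) \<partial>M) =
    (SUP R\<in>\<R>. \<integral>\<^sup>+x. emeasure N (\<Union>r\<in>{r\<in>R. x \<in> A r}. B r) \<partial>M)"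
proof -
  define f where "f R x = emeasure N (\<Union>r\<in>{r\<in>R. x \<in> A r}. B r)" for R x
  have opU: "open (\<Union>r\<in>{r\<in>R. x \<in> A r}. B r)" if "R \<in> \<R>" for R x
    using op[OF that] by auto
  then have sets: "(\<Union>r\<in>{r\<in>R. x \<in> A r}. B r) \<in> sets N" if "R \<in> \<R>" for R x
    using that N by (simp add: radon_sets)
  have "emeasure N (\<Union>R\<in>\<R>. \<Union>r\<in>{r\<in>R. x \<in> A r}. B r) = (SUP R\<in>\<R>. f R x)" for x
    unfolding f_def
  proof (rule emeasure_directed_Union_open[OF N ne opU])
    fix R R' assume "R \<in> \<R>" "R' \<in> \<R>"
    then show "\<exists>R''\<in>\<R>. (\<Union>r\<in>{r\<in>R. x \<in> A r}. B r) \<union> (\<Union>r\<in>{r\<in>R'. x \<in> A r}. B r)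
        \<subseteq> (\<Union>r\<in>{r\<in>R''. x \<in> A r}. B r)"
      by (intro bexI[of _ "R \<union> R'"] un) auto
  qed
  then have "(\<integral>\<^sup>+x. emeasure N (\<Union>R\<in>\<R>. \<Union>r\<in>{r\<in>R. x \<in> A r}. B r) \<partial>M) = (\<integral>\<^sup>+x. (SUP R\<in>\<R>. f R x) \<partial>M)"
    by simp
  also have "\<dots> = (SUP R\<in>\<R>. \<integral>\<^sup>+x. f R x \<partial>M)"
  proof (rule nn_integral_directed_SUP_lsc[OF M ne])
    fix R c assume R: "R \<in> \<R>"
    show "open {x. c < f R x}"
    proof (subst open_subopen, intro ballI)
      fix x assume x: "x \<in> {x. c < f R x}"
      let ?U = "\<Inter>r\<in>{r\<in>R. x \<in> A r}. A r"
      have "?U \<subseteq> {x. c < f R x}"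
      proof
        fix x' assume "x' \<in> ?U"
        then have "f R x \<le> f R x'" unfolding f_def
          by (intro emeasure_mono sets[OF R]) auto
        then show "x' \<in> {x. c < f R x}" using x by auto
      qed
      moreover have "open ?U" using fin[OF R] op[OF R] by (intro open_INT) auto
      ultimately show "\<exists>T. open T \<and> x \<in> T \<and> T \<subseteq> {x. c < f R x}" by blast
    qed
  next
    fix R R' assume RR: "R \<in> \<R>" "R' \<in> \<R>"
    then have "\<forall>x. f R x \<le> f (R \<union> R') x \<and> f R' x \<le> f (R \<union> R') x"
      unfolding f_def by (intro allI conjI emeasure_mono sets[OF un[OF RR]]) auto
    then show "\<exists>k\<in>\<R>. \<forall>x. f R x \<le> f k x \<and> f R' x \<le> f k x" using un[OF RR] by blast
  qed
  finally show ?thesis unfolding f_def .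
qed

text \<open>An open set is the directed union of the finite unions of open rectangles inside it, and
  both iterated integrals commute with such unions.\<close>

lemma tonelli_open:
  fixes M :: "'a::t2_space measure" and N :: "'b::t2_space measure"
  assumes M: "radon_measure M" and N: "radon_measure N" and W: "open W"
  shows "(\<integral>\<^sup>+x. emeasure N {y. (x, y) \<in> W} \<partial>M) = (\<integral>\<^sup>+y. emeasure M {x. (x, y) \<in> W} \<partial>N)"
proof -
  define \<R> where "\<R> = {R. finite R \<and> (\<forall>r\<in>R. open (fst r) \<and> open (snd r) \<and> fst r \<times> snd r \<subseteq> W)}"
  have ne: "\<R> \<noteq> {}" unfolding \<R>_def by auto
  have un: "R \<union> R' \<in> \<R>" if "R \<in> \<R>" "R' \<in> \<R>" for R R' using that unfolding \<R>_def by auto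
  have op: "open (fst r) \<and> open (snd r)" "open (snd r) \<and> open (fst r)"
    if "R \<in> \<R>" "r \<in> R" for R r
    using that unfolding \<R>_def by auto
  have fin: "finite R" if "R \<in> \<R>" for R using that unfolding \<R>_def by auto
  have sub: "(x, y) \<in> W" if "R \<in> \<R>" "r \<in> R" "x \<in> fst r" "y \<in> snd r" for R r x y
  proof -
    have "fst r \<times> snd r \<subseteq> W" using that unfolding \<R>_def by auto
    then show ?thesis using that by auto
  qed
  have cover: "\<exists>R\<in>\<R>. \<exists>r\<in>R. x \<in> fst r \<and> y \<in> snd r" if xy: "(x, y) \<in> W" for x y
  proof -
    obtain A B where "open A" "open B" "(x, y) \<in> A \<times> B" "A \<times> B \<subseteq> W"
      using open_prod_elim[OF W xy] by (metis SigmaI)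
    then show ?thesis unfolding \<R>_def by (intro bexI[of _ "{(A, B)}"]) auto
  qed
  have mem: "(x, y) \<in> W \<longleftrightarrow> (\<exists>R\<in>\<R>. \<exists>r\<in>R. x \<in> fst r \<and> y \<in> snd r)" for x y
    by (meson cover sub)
  have sections: "{y. (x, y) \<in> W} = (\<Union>R\<in>\<R>. \<Union>r\<in>{r\<in>R. x \<in> fst r}. snd r)"
    "{x. (x, y) \<in> W} = (\<Union>R\<in>\<R>. \<Union>r\<in>{r\<in>R. y \<in> snd r}. fst r)" for x y
    unfolding mem by auto
  have "(\<integral>\<^sup>+x. emeasure N (\<Union>r\<in>{r\<in>R. x \<in> fst r}. snd r) \<partial>M) =
      (\<integral>\<^sup>+y. emeasure M (\<Union>r\<in>{r\<in>R. y \<in> snd r}. fst r) \<partial>N)" if R: "R \<in> \<R>" for R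
  proof -
    have A: "fst r \<in> sets M" and B: "snd r \<in> sets N" if "r \<in> R" for r
      using op[OF R that] M N by (auto simp: radon_sets)
    note 1 = nn_integral_rectangles[where A = fst and B = snd, OF fin[OF R] A radon_space[OF M] B radon_space[OF N]]
    note 2 = nn_integral_rectangles[where A = snd and B = fst, OF fin[OF R] B radon_space[OF N] A radon_space[OF M]]
    have "(\<integral>\<^sup>+x. emeasure N (\<Union>r\<in>{r\<in>R. x \<in> fst r}. snd r) \<partial>M) = (\<Sum>S\<in>Pow R. \<Sum>T\<in>Pow R.
        if S \<inter> T = {} then 0 else emeasure M (atom fst R S) * emeasure N (atom snd R T))"
      by (rule 1)
    also have "\<dots> = (\<Sum>T\<in>Pow R. \<Sum>S\<in>Pow R.
        if S \<inter> T = {} then 0 else emeasure M (atom fst R S) * emeasure N (atom snd R T))"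
      by (rule sum.swap)
    also have "\<dots> = (\<Sum>T\<in>Pow R. \<Sum>S\<in>Pow R.
        if T \<inter> S = {} then 0 else emeasure N (atom snd R T) * emeasure M (atom fst R S))"
      by (intro sum.cong refl) (simp add: Int_commute ac_simps)
    also have "\<dots> = (\<integral>\<^sup>+y. emeasure M (\<Union>r\<in>{r\<in>R. y \<in> snd r}. fst r) \<partial>N)"
      by (rule 2[symmetric])
    finally show ?thesis .
  qed
  then have "(SUP R\<in>\<R>. \<integral>\<^sup>+x. emeasure N (\<Union>r\<in>{r\<in>R. x \<in> fst r}. snd r) \<partial>M) =
      (SUP R\<in>\<R>. \<integral>\<^sup>+y. emeasure M (\<Union>r\<in>{r\<in>R. y \<in> snd r}. fst r) \<partial>N)"
    by (rule SUP_cong[OF refl])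
  then show ?thesis
    using nn_integral_sections_directed[where \<R> = \<R>, OF M N ne op(1) fin un]
      nn_integral_sections_directed[where \<R> = \<R>, OF N M ne op(2) fin un]
    unfolding sections by simp
qed

section \<open>Invariant integration\<close>

lemma ennreal_le_if_add_eps:
  fixes a b :: ennreal
  assumes "\<And>e::real. 0 < e \<Longrightarrow> a \<le> c * (b + ennreal e)" "c < \<infinity>"
  shows "a \<le> c * b"
proof (cases "c = 0")
  case True
  then show ?thesis using assms(1)[of 1] by simp
next
  case False
  obtain r where r: "c = ennreal r" "0 < r" using False assms(2) by (cases c) auto
  show ?thesis
  proof (rule ennreal_le_epsilon)
    fix e :: real assume "0 < e"
    then have "a \<le> c * (b + ennreal (e / r))" using r by (intro assms(1)) simp
    also have "\<dots> = c * b + ennreal e" using r \<open>0 < e\<close>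
      by (simp add: distrib_left ennreal_mult[symmetric])
    finally show "a \<le> c * b + ennreal e" .
  qed
qed

lemma radon_outer:
  assumes M: "radon_measure M" and A: "A \<in> sets borel" "emeasure M A < \<infinity>" and e: "0 < (e::real)"
  obtains U where "open U" "A \<subseteq> U" "emeasure M U < emeasure M A + ennreal e"
proof -
  have "emeasure M A = (INF U\<in>{U. open U \<and> A \<subseteq> U}. emeasure M U)"
    using M A(1) unfolding radon_measure_def by blast
  moreover have "emeasure M A < emeasure M A + ennreal e"
    using A(2) e ennreal_add_left_cancel_less[of "emeasure M A" 0 "ennreal e"] by simp
  ultimately have "(INF U\<in>{U. open U \<and> A \<subseteq> U}. emeasure M U) < emeasure M A + ennreal e" by simp
  then show thesis using that unfolding INF_less_iff by auto
qed

lemma radon_outer_diff: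
  assumes M: "radon_measure M" and A: "A \<in> sets borel" "emeasure M A < \<infinity>" and e: "0 < (e::real)"
  obtains U where "open U" "A \<subseteq> U" "emeasure M U < \<infinity>" "emeasure M (U - A) < ennreal e"
proof -
  obtain U where U: "open U" "A \<subseteq> U" "emeasure M U < emeasure M A + ennreal e"
    by (rule radon_outer[OF assms])
  have s: "A \<in> sets M" "U \<in> sets M" using A U radon_sets[OF M] by auto
  have "emeasure M (U - A) = emeasure M U - emeasure M A"
    using A U s by (intro emeasure_Diff) auto
  also have "\<dots> < ennreal e"
    using U(3) A(2) by (subst minus_less_iff_ennreal) (auto simp: add.commute intro!: emeasure_mono U s)
  finally have "emeasure M (U - A) < ennreal e" .
  moreover have "emeasure M A + ennreal e < \<infinity>" using A(2) by simp
  then have "emeasure M U < \<infinity>" by (rule order_less_trans[OF U(3)])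
  ultimately show thesis using U(1,2) by (rule_tac that)
qed

lemma radon_inner_diff:
  assumes M: "radon_measure M" and U: "open U" "emeasure M U < \<infinity>" and e: "0 < (e::real)"
  obtains K where "compact K" "K \<subseteq> U" "emeasure M (U - K) < ennreal e"
\<comment> \<open>If \<open>U\<close> itself is smaller than \<open>e\<close>, the empty compact set
  works; otherwise \<open>r - e\<close> is nonnegative and \<open>ennreal\<close> does not truncate
  it.\<close>
proof (cases "emeasure M U < ennreal e")
  case True
  then show thesis using that[of "{}"] by simp
next
  case False
  have eq: "emeasure M U = (SUP K\<in>{K. compact K \<and> K \<subseteq> U}. emeasure M K)"
    using M U unfolding radon_measure_def by blast
  obtain r where r: "emeasure M U = ennreal r" "0 \<le> r" using U(2) by (cases "emeasure M U") auto
  then have "e \<le> r" using False e by (simp add: ennreal_less_iff)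
  then have "ennreal (r - e) < emeasure M U" using r e by (simp add: ennreal_less_iff)
  then obtain K where K: "compact K" "K \<subseteq> U" "ennreal (r - e) < emeasure M K"
    unfolding eq less_SUP_iff by auto
  have s: "K \<in> sets M" "U \<in> sets M" using K U radon_sets[OF M] by (auto simp: borel_compact)
  have "emeasure M K \<le> emeasure M U" using s K by (intro emeasure_mono) auto
  then obtain k where k: "emeasure M K = ennreal k" "0 \<le> k" using r by (cases "emeasure M K") (auto simp: top_unique)
  have "emeasure M (U - K) = emeasure M U - emeasure M K"
    using k K s by (intro emeasure_Diff) auto
  also have "\<dots> = ennreal (r - k)" using r k by (simp add: ennreal_minus)
  also have "\<dots> < ennreal e" using K(3) k r e \<open>e \<le> r\<close> by (intro ennreal_lessI) (auto simp: ennreal_less_iff)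
  finally show thesis using that K by blast
qed

locale unimodular_haar =
  fixes M :: "'a::{topological_group_add, t2_space} measure"
  assumes haar: "haar_measure M" and unimodular: "unimodular M"
begin

lemma radon: "radon_measure M"
  using haar unfolding haar_measure_def by blast

lemma sets_M [simp, measurable_cong]: "sets M = sets borel"
  by (rule radon_sets[OF radon])

lemma space_M [simp]: "space M = UNIV"
  by (rule radon_space[OF radon])

lemma measurable_translations [measurable]:
  fixes g :: 'a
  shows "(\<lambda>x. g + x) \<in> borel_measurable borel"
    "(\<lambda>x. x + g) \<in> borel_measurable borel"
    "(\<lambda>x::'a. - x) \<in> borel_measurable borel"
  by (intro borel_measurable_continuous_onI continuous_intros)+

lemma emeasure_left: "A \<in> sets borel \<Longrightarrow> emeasure M {x. g + x \<in> A} = emeasure M A"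
proof -
  assume A: "A \<in> sets borel"
  have "{x. g + x \<in> A} = (\<lambda>x. - g + x) ` A"
    by (auto simp: image_iff intro!: bexI[of _ "g + _"])
  then show ?thesis using haar A unfolding haar_measure_def by simp
qed

lemma emeasure_right: "A \<in> sets borel \<Longrightarrow> emeasure M {x. x + g \<in> A} = emeasure M A"
proof -
  assume A: "A \<in> sets borel"
  have "{x. x + g \<in> A} = (\<lambda>x. x + - g) ` A"
    by (auto simp: image_iff add.assoc intro!: bexI[of _ "_ + g"])
  moreover have "emeasure M ((\<lambda>x. x + - g) ` A) = emeasure M A"
    using unimodular A unfolding unimodular_def by blast
  ultimately show ?thesis by (simp only:)
qed

lemma ex_open_pos_finite: "\<exists>A. open A \<and> 0 < emeasure M A \<and> emeasure M A < \<infinity>"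
proof -
  have "emeasure M UNIV = (SUP K\<in>{K. compact K \<and> K \<subseteq> UNIV}. emeasure M K)"
    using radon unfolding radon_measure_def by blast
  moreover have "0 < emeasure M UNIV" using haar unfolding haar_measure_def by (simp add: zero_less_iff_neq_zero)
  ultimately obtain K where K: "compact K" "0 < emeasure M K" by (auto simp: less_SUP_iff)
  have f: "emeasure M K < \<infinity>" using radon K(1) by (simp add: radon_measure_def)
  obtain U where U: "open U" "K \<subseteq> U" "emeasure M U < \<infinity>"
    by (rule radon_outer_diff[OF radon borel_compact[OF K(1)] f zero_less_one])
  have "emeasure M K \<le> emeasure M U" using U by (intro emeasure_mono) auto
  with K(2) have "0 < emeasure M U" by (rule order_less_le_trans)
  then show ?thesis using U(1,3) by blast
qed

text \<open>The product \<open>emeasure M A * emeasure M B\<close> is the double integral over the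
  pairs with x + y in A and y in B, by right invariance in x. A left translation of y by x turns
  this region into y in A, - x + y in B; integrating over x first now gives the measure of the
  inverse of B, by left invariance. As A has positive finite measure, it cancels.\<close>

lemma emeasure_uminus_open:
  assumes B: "open B"
  shows "emeasure M {x. - x \<in> B} = emeasure M B"
proof -
  obtain A where A: "open A" "0 < emeasure M A" "emeasure M A < \<infinity>" using ex_open_pos_finite by blast
  let ?V = "(\<lambda>p. fst p + snd p) -` A \<inter> snd -` B :: ('a \<times> 'a) set"
  let ?W = "snd -` A \<inter> (\<lambda>p. - fst p + snd p) -` B :: ('a \<times> 'a) set"
  have oV: "open ?V" and oW: "open ?W"
    using A B by (auto intro!: open_Int open_vimage continuous_intros)
  have "open ((\<lambda>x. - x) -` B)" by (intro open_vimage B continuous_intros)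
  then have [simp]: "A \<in> sets borel" "B \<in> sets borel" "{x. - x \<in> B} \<in> sets borel"
    using A B by (auto simp: vimage_def)
  have "emeasure M A * emeasure M B = (\<integral>\<^sup>+y. emeasure M A * indicator B y \<partial>M)"
    by (simp add: nn_integral_cmult_indicator)
  also have "\<dots> = (\<integral>\<^sup>+y. emeasure M {x. (x, y) \<in> ?V} \<partial>M)"
    by (intro nn_integral_cong) (auto simp: indicator_def emeasure_right)
  also have "\<dots> = (\<integral>\<^sup>+x. emeasure M {y. (x, y) \<in> ?V} \<partial>M)"
    by (rule tonelli_open[OF radon radon oV, symmetric])
  also have "\<dots> = (\<integral>\<^sup>+x. emeasure M {y. (x, y) \<in> ?W} \<partial>M)"
  proof (rule nn_integral_cong)
    fix x
    have "open (A \<inter> (\<lambda>y. - x + y) -` B)" using A B by (intro open_Int open_vimage continuous_intros)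
    moreover have "{y. (x, y) \<in> ?W} = A \<inter> (\<lambda>y. - x + y) -` B" by auto
    ultimately have "{y. (x, y) \<in> ?W} \<in> sets borel" by simp
    then show "emeasure M {y. (x, y) \<in> ?V} = emeasure M {y. (x, y) \<in> ?W}"
      using emeasure_left[of "{y. (x, y) \<in> ?W}" x] by simp
  qed
  also have "\<dots> = (\<integral>\<^sup>+y. emeasure M {x. (x, y) \<in> ?W} \<partial>M)"
    by (rule tonelli_open[OF radon radon oW])
  also have "\<dots> = (\<integral>\<^sup>+y. emeasure M {x. - x \<in> B} * indicator A y \<partial>M)"
  proof (rule nn_integral_cong)
    fix y
    have "{x. - x + y \<in> B} = {x. - y + x \<in> {x. - x \<in> B}}"
      by (simp add: minus_add)
    moreover have "emeasure M {x. - y + x \<in> {x. - x \<in> B}} = emeasure M {x. - x \<in> B}"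
      by (rule emeasure_left) simp
    ultimately have "emeasure M {x. - x + y \<in> B} = emeasure M {x. - x \<in> B}" by (simp only:)
    then show "emeasure M {x. (x, y) \<in> ?W} = emeasure M {x. - x \<in> B} * indicator A y"
      by (auto simp: indicator_def)
  qed
  also have "\<dots> = emeasure M {x. - x \<in> B} * emeasure M A"
    by (simp add: nn_integral_cmult_indicator)
  finally have "emeasure M A * emeasure M B = emeasure M A * emeasure M {x. - x \<in> B}"
    by (simp add: mult.commute)
  then show ?thesis using A(2,3) by (auto simp: ennreal_mult_cancel_left)
qed

text \<open>Outer regularity transfers one inequality from open sets; applied to the inverse of
  \<open>B\<close> it yields the other.\<close>

lemma emeasure_uminus:
  assumes B: "B \<in> sets borel"
  shows "emeasure M {x. - x \<in> B} = emeasure M B"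
proof -
  have le: "emeasure M {x. - x \<in> C} \<le> emeasure M C" if C: "C \<in> sets borel" for C
  proof -
    have "emeasure M C = (INF U\<in>{U. open U \<and> C \<subseteq> U}. emeasure M U)"
      using radon C unfolding radon_measure_def by blast
    also have "\<dots> \<ge> emeasure M {x. - x \<in> C}"
    proof (rule INF_greatest)
      fix U assume U: "U \<in> {U. open U \<and> C \<subseteq> U}"
      then have "open ((\<lambda>x. - x) -` U)" by (intro open_vimage continuous_intros) auto
      then have "emeasure M {x. - x \<in> C} \<le> emeasure M {x. - x \<in> U}"
        using U by (intro emeasure_mono) (auto simp: vimage_def)
      then show "emeasure M {x. - x \<in> C} \<le> emeasure M U" using U by (simp add: emeasure_uminus_open)
    qed
    finally show ?thesis .
  qed
  have "(\<lambda>x. - x) -` B \<inter> space borel \<in> sets borel" by (rule measurable_sets[OF measurable_translations(3) B])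
  then have "{x. - x \<in> B} \<in> sets borel" by (simp add: vimage_def)
  from le[OF this] have "emeasure M B \<le> emeasure M {x. - x \<in> B}" by simp
  with le[OF B] show ?thesis by (rule antisym)
qed

lemma distr_left: "distr M M (\<lambda>x. g + x) = M"
  by (rule measure_eqI) (auto simp: emeasure_distr vimage_def emeasure_left)

lemma distr_right: "distr M M (\<lambda>x. x + g) = M"
  by (rule measure_eqI) (auto simp: emeasure_distr vimage_def emeasure_right)

lemma distr_uminus: "distr M M (\<lambda>x. - x) = M"
  by (rule measure_eqI) (auto simp: emeasure_distr vimage_def emeasure_uminus)

context
  fixes f :: "'a \<Rightarrow> real"
begin

lemma integrable_left: "integrable M f \<Longrightarrow> integrable M (\<lambda>x. f (g + x))"
  using integrable_distr[of "\<lambda>x. g + x" M M f] distr_left[of g] by simp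

lemma integrable_right: "integrable M f \<Longrightarrow> integrable M (\<lambda>x. f (x + g))"
  using integrable_distr[of "\<lambda>x. x + g" M M f] distr_right[of g] by simp

lemma integrable_uminus: "integrable M f \<Longrightarrow> integrable M (\<lambda>x. f (- x))"
  using integrable_distr[of "\<lambda>x. - x" M M f] distr_uminus by simp

lemma integral_left: "f \<in> borel_measurable borel \<Longrightarrow> (LINT x|M. f (g + x)) = (LINT x|M. f x)"
  using integral_distr[of "\<lambda>x. g + x" M M f] distr_left[of g] by simp

lemma integral_right: "f \<in> borel_measurable borel \<Longrightarrow> (LINT x|M. f (x + g)) = (LINT x|M. f x)"
  using integral_distr[of "\<lambda>x. x + g" M M f] distr_right[of g] by simp

lemma integral_uminus: "f \<in> borel_measurable borel \<Longrightarrow> (LINT x|M. f (- x)) = (LINT x|M. f x)"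
  using integral_distr[of "\<lambda>x. - x" M M f] distr_uminus by simp

end

lemma borel_measurable_M [simp]: "borel_measurable M = borel_measurable borel"
  by (rule measurable_cong_sets) auto

end

section \<open>Continuity of translations in the L^1-norm and of convolutions\<close>

lemma compact_translate_nhd:
  fixes K :: "'a::{topological_group_add, t2_space} set"
  assumes K: "compact K" "K \<subseteq> U" and U: "open U"
  shows "\<exists>N. open N \<and> 0 \<in> N \<and> (\<forall>u\<in>N. \<forall>x\<in>K. u + x \<in> U)"
proof -
  \<comment> \<open>Tube lemma for the open set \<open>?W\<close> around the product of {0} and
    \<open>K\<close>.\<close>
  let ?W = "(\<lambda>p::'a \<times> 'a. fst p + snd p) -` U"
  have W: "open ?W" by (intro open_vimage U continuous_intros)
  have "\<forall>x\<in>K. \<exists>q. open (fst q) \<and> open (snd q) \<and> 0 \<in> fst q \<and> x \<in> snd q \<and> fst q \<times> snd q \<subseteq> ?W"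
  proof
    fix x assume "x \<in> K"
    then have "(0, x) \<in> ?W" using K(2) by auto
    from W this obtain A B where AB: "open A" "open B" "(0, x) \<in> A \<times> B" "A \<times> B \<subseteq> ?W"
      by (rule open_prod_elim)
    from AB(3) have "0 \<in> A" "x \<in> B" by simp_all
    with AB show "\<exists>q. open (fst q) \<and> open (snd q) \<and> 0 \<in> fst q \<and> x \<in> snd q \<and> fst q \<times> snd q \<subseteq> ?W"
      by (intro exI[of _ "(A, B)"]) simp
  qed
  from bchoice[OF this] obtain q where q: "\<forall>x\<in>K. open (fst (q x)) \<and> open (snd (q x)) \<and> 0 \<in> fst (q x)
      \<and> x \<in> snd (q x) \<and> fst (q x) \<times> snd (q x) \<subseteq> ?W" ..
  define A B where "A x = fst (q x)" and "B x = snd (q x)" for x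
  have AB: "open (A x)" "open (B x)" "0 \<in> A x" "x \<in> B x" "A x \<times> B x \<subseteq> ?W" if "x \<in> K" for x
    using bspec[OF q that] unfolding A_def B_def by simp_all
  have "K \<subseteq> (\<Union>x\<in>K. B x)" using AB(4) by auto
  from compactE_image[OF K(1) AB(2) this]
  obtain F where F: "F \<subseteq> K" "finite F" "K \<subseteq> (\<Union>x\<in>F. B x)" by auto
  have "open (\<Inter>x\<in>F. A x)" using F AB(1) by (intro open_INT) auto
  moreover have "0 \<in> (\<Inter>x\<in>F. A x)" using F AB(3) by auto
  moreover have "u + y \<in> U" if uy: "u \<in> (\<Inter>x\<in>F. A x)" "y \<in> K" for u y
  proof -
    obtain x where x: "x \<in> F" "y \<in> B x" using F(3) uy(2) by auto
    then have "(u, y) \<in> A x \<times> B x" using uy(1) by auto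
    then have "(u, y) \<in> ?W" by (rule subsetD[OF AB(5)[OF subsetD[OF F(1) x(1)]]])
    then show ?thesis by simp
  qed
  ultimately show ?thesis by blast
qed

lemma continuous_on_from_translates:
  fixes p :: "'a::{topological_group_add, t2_space} \<Rightarrow> real"
  assumes "\<And>g e. 0 < e \<Longrightarrow> \<exists>N. open N \<and> 0 \<in> N \<and> (\<forall>u\<in>N. \<bar>p (u + g) - p g\<bar> < e)"
  shows "continuous_on UNIV p"
proof (rule continuous_at_imp_continuous_on, intro ballI)
  fix g
  show "isCont p g"
    unfolding isCont_def
  proof (rule tendstoI)
    fix e :: real assume "0 < e"
    from assms[OF this, of g] obtain N
      where N: "open N" "0 \<in> N" "\<And>u. u \<in> N \<Longrightarrow> \<bar>p (u + g) - p g\<bar> < e" by auto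
    have "open ((\<lambda>h. h - g) -` N)" by (intro open_vimage N(1) continuous_intros)
    moreover have "g \<in> (\<lambda>h. h - g) -` N" using N(2) by simp
    moreover have "dist (p h) (p g) < e" if "h \<in> (\<lambda>h. h - g) -` N" for h
      using N(3)[of "h - g"] that by (simp add: dist_real_def)
    ultimately show "\<forall>\<^sub>F h in at g. dist (p h) (p g) < e"
      unfolding eventually_at_topological by blast
  qed
qed

context unimodular_haar
begin

text \<open>By density the claim reduces to indicators of sets \<open>A\<close> of finite measure.
  Such a set lies in an open \<open>U\<close> that is hardly larger, \<open>U\<close> is almost
  filled by a compact \<open>K\<close>, and small translations keep \<open>K\<close> inside
  \<open>U\<close>.\<close>

lemma L1_continuous_translation:
  fixes f :: "'a \<Rightarrow> real"
  assumes "integrable M f" "0 < e"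
  shows "\<exists>N. open N \<and> 0 \<in> N \<and> (\<forall>u\<in>N. (LINT x|M. \<bar>f (u + x) - f x\<bar>) < e)"
  using assms
proof (induction arbitrary: e rule: integrable_induct)
  case (base A c)
  then have A: "A \<in> sets borel" "emeasure M A < \<infinity>" by auto
  \<comment> \<open>The indicator of \<open>A\<close> will be displaced by less than
    \<open>4 * d\<close>: two error sets of measure below \<open>d\<close>, each counted twice. The
    1 avoids a division by zero.\<close>
  define d where "d = e / (4 * (\<bar>c\<bar> + 1))"
  have d: "0 < d" unfolding d_def using base.prems by simp
  obtain U where U: "open U" "A \<subseteq> U" "emeasure M U < \<infinity>" "emeasure M (U - A) < ennreal d"
    by (rule radon_outer_diff[OF radon A d])
  obtain K where K: "compact K" "K \<subseteq> U" "emeasure M (U - K) < ennreal d"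
    by (rule radon_inner_diff[OF radon U(1,3) d])
  obtain N where N: "open N" "0 \<in> N" "\<And>u x. u \<in> N \<Longrightarrow> x \<in> K \<Longrightarrow> u + x \<in> U"
    using compact_translate_nhd[OF K(1,2) U(1)] by blast
  have sets: "U - A \<in> sets M" "U - K \<in> sets M" using A U K by (auto simp: borel_compact)
  have int: "integrable M (indicator A :: 'a \<Rightarrow> real)" "integrable M (indicator (U - A) :: 'a \<Rightarrow> real)"
    "integrable M (indicator (U - K) :: 'a \<Rightarrow> real)"
    using A sets U(4) K(3) order_less_trans[OF _ ennreal_less_top] by (auto intro!: integrable_real_indicator)
  have small: "measure M (U - A) < d" "measure M (U - K) < d"
    using U(4) K(3) d by (auto simp: measure_def enn2real_less_iff order_less_trans[OF _ ennreal_less_top])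
  have "(LINT x|M. \<bar>indicator A (u + x) *\<^sub>R c - indicator A x *\<^sub>R c\<bar>) < e" if u: "u \<in> N" for u
  proof -
    let ?h = "\<lambda>x. \<bar>indicator A (u + x) - indicator A x :: real\<bar>"
    have "(LINT x|M. ?h x) \<le> (LINT x|M. indicator A (u + x) - indicator A x
          + 2 * (indicator (U - K) x + indicator (U - A) (u + x)))"
    proof (rule integral_mono)
      \<comment> \<open>As |p| = p + 2 max 0 (- p), only the points with x in A and u + x outside A
        cost extra; for these either x lies in U - K or u + x lies in U - A. The term p itself
        integrates to 0 by invariance.\<close>
      show "?h x \<le> indicator A (u + x) - indicator A x + 2 * (indicator (U - K) x + indicator (U - A) (u + x))" for x
        using N(3)[OF u, of x] U(2) by (auto simp: indicator_def)
    qed (intro integrable_abs Bochner_Integration.integrable_diff Bochner_Integration.integrable_add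
        integrable_mult_right integrable_left int)+
    also have "\<dots> = (LINT x|M. indicator A (u + x)) - (LINT x|M. indicator A x)
          + 2 * ((LINT x|M. indicator (U - K) x) + (LINT x|M. indicator (U - A) (u + x)))"
      using int integrable_left[OF int(1)] integrable_left[OF int(2)] by simp
    also have "\<dots> = 2 * (measure M (U - K) + measure M (U - A))"
      using A sets by (subst (1 2) integral_left) auto
    also have "\<dots> < 4 * d" using small by simp
    finally have "(LINT x|M. ?h x) < 4 * d" .
    then have "\<bar>c\<bar> * (LINT x|M. ?h x) \<le> \<bar>c\<bar> * (4 * d)" by (intro mult_left_mono) auto
    also have "\<dots> < (\<bar>c\<bar> + 1) * (4 * d)" using d by (simp add: algebra_simps)
    also have "\<dots> = e" unfolding d_def by (simp add: field_simps)
    finally have "\<bar>c\<bar> * (LINT x|M. ?h x) < e" .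
    moreover have "(LINT x|M. \<bar>indicator A (u + x) *\<^sub>R c - indicator A x *\<^sub>R c\<bar>) = (LINT x|M. \<bar>c\<bar> * ?h x)"
      by (intro Bochner_Integration.integral_cong refl) (auto simp: indicator_def)
    ultimately show ?thesis by simp
  qed
  then show ?case using N(1,2) by (intro exI[of _ N]) auto
next
  case (add f g)
  obtain N where N: "open N" "0 \<in> N" "\<And>u. u \<in> N \<Longrightarrow> (LINT x|M. \<bar>f (u + x) - f x\<bar>) < e / 2"
    using add.IH(1)[of "e / 2"] add.prems by auto
  obtain N' where N': "open N'" "0 \<in> N'" "\<And>u. u \<in> N' \<Longrightarrow> (LINT x|M. \<bar>g (u + x) - g x\<bar>) < e / 2"
    using add.IH(2)[of "e / 2"] add.prems by auto
  have "(LINT x|M. \<bar>f (u + x) + g (u + x) - (f x + g x)\<bar>) < e" if u: "u \<in> N" "u \<in> N'" for u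
  proof -
    note i = integrable_left[OF add.hyps(1)] integrable_left[OF add.hyps(2)] add.hyps
    have "(LINT x|M. \<bar>f (u + x) + g (u + x) - (f x + g x)\<bar>) \<le> (LINT x|M. \<bar>f (u + x) - f x\<bar> + \<bar>g (u + x) - g x\<bar>)"
      using i by (intro integral_mono) auto
    also have "\<dots> = (LINT x|M. \<bar>f (u + x) - f x\<bar>) + (LINT x|M. \<bar>g (u + x) - g x\<bar>)"
      using i by (intro Bochner_Integration.integral_add) auto
    also have "\<dots> < e" using N(3)[OF u(1)] N'(3)[OF u(2)] by simp
    finally show ?thesis .
  qed
  then show ?case using N N' by (intro exI[of _ "N \<inter> N'"]) auto
next
  case (lim f s)
  have "(\<lambda>i. LINT x|M. \<bar>s i x - f x\<bar>) \<longlonglongrightarrow> (LINT x|M. 0)"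
  proof (rule integral_dominated_convergence[where w = "\<lambda>x. 3 * \<bar>f x\<bar>"])
    show "AE x in M. (\<lambda>i. \<bar>s i x - f x\<bar>) \<longlonglongrightarrow> 0"
      using lim.hyps(2) by (auto intro!: tendsto_rabs_zero LIM_zero)
    show "AE x in M. norm \<bar>s i x - f x\<bar> \<le> 3 * \<bar>f x\<bar>" for i
    proof (intro AE_I2)
      fix x show "norm \<bar>s i x - f x\<bar> \<le> 3 * \<bar>f x\<bar>" using lim.hyps(3)[of x i] by simp
    qed
  qed (use lim.hyps in auto)
  then have "eventually (\<lambda>i. (LINT x|M. \<bar>s i x - f x\<bar>) < e / 3) sequentially"
    using lim.prems by (intro order_tendstoD(2)) auto
  then obtain i where i: "(LINT x|M. \<bar>s i x - f x\<bar>) < e / 3"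
    by (auto simp: eventually_sequentially)
  obtain N where N: "open N" "0 \<in> N" "\<And>u. u \<in> N \<Longrightarrow> (LINT x|M. \<bar>s i (u + x) - s i x\<bar>) < e / 3"
    using lim.IH[of "e / 3" i] lim.prems by auto
  have "(LINT x|M. \<bar>f (u + x) - f x\<bar>) < e" if u: "u \<in> N" for u
  proof -
    note a = lim.hyps(4) lim.hyps(1)[of i]
    have b: "integrable M (\<lambda>x. \<bar>s i x - f x\<bar>)" using a by simp
    note c = a integrable_left[OF a(1), of u] integrable_left[OF a(2), of u] b integrable_left[OF b, of u]
    have "(LINT x|M. \<bar>f (u + x) - f x\<bar>) \<le>
        (LINT x|M. \<bar>s i (u + x) - f (u + x)\<bar> + \<bar>s i x - f x\<bar> + \<bar>s i (u + x) - s i x\<bar>)"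
      using c by (intro integral_mono) auto
    also have "\<dots> = (LINT x|M. \<bar>s i (u + x) - f (u + x)\<bar>) + (LINT x|M. \<bar>s i x - f x\<bar>) + (LINT x|M. \<bar>s i (u + x) - s i x\<bar>)"
      using c by simp
    also have "(LINT x|M. \<bar>s i (u + x) - f (u + x)\<bar>) = (LINT x|M. \<bar>s i x - f x\<bar>)"
      using b by (intro integral_left[where f = "\<lambda>x. \<bar>s i x - f x\<bar>"]) (auto dest: borel_measurable_integrable)
    finally show ?thesis using i N(3)[OF u] by simp
  qed
  then show ?case using N(1,2) by blast
qed

text \<open>Translating the argument of the convolution amounts to translating \<open>\<phi>\<close>
  under the integral. As \<open>\<psi>\<close> is bounded by 1, the change is at most the
  L^1-distance between \<open>\<phi>\<close> and its translate.\<close>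

lemma continuous_convolution:
  assumes \<phi>: "integrable M \<phi>" and \<psi>: "\<psi> \<in> borel_measurable borel" "\<And>x. \<bar>\<psi> x\<bar> \<le> 1"
  shows "continuous_on UNIV (group_convolution M \<phi> \<psi>)"
proof (rule continuous_on_from_translates)
  fix g and e :: real assume "0 < e"
  then obtain N where N: "open N" "0 \<in> N" "\<And>u. u \<in> N \<Longrightarrow> (LINT x|M. \<bar>\<phi> (u + x) - \<phi> x\<bar>) < e"
    using L1_continuous_translation[OF \<phi> \<open>0 < e\<close>] by auto
  have [measurable]: "\<phi> \<in> borel_measurable borel" using \<phi> by (auto dest: borel_measurable_integrable)
  note [measurable] = \<psi>(1)
  have tr [measurable]: "(\<lambda>x. \<psi> (- x + h)) \<in> borel_measurable borel" for h
    using measurable_compose[OF measurable_compose[OF measurable_translations(3) measurable_translations(2)] \<psi>(1)]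
    by simp
  have int: "integrable M (\<lambda>x. f x * \<psi> (- x + h))" if "integrable M f" for f h
  proof (rule Bochner_Integration.integrable_bound[OF that])
    show "AE x in M. norm (f x * \<psi> (- x + h)) \<le> norm (f x)"
      using \<psi>(2) by (intro AE_I2) (simp add: abs_mult mult_left_le)
  qed (use that in \<open>auto dest: borel_measurable_integrable\<close>)
  have "\<bar>group_convolution M \<phi> \<psi> (u + g) - group_convolution M \<phi> \<psi> g\<bar> < e" if u: "u \<in> N" for u
  proof -
    note i = integrable_left[OF \<phi>, of u]
    have "(LINT x|M. \<phi> x * \<psi> (- x + (u + g))) = (LINT x|M. \<phi> (u + x) * \<psi> (- (u + x) + (u + g)))"
      by (rule integral_left[symmetric, of "\<lambda>x. \<phi> x * \<psi> (- x + (u + g))"]) simp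
    also have "\<dots> = (LINT x|M. \<phi> (u + x) * \<psi> (- x + g))"
      by (metis (no_types, opaque_lifting) add.assoc minus_add minus_add_cancel)
    finally have "group_convolution M \<phi> \<psi> (u + g) - group_convolution M \<phi> \<psi> g =
        (LINT x|M. \<phi> (u + x) * \<psi> (- x + g)) - (LINT x|M. \<phi> x * \<psi> (- x + g))"
      unfolding group_convolution_def by simp
    also have "\<dots> = (LINT x|M. (\<phi> (u + x) - \<phi> x) * \<psi> (- x + g))"
      using int[OF i, of g] int[OF \<phi>, of g] by (simp add: left_diff_distrib)
    also have "\<bar>\<dots>\<bar> \<le> (LINT x|M. \<bar>(\<phi> (u + x) - \<phi> x) * \<psi> (- x + g)\<bar>)"
      by (rule integral_abs_bound)
    also have "\<dots> \<le> (LINT x|M. \<bar>\<phi> (u + x) - \<phi> x\<bar>)"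
      using \<psi>(2) by (intro integral_mono integrable_abs int Bochner_Integration.integrable_diff i \<phi>)
        (simp add: abs_mult mult_left_le)
    also have "\<dots> < e" by (rule N(3)[OF u])
    finally show ?thesis .
  qed
  then show "\<exists>N. open N \<and> 0 \<in> N \<and> (\<forall>u\<in>N. \<bar>group_convolution M \<phi> \<psi> (u + g) - group_convolution M \<phi> \<psi> g\<bar> < e)"
    using N(1,2) by blast
qed

end

section \<open>The integral of a convolution\<close>

context unimodular_haar
begin

lemma measurable_conv_arg [measurable]: "(\<lambda>x::'a. - x + g) \<in> borel_measurable borel"
  by (intro borel_measurable_continuous_onI continuous_intros)

text \<open>The function is a convolution of two indicators and therefore continuous; this bypasses
  joint measurability of \<open>- x + g\<close> in both variables.\<close>

lemma measurable_emeasure_conv [measurable]: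
  assumes A: "A \<in> sets borel" "emeasure M A < \<infinity>" and B: "B \<in> sets borel"
  shows "(\<lambda>g. emeasure M {x\<in>A. - x + g \<in> B}) \<in> borel_measurable borel"
proof -
  note [measurable] = A(1) B
  have s: "{x\<in>A. - x + g \<in> B} \<in> sets M" for g
  proof -
    have "{x \<in> space M. x \<in> A \<and> - x + g \<in> B} \<in> sets M" by measurable
    then show ?thesis by simp
  qed
  have f: "emeasure M {x\<in>A. - x + g \<in> B} < \<infinity>" for g
    using A by (intro le_less_trans[OF emeasure_mono A(2)]) auto
  have "emeasure M {x\<in>A. - x + g \<in> B} = ennreal (group_convolution M (indicator A) (indicator B) g)" for g
  proof -
    have "group_convolution M (indicator A) (indicator B) g = (LINT x|M. indicator {x\<in>A. - x + g \<in> B} x)"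
      unfolding group_convolution_def by (intro Bochner_Integration.integral_cong) (auto simp: indicator_def)
    also have "\<dots> = measure M {x\<in>A. - x + g \<in> B}" using s f by simp
    finally show ?thesis using f[of g] by (simp add: emeasure_eq_ennreal_measure less_top)
  qed
  moreover have "continuous_on UNIV (group_convolution M (indicator A) (indicator B))"
    using A B by (intro continuous_convolution) (auto simp: indicator_def integrable_real_indicator)
  then have "group_convolution M (indicator A) (indicator B) \<in> borel_measurable borel"
    by (rule borel_measurable_continuous_onI)
  ultimately show ?thesis by simp
qed

text \<open>Outer regularity gives \<open>\<nu> B \<le> c * emeasure M B\<close> for all Borel sets
  of finite measure. The reverse inequality for \<open>A\<close> comes from applying this to
  \<open>U - A\<close> with \<open>U\<close> open, where the total is known.\<close>

lemma proportional_from_open: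
  fixes \<nu> :: "'a set \<Rightarrow> ennreal"
  assumes c: "c < \<infinity>"
    and add: "\<And>A B. A \<in> sets borel \<Longrightarrow> B \<in> sets borel \<Longrightarrow> emeasure M A < \<infinity> \<Longrightarrow> emeasure M B < \<infinity>
      \<Longrightarrow> A \<inter> B = {} \<Longrightarrow> \<nu> (A \<union> B) = \<nu> A + \<nu> B"
    and open_eq: "\<And>U. open U \<Longrightarrow> emeasure M U < \<infinity> \<Longrightarrow> \<nu> U = c * emeasure M U"
    and A: "A \<in> sets borel" "emeasure M A < \<infinity>"
  shows "\<nu> A = c * emeasure M A"
proof (rule antisym)
  have split: "\<nu> U = \<nu> B + \<nu> (U - B)" "emeasure M (U - B) < \<infinity>"
    if "open U" "B \<subseteq> U" "emeasure M U < \<infinity>" "B \<in> sets borel" for U B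
  proof -
    have "emeasure M B \<le> emeasure M U" "emeasure M (U - B) \<le> emeasure M U"
      using that by (auto intro!: emeasure_mono)
    then have f: "emeasure M B < \<infinity>" "emeasure M (U - B) < \<infinity>" using that(3) by (auto intro: order_le_less_trans)
    then show "emeasure M (U - B) < \<infinity>" by simp
    have "\<nu> (B \<union> (U - B)) = \<nu> B + \<nu> (U - B)" using that f by (intro add) auto
    moreover have "B \<union> (U - B) = U" using that(2) by auto
    ultimately show "\<nu> U = \<nu> B + \<nu> (U - B)" by simp
  qed
  have upper: "\<nu> B \<le> c * emeasure M B" if B: "B \<in> sets borel" "emeasure M B < \<infinity>" for B
  proof (rule ennreal_le_if_add_eps[OF _ c])
    fix e :: real assume e: "0 < e"
    obtain U where U: "open U" "B \<subseteq> U" "emeasure M U < emeasure M B + ennreal e"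
      by (rule radon_outer[OF radon B e])
    have "emeasure M B + ennreal e < \<infinity>" using B by simp
    then have f: "emeasure M U < \<infinity>" by (rule order_less_trans[OF U(3)])
    have "\<nu> B \<le> \<nu> U" unfolding split(1)[OF U(1,2) f B(1)] by simp
    also have "\<dots> = c * emeasure M U" by (rule open_eq[OF U(1) f])
    also have "\<dots> \<le> c * (emeasure M B + ennreal e)" using U(3) by (intro mult_left_mono) auto
    finally show "\<nu> B \<le> c * (emeasure M B + ennreal e)" .
  qed
  show "\<nu> A \<le> c * emeasure M A" by (rule upper[OF A])
  obtain U where U: "open U" "A \<subseteq> U" "emeasure M U < \<infinity>"
    by (rule radon_outer_diff[OF radon A zero_less_one])
  have d: "emeasure M (U - A) < \<infinity>" by (rule split(2)[OF U A(1)])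
  have "c * emeasure M (U - A) + c * emeasure M A = c * emeasure M U"
    using U A by (subst distrib_left[symmetric], subst plus_emeasure) (auto simp: Un_absorb2)
  also have "\<dots> = \<nu> A + \<nu> (U - A)" using open_eq[OF U(1,3)] split(1)[OF U A(1)] by simp
  also have "\<dots> \<le> \<nu> A + c * emeasure M (U - A)"
    using U A d by (intro add_left_mono upper) auto
  finally have "c * emeasure M (U - A) + c * emeasure M A \<le> c * emeasure M (U - A) + \<nu> A"
    by (simp add: add.commute)
  moreover have "c * emeasure M (U - A) \<noteq> \<infinity>"
    using c d ennreal_mult_less_top[of c "emeasure M (U - A)"] by auto
  ultimately show "c * emeasure M A \<le> \<nu> A" unfolding ennreal_add_left_cancel_le by simp
qed

lemma nn_integral_emeasure_conv_open:
  assumes A: "open A" and B: "open B"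
  shows "(\<integral>\<^sup>+g. emeasure M {x\<in>A. - x + g \<in> B} \<partial>M) = emeasure M A * emeasure M B"
proof -
  let ?W = "fst -` A \<inter> (\<lambda>p. - fst p + snd p) -` B :: ('a \<times> 'a) set"
  have W: "open ?W" by (intro open_Int open_vimage A B continuous_intros)
  have "(\<integral>\<^sup>+g. emeasure M {x\<in>A. - x + g \<in> B} \<partial>M) = (\<integral>\<^sup>+g. emeasure M {x. (x, g) \<in> ?W} \<partial>M)"
    by (intro nn_integral_cong arg_cong[where f = "emeasure M"]) auto
  also have "\<dots> = (\<integral>\<^sup>+x. emeasure M {g. (x, g) \<in> ?W} \<partial>M)"
    by (rule tonelli_open[OF radon radon W, symmetric])
  also have "\<dots> = (\<integral>\<^sup>+x. emeasure M B * indicator A x \<partial>M)"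
    using B by (intro nn_integral_cong) (auto simp: indicator_def emeasure_left)
  also have "\<dots> = emeasure M B * emeasure M A"
    using A by (subst nn_integral_cmult_indicator) auto
  also have "\<dots> = emeasure M A * emeasure M B" by (rule mult.commute)
  finally show ?thesis .
qed

text \<open>The formula passes from open to Borel sets in one factor at a time.\<close>

lemma nn_integral_emeasure_conv:
  assumes A: "A \<in> sets borel" "emeasure M A < \<infinity>" and B: "B \<in> sets borel" "emeasure M B < \<infinity>"
  shows "(\<integral>\<^sup>+g. emeasure M {x\<in>A. - x + g \<in> B} \<partial>M) = emeasure M A * emeasure M B"
proof -
  have sets: "{x\<in>C. - x + g \<in> D} \<in> sets M" if "C \<in> sets borel" "D \<in> sets borel" for C D g
  proof -
    note [measurable] = that
    have "{x \<in> space M. x \<in> C \<and> - x + g \<in> D} \<in> sets M" by measurable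
    then show ?thesis by simp
  qed
  have step: "(\<integral>\<^sup>+g. emeasure M {x\<in>C. - x + g \<in> D} \<partial>M) = emeasure M C * emeasure M D"
    if C: "open C" "emeasure M C < \<infinity>" and D: "D \<in> sets borel" "emeasure M D < \<infinity>" for C D
  proof (rule proportional_from_open[OF C(2) _ _ D])
    show "(\<integral>\<^sup>+g. emeasure M {x\<in>C. - x + g \<in> U} \<partial>M) = emeasure M C * emeasure M U" if "open U" for U
      by (rule nn_integral_emeasure_conv_open[OF C(1) that])
    fix E F :: "'a set" assume EF: "E \<in> sets borel" "F \<in> sets borel" "E \<inter> F = {}"
    have "emeasure M {x\<in>C. - x + g \<in> E \<union> F} = emeasure M {x\<in>C. - x + g \<in> E} + emeasure M {x\<in>C. - x + g \<in> F}" for g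
      using C EF by (subst plus_emeasure) (auto intro!: sets arg_cong[where f = "emeasure M"])
    then show "(\<integral>\<^sup>+g. emeasure M {x\<in>C. - x + g \<in> E \<union> F} \<partial>M) =
        (\<integral>\<^sup>+g. emeasure M {x\<in>C. - x + g \<in> E} \<partial>M) + (\<integral>\<^sup>+g. emeasure M {x\<in>C. - x + g \<in> F} \<partial>M)"
      using measurable_emeasure_conv[of C E] measurable_emeasure_conv[of C F] C EF
      by (simp add: nn_integral_add)
  qed
  have "(\<integral>\<^sup>+g. emeasure M {x\<in>A. - x + g \<in> B} \<partial>M) = emeasure M B * emeasure M A"
  proof (rule proportional_from_open[OF B(2) _ _ A])
    show "(\<integral>\<^sup>+g. emeasure M {x\<in>U. - x + g \<in> B} \<partial>M) = emeasure M B * emeasure M U"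
      if "open U" "emeasure M U < \<infinity>" for U
      using step[OF that B] by (simp add: mult.commute)
    fix E F :: "'a set" assume EF: "E \<in> sets borel" "F \<in> sets borel" "emeasure M E < \<infinity>" "emeasure M F < \<infinity>" "E \<inter> F = {}"
    have "emeasure M {x\<in>E \<union> F. - x + g \<in> B} = emeasure M {x\<in>E. - x + g \<in> B} + emeasure M {x\<in>F. - x + g \<in> B}" for g
      using B EF by (subst plus_emeasure) (auto intro!: sets arg_cong[where f = "emeasure M"])
    then show "(\<integral>\<^sup>+g. emeasure M {x\<in>E \<union> F. - x + g \<in> B} \<partial>M) =
        (\<integral>\<^sup>+g. emeasure M {x\<in>E. - x + g \<in> B} \<partial>M) + (\<integral>\<^sup>+g. emeasure M {x\<in>F. - x + g \<in> B} \<partial>M)"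
      using measurable_emeasure_conv[of E B] measurable_emeasure_conv[of F B] B EF
      by (simp add: nn_integral_add)
  qed
  then show ?thesis by (simp add: mult.commute)
qed

text \<open>Standard induction over simple functions and monotone limits. Measurability of
  \<open>T u\<close> is carried along because additivity and monotone convergence of its integral
  rest on it; finiteness of the integral keeps all level sets within reach of the assumption on
  indicators.\<close>

lemma nn_integral_operator_extend:
  fixes T :: "('a \<Rightarrow> ennreal) \<Rightarrow> 'a \<Rightarrow> ennreal"
  assumes mono: "\<And>u v. u \<le> v \<Longrightarrow> T u \<le> T v"
    and cmult: "\<And>c u. u \<in> borel_measurable borel \<Longrightarrow> T (\<lambda>x. c * u x) = (\<lambda>g. c * T u g)"
    and add: "\<And>u v. u \<in> borel_measurable borel \<Longrightarrow> v \<in> borel_measurable borel \<Longrightarrow>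
      T (\<lambda>x. u x + v x) = (\<lambda>g. T u g + T v g)"
    and sup: "\<And>U. (\<And>i. U i \<in> borel_measurable borel) \<Longrightarrow> incseq U \<Longrightarrow> T (SUP i. U i) = (\<lambda>g. SUP i::nat. T (U i) g)"
    and ind: "\<And>A. A \<in> sets borel \<Longrightarrow> emeasure M A < \<infinity> \<Longrightarrow>
      T (indicator A) \<in> borel_measurable borel \<and> (\<integral>\<^sup>+g. T (indicator A) g \<partial>M) = C * emeasure M A"
    and u: "u \<in> borel_measurable borel" "(\<integral>\<^sup>+x. u x \<partial>M) < \<infinity>"
  shows "T u \<in> borel_measurable borel \<and> (\<integral>\<^sup>+g. T u g \<partial>M) = C * (\<integral>\<^sup>+x. u x \<partial>M)"
proof -
  have "(\<integral>\<^sup>+x. u x \<partial>M) < \<infinity> \<longrightarrow>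
      T u \<in> borel_measurable borel \<and> (\<integral>\<^sup>+g. T u g \<partial>M) = C * (\<integral>\<^sup>+x. u x \<partial>M)"
    using u(1)
  proof (induction u rule: borel_measurable_induct)
    case (cong f g)
    then have "f = g" by auto
    then show ?case using cong by simp
  next
    case (set A)
    then show ?case using ind[of A] by simp
  next
    case (mult w c)
    have [measurable]: "w \<in> borel_measurable borel" using mult by simp
    have i: "(\<integral>\<^sup>+x. c * w x \<partial>M) = c * (\<integral>\<^sup>+x. w x \<partial>M)" by (rule nn_integral_cmult) simp
    show ?case
    proof (intro impI, cases "c = 0")
      case True
      then show "T (\<lambda>x. c * w x) \<in> borel_measurable borel \<and> (\<integral>\<^sup>+g. T (\<lambda>x. c * w x) g \<partial>M) = C * (\<integral>\<^sup>+x. c * w x \<partial>M)"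
        unfolding cmult[OF \<open>w \<in> borel_measurable borel\<close>] by simp
    next
      case False
      assume "(\<integral>\<^sup>+x. c * w x \<partial>M) < \<infinity>"
      then have "(\<integral>\<^sup>+x. w x \<partial>M) < \<infinity>" using False by (auto simp: i ennreal_mult_less_top)
      then have T: "T w \<in> borel_measurable borel" "(\<integral>\<^sup>+g. T w g \<partial>M) = C * (\<integral>\<^sup>+x. w x \<partial>M)"
        using mult by auto
      have "(\<integral>\<^sup>+g. c * T w g \<partial>M) = c * (\<integral>\<^sup>+g. T w g \<partial>M)" by (rule nn_integral_cmult) (simp add: T)
      then show "T (\<lambda>x. c * w x) \<in> borel_measurable borel \<and> (\<integral>\<^sup>+g. T (\<lambda>x. c * w x) g \<partial>M) = C * (\<integral>\<^sup>+x. c * w x \<partial>M)"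
        unfolding cmult[OF \<open>w \<in> borel_measurable borel\<close>] i using T by (simp add: ac_simps)
    qed
  next
    case (add w w')
    have m [measurable]: "w \<in> borel_measurable borel" "w' \<in> borel_measurable borel" using add by simp_all
    have i: "(\<integral>\<^sup>+x. w' x + w x \<partial>M) = (\<integral>\<^sup>+x. w' x \<partial>M) + (\<integral>\<^sup>+x. w x \<partial>M)" by (rule nn_integral_add) simp_all
    show ?case
      unfolding assms(3)[OF m(2,1)] i
      using add by (auto simp: nn_integral_add distrib_left)
  next
    case (seq W)
    have inc: "incseq W" "incseq (\<lambda>i. T (W i))" using seq(3) by (auto simp: incseq_def intro: mono)
    have m: "W i \<in> borel_measurable borel" for i using seq(1) by simp
    have i: "(\<integral>\<^sup>+x. (SUP i. W i) x \<partial>M) = (SUP i. \<integral>\<^sup>+x. W i x \<partial>M)"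
      unfolding SUP_apply by (rule nn_integral_monotone_convergence_SUP[OF inc(1)]) (simp add: m)
    show ?case
    proof
      assume f: "(\<integral>\<^sup>+x. (SUP i. W i) x \<partial>M) < \<infinity>"
      have "(\<integral>\<^sup>+x. W i x \<partial>M) < \<infinity>" for i
        by (rule le_less_trans[OF nn_integral_mono f]) (auto intro: SUP_upper)
      then have T: "T (W i) \<in> borel_measurable borel" "(\<integral>\<^sup>+g. T (W i) g \<partial>M) = C * (\<integral>\<^sup>+x. W i x \<partial>M)" for i
        using seq(5) by auto
      have "(\<integral>\<^sup>+g. (SUP i. T (W i) g) \<partial>M) = (SUP i. \<integral>\<^sup>+g. T (W i) g \<partial>M)"
        by (rule nn_integral_monotone_convergence_SUP[OF inc(2)]) (simp add: T)
      then show "T (SUP i. W i) \<in> borel_measurable borel \<and>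
          (\<integral>\<^sup>+g. T (SUP i. W i) g \<partial>M) = C * (\<integral>\<^sup>+x. (SUP i. W i) x \<partial>M)"
        unfolding sup[OF m inc(1)] i
        by (intro conjI borel_measurable_SUP) (auto simp: T SUP_mult_left_ennreal)
    qed
  qed
  then show ?thesis using u(2) by simp
qed

text \<open>Starting from two indicators, the identity is extended first in \<open>v\<close>, with
  an indicator in place of \<open>u\<close>, and then in \<open>u\<close>.\<close>

lemma nn_integral_conv:
  assumes u: "u \<in> borel_measurable borel" "(\<integral>\<^sup>+x. u x \<partial>M) < \<infinity>"
    and v: "v \<in> borel_measurable borel" "(\<integral>\<^sup>+x. v x \<partial>M) < \<infinity>"
  shows "(\<integral>\<^sup>+g. (\<integral>\<^sup>+x. u x * v (- x + g) \<partial>M) \<partial>M) = (\<integral>\<^sup>+x. u x \<partial>M) * (\<integral>\<^sup>+x. v x \<partial>M)"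
proof -
  define J where "J u v g = (\<integral>\<^sup>+x. u x * v (- x + g) \<partial>M)" for u v :: "'a \<Rightarrow> ennreal" and g
  have m: "(\<lambda>x. w (- x + g)) \<in> borel_measurable borel"
    if "w \<in> borel_measurable borel" for w :: "'a \<Rightarrow> ennreal" and g
    using measurable_compose[OF measurable_conv_arg that] .
  have J: "J u v \<le> J u' v'" if "u \<le> u'" "v \<le> v'" for u v u' v'
    using that unfolding J_def le_fun_def by (intro allI nn_integral_mono mult_mono) auto
  have indicators: "J (indicator A) (indicator B) \<in> borel_measurable borel \<and>
      (\<integral>\<^sup>+g. J (indicator A) (indicator B) g \<partial>M) = emeasure M A * emeasure M B"
    if A: "A \<in> sets borel" "emeasure M A < \<infinity>" and B: "B \<in> sets borel" "emeasure M B < \<infinity>" for A B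
  proof -
    have "J (indicator A) (indicator B) g = emeasure M {x\<in>A. - x + g \<in> B}" for g
    proof -
      note [measurable] = A(1) B(1)
      have "{x \<in> space M. x \<in> A \<and> - x + g \<in> B} \<in> sets M" by measurable
      moreover have "indicator A x * indicator B (- x + g) = (indicator {x\<in>A. - x + g \<in> B} x :: ennreal)" for x
        by (simp add: indicator_def)
      ultimately show ?thesis by (simp add: J_def)
    qed
    then have "J (indicator A) (indicator B) = (\<lambda>g. emeasure M {x\<in>A. - x + g \<in> B})" by (rule ext)
    then show ?thesis using A B by (simp add: nn_integral_emeasure_conv measurable_emeasure_conv)
  qed
  have step: "J (indicator A) v \<in> borel_measurable borel \<and>
      (\<integral>\<^sup>+g. J (indicator A) v g \<partial>M) = emeasure M A * (\<integral>\<^sup>+x. v x \<partial>M)"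
    if A: "A \<in> sets borel" "emeasure M A < \<infinity>" for A
  proof (rule nn_integral_operator_extend[where T = "J (indicator A)", OF J[OF order_refl] _ _ _ indicators[OF A] v])
    note [measurable] = A(1)
    show "J (indicator A) (\<lambda>x. c * w x) = (\<lambda>g. c * J (indicator A) w g)"
      if "w \<in> borel_measurable borel" for c w
      unfolding J_def mult.left_commute[of "indicator A _" c] using m[OF that] by (intro ext nn_integral_cmult) simp
    show "J (indicator A) (\<lambda>x. w x + w' x) = (\<lambda>g. J (indicator A) w g + J (indicator A) w' g)"
      if "w \<in> borel_measurable borel" "w' \<in> borel_measurable borel" for w w'
      unfolding J_def distrib_left using m[OF that(1)] m[OF that(2)] by (intro ext nn_integral_add) simp_all
    show "J (indicator A) (SUP i. W i) = (\<lambda>g. SUP i. J (indicator A) (W i) g)"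
      if W: "\<And>i. W i \<in> borel_measurable borel" "incseq W" for W :: "nat \<Rightarrow> _"
      unfolding J_def SUP_apply SUP_mult_left_ennreal using m[OF W(1)] W(2)
      by (intro ext nn_integral_monotone_convergence_SUP) (auto simp: incseq_def le_fun_def intro!: mult_left_mono)
  qed
  have "J u v \<in> borel_measurable borel \<and> (\<integral>\<^sup>+g. J u v g \<partial>M) = (\<integral>\<^sup>+x. v x \<partial>M) * (\<integral>\<^sup>+x. u x \<partial>M)"
  proof (rule nn_integral_operator_extend[where T = "\<lambda>u. J u v", OF J[OF _ order_refl] _ _ _ _ u])
    show "J (indicator A) v \<in> borel_measurable borel \<and>
        (\<integral>\<^sup>+g. J (indicator A) v g \<partial>M) = (\<integral>\<^sup>+x. v x \<partial>M) * emeasure M A"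
      if "A \<in> sets borel" "emeasure M A < \<infinity>" for A
      using step[OF that] by (simp add: mult.commute)
    show "J (\<lambda>x. c * w x) v = (\<lambda>g. c * J w v g)" if "w \<in> borel_measurable borel" for c w
      unfolding J_def mult.assoc using that m[OF v(1)] by (intro ext nn_integral_cmult) simp
    show "J (\<lambda>x. w x + w' x) v = (\<lambda>g. J w v g + J w' v g)"
      if "w \<in> borel_measurable borel" "w' \<in> borel_measurable borel" for w w'
      unfolding J_def distrib_right using that m[OF v(1)] by (intro ext nn_integral_add) simp_all
    show "J (SUP i. W i) v = (\<lambda>g. SUP i. J (W i) v g)"
      if W: "\<And>i. W i \<in> borel_measurable borel" "incseq W" for W :: "nat \<Rightarrow> _"
      unfolding J_def SUP_apply SUP_mult_right_ennreal using W m[OF v(1)]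
      by (intro ext nn_integral_monotone_convergence_SUP) (auto simp: incseq_def le_fun_def intro!: mult_right_mono)
  qed
  then show ?thesis by (simp add: J_def mult.commute)
qed

end

section \<open>Minimum principle and unit-valued functions\<close>

text \<open>\<open>X\<close> holds pairs of a parameter s and a value d, with several values per
  parameter allowed; \<open>move\<close> is an approximate midpoint concavity of the lower envelope.
  A value below \<open>\<kappa>\<close> is refuted by an almost minimiser of d - \<eta> s^2:
  \<open>left\<close> and \<open>right\<close> keep it away from the ends, and stepping by \<delta>
  to both sides lowers the mean of the perturbed values by at least \<eta> \<delta>^2, more than the
  error of almost minimality.\<close>

lemma chord_principle:
  fixes X :: "(real \<times> real) set"
  assumes lo: "0 \<le> lo" and C: "0 \<le> C" and r0: "0 < r0"
    and left: "\<And>s d. (s, d) \<in> X \<Longrightarrow> lo \<le> s \<Longrightarrow> s \<le> hi \<Longrightarrow> \<kappa> - C * (s - lo) \<le> d"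
    and right: "\<And>s d. (s, d) \<in> X \<Longrightarrow> lo \<le> s \<Longrightarrow> s \<le> hi \<Longrightarrow> \<kappa> - C * (hi - s) \<le> d"
    and move: "\<And>s d r. (s, d) \<in> X \<Longrightarrow> lo + r \<le> s \<Longrightarrow> s + r \<le> hi \<Longrightarrow> 0 < r \<Longrightarrow> r < r0 \<Longrightarrow>
      \<exists>\<delta> d1 d2. r / 2 \<le> \<delta> \<and> \<delta> \<le> r \<and> (s - \<delta>, d1) \<in> X \<and> (s + \<delta>, d2) \<in> X \<and> d1 + d2 \<le> 2 * d"
    and X: "(s, d) \<in> X" "lo \<le> s" "s \<le> hi"
  shows "\<kappa> \<le> d"
proof (rule ccontr)
  assume "\<not> \<kappa> \<le> d"
  define \<gamma> where "\<gamma> = \<kappa> - d"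
  have \<gamma>: "0 < \<gamma>" using \<open>\<not> \<kappa> \<le> d\<close> by (simp add: \<gamma>_def)
  \<comment> \<open>Makes the perturbation \<open>\<eta> * s\<^sup>2\<close> at most
    \<open>\<gamma> / 4\<close> on the whole interval; the 1 keeps the denominator positive.\<close>
  define \<eta> where "\<eta> = \<gamma> / (4 * (hi\<^sup>2 + 1))"
  have pos: "0 < 4 * (hi\<^sup>2 + 1)" using add_nonneg_pos[OF zero_le_power2[of hi] zero_less_one] by simp
  have \<eta>: "0 < \<eta>" unfolding \<eta>_def using \<gamma> pos by (rule divide_pos_pos)
  have \<eta>hi: "\<eta> * hi\<^sup>2 \<le> \<gamma> / 4"
  proof -
    have "\<eta> * hi\<^sup>2 \<le> \<eta> * (hi\<^sup>2 + 1)" using \<eta> by (intro mult_left_mono) auto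
    also have "\<dots> = \<gamma> / 4" unfolding \<eta>_def using pos by (simp add: field_simps)
    finally show ?thesis .
  qed
  \<comment> \<open>Values at distance at most \<open>r\<close> from an end are at least
    \<open>\<kappa> - \<gamma> / 4\<close>.\<close>
  define r where "r = min (r0 / 2) (\<gamma> / (4 * (C + 1)))"
  have r: "0 < r" "r < r0" unfolding r_def using r0 \<gamma> C by auto
  have Cr: "C * r \<le> \<gamma> / 4"
  proof -
    have "C * r \<le> (C + 1) * (\<gamma> / (4 * (C + 1)))" using C r(1) \<gamma> by (intro mult_mono) (auto simp: r_def)
    also have "\<dots> = \<gamma> / 4" using C by (simp add: field_simps)
    finally show ?thesis .
  qed
  define J where "J = (\<lambda>(s, d). d - \<eta> * s\<^sup>2) ` {(s, d). (s, d) \<in> X \<and> lo \<le> s \<and> s \<le> hi}"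
  have sq: "\<eta> * s'\<^sup>2 \<le> \<gamma> / 4" if "lo \<le> s'" "s' \<le> hi" for s'
  proof -
    have "s'\<^sup>2 \<le> hi\<^sup>2" using lo that by (intro power_mono) auto
    then have "\<eta> * s'\<^sup>2 \<le> \<eta> * hi\<^sup>2" using \<eta> by (intro mult_left_mono) auto
    then show ?thesis using \<eta>hi by linarith
  qed
  have memJ: "d' - \<eta> * s'\<^sup>2 \<in> J" if "(s', d') \<in> X" "lo \<le> s'" "s' \<le> hi" for s' d'
    using that unfolding J_def by (auto intro!: rev_image_eqI[of "(s', d')"])
  have bdd: "bdd_below J"
  proof (rule bdd_belowI[of _ "\<kappa> - C * (hi - lo) - \<gamma> / 4"])
    fix j assume "j \<in> J"
    then obtain s' d' where j: "j = d' - \<eta> * s'\<^sup>2" "(s', d') \<in> X" "lo \<le> s'" "s' \<le> hi" by (auto simp: J_def)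
    have "C * (s' - lo) \<le> C * (hi - lo)" using j C by (intro mult_left_mono) auto
    then show "\<kappa> - C * (hi - lo) - \<gamma> / 4 \<le> j" using left[OF j(2-4)] sq[OF j(3,4)] j(1) by linarith
  qed
  define I where "I = Inf J"
  have I: "I \<le> d' - \<eta> * s'\<^sup>2" if "(s', d') \<in> X" "lo \<le> s'" "s' \<le> hi" for s' d'
    unfolding I_def by (rule cInf_lower[OF memJ[OF that] bdd])
  \<comment> \<open>The first bound puts the almost minimiser below
    \<open>\<kappa> - \<gamma> / 2\<close>. The second is half of
    \<open>\<eta> * r\<^sup>2 / 4\<close>, the least gain from a step of length at least
    \<open>r / 2\<close>.\<close>
  define e where "e = min (\<gamma> / 4) (\<eta> * r\<^sup>2 / 8)"
  have e: "0 < e" unfolding e_def using \<gamma> \<eta> r by simp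
  have "Inf J < I + e" using e by (simp add: I_def)
  then obtain j where "j \<in> J" "j < I + e" using cInf_lessD[of J] memJ[OF X] by blast
  then obtain s1 d1 where 1: "(s1, d1) \<in> X" "lo \<le> s1" "s1 \<le> hi" "d1 - \<eta> * s1\<^sup>2 < I + e" by (auto simp: J_def)
  have "I \<le> d" using I[OF X] \<eta> zero_le_power2[of s] mult_nonneg_nonneg[of \<eta> "s\<^sup>2"] by linarith
  then have low: "d1 < \<kappa> - \<gamma> / 2"
    using 1(4) sq[OF 1(2,3)] \<gamma>_def unfolding e_def by linarith
  have "lo + r \<le> s1"
  proof (rule ccontr)
    assume "\<not> lo + r \<le> s1"
    then have "C * (s1 - lo) \<le> C * r" using C by (intro mult_left_mono) auto
    then show False using left[OF 1(1-3)] Cr low \<gamma> by linarith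
  qed
  moreover have "s1 + r \<le> hi"
  proof (rule ccontr)
    assume "\<not> s1 + r \<le> hi"
    then have "C * (hi - s1) \<le> C * r" using C by (intro mult_left_mono) auto
    then show False using right[OF 1(1-3)] Cr low \<gamma> by linarith
  qed
  ultimately obtain \<delta> d2 d3 where m: "r / 2 \<le> \<delta>" "\<delta> \<le> r" "(s1 - \<delta>, d2) \<in> X" "(s1 + \<delta>, d3) \<in> X" "d2 + d3 \<le> 2 * d1"
    using move[OF 1(1) _ _ r] by blast
  have "I \<le> d2 - \<eta> * (s1 - \<delta>)\<^sup>2" "I \<le> d3 - \<eta> * (s1 + \<delta>)\<^sup>2"
    using m \<open>lo + r \<le> s1\<close> \<open>s1 + r \<le> hi\<close> r by (auto intro!: I)
  then have "2 * I \<le> d2 + d3 - \<eta> * ((s1 - \<delta>)\<^sup>2 + (s1 + \<delta>)\<^sup>2)" by (simp add: distrib_left)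
  also have "(s1 - \<delta>)\<^sup>2 + (s1 + \<delta>)\<^sup>2 = 2 * s1\<^sup>2 + 2 * \<delta>\<^sup>2" by (simp add: power2_eq_square algebra_simps)
  finally have "2 * I \<le> 2 * (d1 - \<eta> * s1\<^sup>2) - 2 * (\<eta> * \<delta>\<^sup>2)" using m(5) by (simp add: distrib_left)
  moreover have "\<eta> * (r / 2)\<^sup>2 \<le> \<eta> * \<delta>\<^sup>2" using \<eta> m r by (intro mult_left_mono power_mono) auto
  then have "\<eta> * r\<^sup>2 / 4 \<le> \<eta> * \<delta>\<^sup>2" by (simp add: power_divide)
  moreover have "e \<le> \<eta> * r\<^sup>2 / 8" "0 < \<eta> * r\<^sup>2" using \<eta> r by (auto simp: e_def)
  moreover have False if "2 * I \<le> 2 * j - 2 * x" "y / 4 \<le> x" "e \<le> y / 8" "0 < y" "j < I + e" for j x y :: real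
    using that by linarith
  ultimately show False using 1(4) by blast
qed

section \<open>Elementary estimates for convolutions of functions with values in [0, 1]\<close>

context unimodular_haar
begin

definition unit_L1 :: "('a \<Rightarrow> real) \<Rightarrow> bool" where
  "unit_L1 \<phi> \<longleftrightarrow> integrable M \<phi> \<and> (\<forall>x. 0 \<le> \<phi> x \<and> \<phi> x \<le> 1)"

abbreviation conv :: "('a \<Rightarrow> real) \<Rightarrow> ('a \<Rightarrow> real) \<Rightarrow> 'a \<Rightarrow> real" (infixl "\<star>" 70) where
  "\<phi> \<star> \<psi> \<equiv> group_convolution M \<phi> \<psi>"

abbreviation mass :: "('a \<Rightarrow> real) \<Rightarrow> real" where
  "mass \<phi> \<equiv> integral\<^sup>L M \<phi>"

lemma unit_L1D:
  assumes "unit_L1 \<phi>"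
  shows "integrable M \<phi>" "\<phi> \<in> borel_measurable borel" "0 \<le> \<phi> x" "\<phi> x \<le> 1" "\<bar>\<phi> x\<bar> \<le> 1"
proof -
  show i: "integrable M \<phi>" "0 \<le> \<phi> x" "\<phi> x \<le> 1" "\<bar>\<phi> x\<bar> \<le> 1" using assms by (auto simp: unit_L1_def)
  show "\<phi> \<in> borel_measurable borel" using borel_measurable_integrable[OF i(1)] by simp
qed

lemma unit_L1_bounded:
  assumes "unit_L1 \<phi>" "\<psi> \<in> borel_measurable borel" "\<And>x. 0 \<le> \<psi> x" "\<And>x. \<psi> x \<le> \<phi> x"
  shows "unit_L1 \<psi>"
  unfolding unit_L1_def
proof (intro conjI allI)
  show "integrable M \<psi>"
  proof (rule Bochner_Integration.integrable_bound[OF unit_L1D(1)[OF assms(1)]])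
    show "AE x in M. norm (\<psi> x) \<le> norm (\<phi> x)"
      by (rule AE_I2) (use assms(3,4) order_trans in \<open>simp add: abs_of_nonneg unit_L1D(3)[OF assms(1)]\<close>)
  qed (use assms(2) in simp)
  show "0 \<le> \<psi> x" "\<psi> x \<le> 1" for x
    using assms(3,4) unit_L1D(4)[OF assms(1)] order_trans by blast+
qed

lemma unit_L1_left: "unit_L1 \<phi> \<Longrightarrow> unit_L1 (\<lambda>x. \<phi> (g + x))"
  and unit_L1_right: "unit_L1 \<phi> \<Longrightarrow> unit_L1 (\<lambda>x. \<phi> (x + g))"
  and unit_L1_uminus: "unit_L1 \<phi> \<Longrightarrow> unit_L1 (\<lambda>x. \<phi> (- x))"
  by (auto simp: unit_L1_def integrable_left integrable_right integrable_uminus)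

lemma mass_nonneg: "unit_L1 \<phi> \<Longrightarrow> 0 \<le> mass \<phi>"
  by (intro Bochner_Integration.integral_nonneg) (simp add: unit_L1D(3))

lemma conv_arg:
  assumes "unit_L1 \<psi>"
  shows "unit_L1 (\<lambda>x. \<psi> (- x + g))" "mass (\<lambda>x. \<psi> (- x + g)) = mass \<psi>"
proof -
  have r: "unit_L1 (\<lambda>y. \<psi> (y + g))" by (rule unit_L1_right[OF assms])
  show "unit_L1 (\<lambda>x. \<psi> (- x + g))" by (rule unit_L1_uminus[OF r])
  have "mass (\<lambda>x. \<psi> (- x + g)) = mass (\<lambda>x. \<psi> (x + g))"
    by (rule integral_uminus[OF unit_L1D(2)[OF r]])
  also have "\<dots> = mass \<psi>" by (rule integral_right[OF unit_L1D(2)[OF assms]])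
  finally show "mass (\<lambda>x. \<psi> (- x + g)) = mass \<psi>" .
qed

lemma unit_L1_mult:
  assumes "unit_L1 \<phi>" "unit_L1 \<psi>"
  shows "unit_L1 (\<lambda>x. \<phi> x * \<psi> x)"
proof (rule unit_L1_bounded[OF assms(1)])
  note [measurable] = unit_L1D(2)[OF assms(1)] unit_L1D(2)[OF assms(2)]
  show "(\<lambda>x. \<phi> x * \<psi> x) \<in> borel_measurable borel" by measurable
qed (use assms in \<open>auto simp: unit_L1D mult_left_le\<close>)

lemma conv_integrand: "unit_L1 \<phi> \<Longrightarrow> unit_L1 \<psi> \<Longrightarrow> unit_L1 (\<lambda>x. \<phi> x * \<psi> (- x + g))"
  by (intro unit_L1_mult conv_arg(1))

lemma conv_nonneg: "unit_L1 \<phi> \<Longrightarrow> unit_L1 \<psi> \<Longrightarrow> 0 \<le> (\<phi> \<star> \<psi>) g"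
  unfolding group_convolution_def by (rule mass_nonneg[OF conv_integrand])

lemma conv_le_left:
  assumes "unit_L1 \<phi>" "unit_L1 \<psi>"
  shows "(\<phi> \<star> \<psi>) g \<le> mass \<phi>"
  unfolding group_convolution_def
  using assms by (intro integral_mono unit_L1D(1)[OF conv_integrand] unit_L1D(1)) (auto simp: unit_L1D mult_left_le)

lemma conv_le_right:
  assumes "unit_L1 \<phi>" "unit_L1 \<psi>"
  shows "(\<phi> \<star> \<psi>) g \<le> mass \<psi>"
proof -
  have "(\<phi> \<star> \<psi>) g \<le> mass (\<lambda>x. \<psi> (- x + g))"
    unfolding group_convolution_def
    using assms conv_arg(1)[OF assms(2), of g]
    by (intro integral_mono unit_L1D(1)[OF conv_integrand] unit_L1D(1)) (auto simp: unit_L1D mult_left_le_one_le)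
  then show ?thesis using conv_arg(2)[OF assms(2)] by simp
qed

lemma conv_measurable: "unit_L1 \<phi> \<Longrightarrow> unit_L1 \<psi> \<Longrightarrow> \<phi> \<star> \<psi> \<in> borel_measurable borel"
  by (rule borel_measurable_continuous_onI[OF continuous_convolution]) (auto simp: unit_L1D)

lemma conv_mass:
  assumes "unit_L1 \<phi>" "unit_L1 \<psi>"
  shows "integrable M (\<phi> \<star> \<psi>)" "mass (\<phi> \<star> \<psi>) = mass \<phi> * mass \<psi>"
proof -
  have e: "(\<integral>\<^sup>+x. ennreal (\<theta> x) \<partial>M) = ennreal (mass \<theta>)" if "unit_L1 \<theta>" for \<theta>
    by (rule nn_integral_eq_integral) (auto simp: unit_L1D[OF that])
  have "(\<integral>\<^sup>+g. (\<integral>\<^sup>+x. ennreal (\<phi> x) * ennreal (\<psi> (- x + g)) \<partial>M) \<partial>M) =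
      (\<integral>\<^sup>+x. ennreal (\<phi> x) \<partial>M) * (\<integral>\<^sup>+x. ennreal (\<psi> x) \<partial>M)"
    using assms by (intro nn_integral_conv measurable_compose[OF unit_L1D(2) measurable_ennreal]) (auto simp: e)
  then have "(\<integral>\<^sup>+g. (\<integral>\<^sup>+x. ennreal (\<phi> x) * ennreal (\<psi> (- x + g)) \<partial>M) \<partial>M) = ennreal (mass \<phi> * mass \<psi>)"
    using assms by (simp add: e ennreal_mult mass_nonneg)
  moreover have "(\<integral>\<^sup>+x. ennreal (\<phi> x) * ennreal (\<psi> (- x + g)) \<partial>M) = ennreal ((\<phi> \<star> \<psi>) g)" for g
    unfolding group_convolution_def e[OF conv_integrand[OF assms, of g], symmetric]
    using assms by (intro nn_integral_cong) (simp add: ennreal_mult unit_L1D)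
  ultimately have n: "(\<integral>\<^sup>+g. ennreal ((\<phi> \<star> \<psi>) g) \<partial>M) = ennreal (mass \<phi> * mass \<psi>)" by simp
  show "integrable M (\<phi> \<star> \<psi>)"
    using n by (intro integrableI_nonneg) (auto simp: conv_measurable conv_nonneg assms)
  show "mass (\<phi> \<star> \<psi>) = mass \<phi> * mass \<psi>"
    using n by (subst integral_eq_nn_integral) (auto simp: conv_measurable conv_nonneg mass_nonneg assms)
qed

lemma conv_mono:
  assumes "unit_L1 \<phi>" "unit_L1 \<psi>" "unit_L1 \<phi>'" "unit_L1 \<psi>'" "\<And>x. \<phi> x \<le> \<phi>' x" "\<And>x. \<psi> x \<le> \<psi>' x"
  shows "(\<phi> \<star> \<psi>) g \<le> (\<phi>' \<star> \<psi>') g"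
  unfolding group_convolution_def
  using assms by (intro integral_mono unit_L1D(1)[OF conv_integrand] mult_mono) (auto simp: unit_L1D)

lemma conv_translate:
  assumes "unit_L1 \<phi>" "unit_L1 \<psi>"
  shows "((\<lambda>x. \<phi> (x0 + x)) \<star> (\<lambda>x. \<psi> (x + y0))) g = (\<phi> \<star> \<psi>) (x0 + g + y0)"
proof -
  have "(\<phi> \<star> \<psi>) (x0 + g + y0) = (LINT x|M. \<phi> (x0 + x) * \<psi> (- (x0 + x) + (x0 + g + y0)))"
    unfolding group_convolution_def
    by (rule integral_left[symmetric, of "\<lambda>x. \<phi> x * \<psi> (- x + (x0 + g + y0))"])
      (rule unit_L1D(2)[OF conv_integrand[OF assms]])
  moreover have "- (x0 + x) + (x0 + g + y0) = - x + g + y0" for x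
    by (metis (no_types, opaque_lifting) add.assoc minus_add minus_add_cancel)
  ultimately show ?thesis unfolding group_convolution_def by simp
qed

lemma integrable_conv_comp:
  assumes "unit_L1 \<phi>" "unit_L1 \<psi>" "F \<in> borel_measurable borel" "\<And>y. 0 \<le> y \<Longrightarrow> \<bar>F y\<bar> \<le> C * y"
  shows "integrable M (\<lambda>g. F ((\<phi> \<star> \<psi>) g))"
proof (rule Bochner_Integration.integrable_bound)
  show "integrable M (\<lambda>g. C * (\<phi> \<star> \<psi>) g)" using conv_mass(1)[OF assms(1,2)] by simp
  show "(\<lambda>g. F ((\<phi> \<star> \<psi>) g)) \<in> borel_measurable M"
    using measurable_compose[OF conv_measurable[OF assms(1,2)] assms(3)] by simp
  show "AE g in M. norm (F ((\<phi> \<star> \<psi>) g)) \<le> norm (C * (\<phi> \<star> \<psi>) g)"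
    by (rule AE_I2) (use assms(4)[OF conv_nonneg[OF assms(1,2)]] in \<open>simp add: order_trans[OF _ abs_ge_self]\<close>)
qed

lemma integrable_min_conv:
  assumes "unit_L1 \<phi>" "unit_L1 \<psi>" "0 \<le> t"
  shows "integrable M (\<lambda>g. min ((\<phi> \<star> \<psi>) g) t)"
  using assms(3) by (intro integrable_conv_comp[OF assms(1,2), of "\<lambda>y. min y t" 1]) auto

lemma integrable_excess:
  assumes "unit_L1 \<phi>" "unit_L1 \<psi>" "0 \<le> t"
  shows "integrable M (\<lambda>g. max 0 ((\<phi> \<star> \<psi>) g - t))"
  using assms(3) by (intro integrable_conv_comp[OF assms(1,2), of "\<lambda>y. max 0 (y - t)" 1]) auto

lemma excess_eq:
  assumes "unit_L1 \<phi>" "unit_L1 \<psi>" "0 \<le> t"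
  shows "(LINT g|M. max 0 ((\<phi> \<star> \<psi>) g - t)) = mass \<phi> * mass \<psi> - (LINT g|M. min ((\<phi> \<star> \<psi>) g) t)"
proof -
  have "(LINT g|M. max 0 ((\<phi> \<star> \<psi>) g - t)) = (LINT g|M. (\<phi> \<star> \<psi>) g - min ((\<phi> \<star> \<psi>) g) t)"
    by (intro Bochner_Integration.integral_cong) auto
  also have "\<dots> = mass (\<phi> \<star> \<psi>) - (LINT g|M. min ((\<phi> \<star> \<psi>) g) t)"
    using assms by (intro Bochner_Integration.integral_diff conv_mass integrable_min_conv)
  finally show ?thesis using conv_mass(2)[OF assms(1,2)] by simp
qed

end

section \<open>Submodularity\<close>

context unimodular_haar
begin

text \<open>Words in \<open>U\<close> are closed under inverses because \<open>U\<close> is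
  symmetric, and form an open set because a letter from \<open>N\<close> can be appended to any
  word.\<close>

lemma subgroup_generated_open:
  assumes N: "open N" "0 \<in> N" "N \<subseteq> U" and U: "\<And>u. u \<in> U \<Longrightarrow> - u \<in> U"
  shows "open_subgroup {g::'a. \<exists>us. set us \<subseteq> U \<and> g = sum_list us}" (is "open_subgroup ?K")
  unfolding open_subgroup_def
proof (intro conjI ballI)
  have add: "x + y \<in> ?K" if xy: "x \<in> ?K" "y \<in> ?K" for x y
  proof -
    obtain us where "set us \<subseteq> U" "x = sum_list us" using xy(1) by auto
    moreover obtain vs where "set vs \<subseteq> U" "y = sum_list vs" using xy(2) by auto
    ultimately show ?thesis by (auto intro!: exI[of _ "us @ vs"])
  qed
  show "x + y \<in> ?K" if "x \<in> ?K" "y \<in> ?K" for x y by (rule add[OF that])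
  show "0 \<in> ?K" by (auto intro!: exI[of _ "[]"])
  show "- x \<in> ?K" if x: "x \<in> ?K" for x
  proof -
    obtain us where us: "set us \<subseteq> U" "x = sum_list us" using x by auto
    have "- sum_list us = sum_list (rev (map uminus us))"
      by (induction us) (auto simp: minus_add)
    moreover have "set (rev (map uminus us)) \<subseteq> U" using us(1) U by auto
    ultimately show ?thesis using us(2) by blast
  qed
  show "open ?K"
  proof (subst open_subopen, intro ballI)
    fix g assume g: "g \<in> ?K"
    let ?T = "(\<lambda>h. - g + h) -` N"
    have "open ?T" by (intro open_vimage N(1) continuous_intros)
    moreover have "g \<in> ?T" using N(2) by simp
    moreover have "?T \<subseteq> ?K"
    proof
      fix h assume "h \<in> ?T"
      then have "- g + h \<in> ?K" using N(3) by (auto intro!: exI[of _ "[- g + h]"])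
      from add[OF g this] show "h \<in> ?K" by (simp add: add.assoc[symmetric])
    qed
    ultimately show "\<exists>T. open T \<and> g \<in> T \<and> T \<subseteq> ?K" by blast
  qed
qed

text \<open>Autocorrelation of \<open>\<phi>\<close>; for the indicator of a set it is the measure
  of the intersection with a translate.\<close>

definition overlap :: "('a \<Rightarrow> real) \<Rightarrow> 'a \<Rightarrow> real" where
  "overlap \<phi> g = mass (\<lambda>x. \<phi> x * \<phi> (- g + x))"

lemma overlap_eq_conv: "overlap \<phi> = \<phi> \<star> (\<lambda>x. \<phi> (- x))"
  unfolding overlap_def group_convolution_def by (rule ext) (simp add: minus_add)

text \<open>Markov's inequality: the overlap integrates to the square of the mass, so it cannot
  exceed \<open>c\<close> on all of \<open>K\<close>.\<close>

lemma overlap_small: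
  assumes \<phi>: "unit_L1 \<phi>" and K: "K \<in> sets borel" and c: "0 \<le> c"
    and less: "ennreal ((mass \<phi>)\<^sup>2) < ennreal c * emeasure M K"
  shows "\<exists>g\<in>K. overlap \<phi> g \<le> c"
proof (rule ccontr)
  assume "\<not> ?thesis"
  then have big: "c < overlap \<phi> g" if "g \<in> K" for g using that by auto
  have \<phi>': "unit_L1 (\<lambda>x. \<phi> (- x))" by (rule unit_L1_uminus[OF \<phi>])
  have nn: "0 \<le> overlap \<phi> g" for g unfolding overlap_eq_conv by (rule conv_nonneg[OF \<phi> \<phi>'])
  have "ennreal c * emeasure M K = (\<integral>\<^sup>+g. ennreal c * indicator K g \<partial>M)"
    using K by (simp add: nn_integral_cmult_indicator)
  also have "\<dots> \<le> (\<integral>\<^sup>+g. ennreal (overlap \<phi> g) \<partial>M)"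
    using big nn by (intro nn_integral_mono) (auto simp: indicator_def intro: ennreal_leI less_imp_le)
  also have "\<dots> = ennreal (mass (overlap \<phi>))"
    using nn conv_mass(1)[OF \<phi> \<phi>'] by (intro nn_integral_eq_integral) (auto simp: overlap_eq_conv)
  also have "mass (overlap \<phi>) = (mass \<phi>)\<^sup>2"
    unfolding overlap_eq_conv conv_mass(2)[OF \<phi> \<phi>'] integral_uminus[OF unit_L1D(2)[OF \<phi>]]
    by (simp add: power2_eq_square)
  finally show False using less by simp
qed

text \<open>Only the second factor changes, by a translate of the difference between
  \<open>\<phi>\<close> and its translate by u, and the first factor is at most 1. Left invariance
  removes the dependence of the error on g.\<close>

lemma overlap_step:
  assumes \<phi>: "unit_L1 \<phi>"
  shows "overlap \<phi> g \<le> overlap \<phi> (g + u) + (LINT x|M. \<bar>\<phi> (- u + x) - \<phi> x\<bar>)"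
proof -
  note i = unit_L1_left[OF \<phi>, of "- g"] unit_L1_left[OF \<phi>, of "- (g + u)"]
  note j = unit_L1D(1)[OF unit_L1_mult[OF \<phi> i(1)]] unit_L1D(1)[OF unit_L1_mult[OF \<phi> i(2)]]
  have d: "integrable M (\<lambda>x. \<bar>\<phi> (- u + x) - \<phi> x\<bar>)"
    using unit_L1D(1)[OF \<phi>] unit_L1D(1)[OF unit_L1_left[OF \<phi>, of "- u"]] by simp
  have "overlap \<phi> g \<le> (LINT x|M. \<phi> x * \<phi> (- (g + u) + x) + \<bar>\<phi> (- u + (- g + x)) - \<phi> (- g + x)\<bar>)"
    unfolding overlap_def
  proof (rule integral_mono)
    show "integrable M (\<lambda>x. \<phi> x * \<phi> (- (g + u) + x) + \<bar>\<phi> (- u + (- g + x)) - \<phi> (- g + x)\<bar>)"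
      using j integrable_left[OF d, of "- g"] by simp
    fix x
    have e: "- (g + u) + x = - u + (- g + x)" by (metis add.assoc minus_add)
    have "\<phi> x * (\<phi> (- g + x) - \<phi> (- (g + u) + x)) \<le> 1 * \<bar>\<phi> (- (g + u) + x) - \<phi> (- g + x)\<bar>"
    proof -
      have "\<phi> x * d \<le> 1 * \<bar>d\<bar>" for d
        using unit_L1D(3,4)[OF \<phi>, of x] mult_left_mono[of d "\<bar>d\<bar>" "\<phi> x"] mult_right_mono[of "\<phi> x" 1 "\<bar>d\<bar>"]
        by linarith
      then show ?thesis by (subst abs_minus_commute)
    qed
    then show "\<phi> x * \<phi> (- g + x) \<le> \<phi> x * \<phi> (- (g + u) + x) + \<bar>\<phi> (- u + (- g + x)) - \<phi> (- g + x)\<bar>"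
      unfolding e by (simp add: algebra_simps)
  qed (use j in simp)
  also have "\<dots> = overlap \<phi> (g + u) + (LINT x|M. \<bar>\<phi> (- u + (- g + x)) - \<phi> (- g + x)\<bar>)"
    unfolding overlap_def using j integrable_left[OF d, of "- g"] by simp
  also have "(LINT x|M. \<bar>\<phi> (- u + (- g + x)) - \<phi> (- g + x)\<bar>) = (LINT x|M. \<bar>\<phi> (- u + x) - \<phi> x\<bar>)"
    using borel_measurable_integrable[OF d] integral_left[where f = "\<lambda>x. \<bar>\<phi> (- u + x) - \<phi> x\<bar>" and g = "- g"] by simp
  finally show ?thesis .
qed

text \<open>The subgroup generated by a small neighbourhood of \<open>0\<close> plays the role of connectedness: walking
  through it in small steps, the overlap passes every value between its extremes up to a small error.\<close>
lemma exists_intersection: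
  assumes \<phi>: "unit_L1 \<phi>" and H: "open_subgroup H" and r: "0 < r" "r \<le> mass \<phi>"
    and vol: "\<And>K. open_subgroup K \<Longrightarrow> K \<subseteq> H \<Longrightarrow> ennreal ((mass \<phi>)\<^sup>2) < ennreal (mass \<phi> - r) * emeasure M K"
  shows "\<exists>g\<in>H. \<exists>h. h \<in> borel_measurable borel \<and>
    (\<forall>x. 0 \<le> h x \<and> h x \<le> \<phi> x \<and> h x \<le> \<phi> (- g + x) \<and> \<phi> x + \<phi> (- g + x) - h x \<le> 1) \<and>
    r / 2 \<le> mass \<phi> - mass h \<and> mass \<phi> - mass h \<le> r"
proof -
  note [measurable] = unit_L1D(2)[OF \<phi>]
  define \<delta> where "\<delta> g = mass \<phi> - overlap \<phi> g" for g
  \<comment> \<open>The product serves as intersection; the corresponding union p + q - p q stays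
    below 1 because \<open>(1 - p) * (1 - q)\<close> is nonnegative.\<close>
  have prod: "\<exists>h. h \<in> borel_measurable borel \<and>
    (\<forall>x. 0 \<le> h x \<and> h x \<le> \<phi> x \<and> h x \<le> \<phi> (- g + x) \<and> \<phi> x + \<phi> (- g + x) - h x \<le> 1) \<and>
    r / 2 \<le> mass \<phi> - mass h \<and> mass \<phi> - mass h \<le> r" if "r / 2 \<le> \<delta> g" "\<delta> g \<le> r" for g
  proof (intro exI[of _ "\<lambda>x. \<phi> x * \<phi> (- g + x)"] conjI allI)
    note u = unit_L1D[OF \<phi>]
    show "(\<lambda>x. \<phi> x * \<phi> (- g + x)) \<in> borel_measurable borel"
      by (rule unit_L1D(2)[OF unit_L1_mult[OF \<phi> unit_L1_left[OF \<phi>]]])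
    show "0 \<le> \<phi> x * \<phi> (- g + x)" "\<phi> x * \<phi> (- g + x) \<le> \<phi> x" "\<phi> x * \<phi> (- g + x) \<le> \<phi> (- g + x)" for x
      using u(3,4) by (auto simp: mult_left_le mult_left_le_one_le)
    show "\<phi> x + \<phi> (- g + x) - \<phi> x * \<phi> (- g + x) \<le> 1" for x
      using mult_nonneg_nonneg[of "1 - \<phi> x" "1 - \<phi> (- g + x)"] u(4)[of x] u(4)[of "- g + x"]
      by (simp add: algebra_simps)
  qed (use that in \<open>simp_all add: \<delta>_def overlap_def\<close>)
  have H0: "0 \<in> H" using H by (simp add: open_subgroup_def)
  show ?thesis
  proof (cases "r \<le> \<delta> 0")
    case True
    then have \<delta>0: "0 < \<delta> 0" using r by simp
    \<comment> \<open>When \<open>\<phi>\<close> is far from an indicator, its square already loses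
      at least the mass \<open>r\<close>. The witness at \<open>g = 0\<close> therefore interpolates
      between \<open>\<phi>\<close> and its square so as to lose exactly \<open>r\<close>.\<close>
    define l where "l = r / \<delta> 0"
    have l: "0 \<le> l" "l \<le> 1" using True \<delta>0 r by (auto simp: l_def)
    let ?h = "\<lambda>x. \<phi> x - l * (\<phi> x - \<phi> x * \<phi> x)"
    have h: "0 \<le> ?h x \<and> ?h x \<le> \<phi> x \<and> ?h x \<le> \<phi> (- 0 + x) \<and> \<phi> x + \<phi> (- 0 + x) - ?h x \<le> 1" for x
    proof -
      have u: "0 \<le> \<phi> x" "\<phi> x \<le> 1" using unit_L1D[OF \<phi>] by auto
      have q: "0 \<le> \<phi> x - \<phi> x * \<phi> x" using u by (simp add: mult_left_le)
      have "l * (\<phi> x - \<phi> x * \<phi> x) \<le> 1 * (\<phi> x - \<phi> x * \<phi> x)" using l q by (intro mult_right_mono) auto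
      moreover have "0 \<le> l * (\<phi> x - \<phi> x * \<phi> x)" using l q by simp
      moreover have "0 \<le> (1 - \<phi> x) * (1 - \<phi> x)" by simp
      then have "2 * \<phi> x - \<phi> x * \<phi> x \<le> 1" by (simp add: algebra_simps)
      moreover have "0 \<le> \<phi> x * \<phi> x" by simp
      moreover have "0 \<le> p - m \<and> p - m \<le> p \<and> 2 * p - (p - m) \<le> 1"
        if "m \<le> 1 * (p - q)" "0 \<le> m" "2 * p - q \<le> 1" "0 \<le> q" for m p q :: real
        using that by simp
      ultimately have "0 \<le> ?h x \<and> ?h x \<le> \<phi> x \<and> 2 * \<phi> x - ?h x \<le> 1" by blast
      then show ?thesis by simp
    qed
    have "mass ?h = mass \<phi> - l * \<delta> 0"
      unfolding \<delta>_def overlap_def using unit_L1D(1)[OF \<phi>] unit_L1D(1)[OF unit_L1_mult[OF \<phi> \<phi>]] by simp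
    also have "\<dots> = mass \<phi> - r" using \<delta>0 by (simp add: l_def)
    finally have "mass \<phi> - mass ?h = r" by simp
    moreover have "?h \<in> borel_measurable borel" by measurable
    ultimately show ?thesis using r h by (intro bexI[OF _ H0] exI[of _ ?h]) simp
  next
    case False
    obtain N where N: "open N" "0 \<in> N" "\<And>u. u \<in> N \<Longrightarrow> (LINT x|M. \<bar>\<phi> (u + x) - \<phi> x\<bar>) < r / 2"
      using L1_continuous_translation[OF unit_L1D(1)[OF \<phi>], of "r / 2"] r by auto
    \<comment> \<open>Defined by the displacement of \<open>\<phi>\<close> rather than by
      \<open>N\<close>: the displacements by u and - u agree, which makes \<open>U\<close>
      symmetric.\<close>
    define U where "U = {u\<in>H. (LINT x|M. \<bar>\<phi> (- u + x) - \<phi> x\<bar>) < r / 2}"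
    define K where "K = {g. \<exists>us. set us \<subseteq> U \<and> g = sum_list us}"
    have symm: "- u \<in> U" if "u \<in> U" for u
    proof -
      have "(LINT x|M. \<bar>\<phi> (- (- u) + x) - \<phi> x\<bar>) = (LINT x|M. \<bar>\<phi> (- (- u) + (- u + x)) - \<phi> (- u + x)\<bar>)"
        by (rule integral_left[symmetric, of "\<lambda>x. \<bar>\<phi> (- (- u) + x) - \<phi> x\<bar>"]) measurable
      also have "\<dots> = (LINT x|M. \<bar>\<phi> (- u + x) - \<phi> x\<bar>)"
        by (simp add: add.assoc[symmetric] abs_minus_commute)
      finally show ?thesis using that H unfolding U_def open_subgroup_def by auto
    qed
    have "open (H \<inter> (\<lambda>x. - x) -` N)"
      using H N(1) by (intro open_Int open_vimage continuous_intros) (auto simp: open_subgroup_def)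
    moreover have "0 \<in> H \<inter> (\<lambda>x. - x) -` N" using H0 N(2) by simp
    moreover have "H \<inter> (\<lambda>x. - x) -` N \<subseteq> U" using N(3) by (auto simp: U_def)
    ultimately have K: "open_subgroup K" unfolding K_def by (rule subgroup_generated_open) (rule symm)
    have sumH: "sum_list us \<in> H" if "set us \<subseteq> U" for us
      using that H by (induction us) (auto simp: U_def open_subgroup_def)
    then have KH: "K \<subseteq> H" unfolding K_def by auto
    have "\<exists>g\<in>K. overlap \<phi> g \<le> mass \<phi> - r"
      using K r by (intro overlap_small[OF \<phi> _ _ vol[OF K KH]]) (auto simp: open_subgroup_def)
    then obtain us where us: "set us \<subseteq> U" "r \<le> \<delta> (sum_list us)" unfolding K_def \<delta>_def by auto
    \<comment> \<open>Letters are removed from the end of the word. Appending a letter raises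
      \<delta> by less than \<open>r / 2\<close>, so a word with \<delta> \<ge> r / 2 whose
      shortening has \<delta> < r / 2 satisfies \<delta> \<le> r. For the empty word, \<delta> \<le>
      r is the case assumption.\<close>
    have "\<exists>g\<in>H. r / 2 \<le> \<delta> g \<and> \<delta> g \<le> r" if "set vs \<subseteq> U" "r / 2 \<le> \<delta> (sum_list vs)" for vs
      using that
    proof (induction vs rule: rev_induct)
      case Nil
      then show ?case using False H0 by (intro bexI[of _ 0]) auto
    next
      case (snoc u vs)
      show ?case
      proof (cases "r / 2 \<le> \<delta> (sum_list vs)")
        case True
        then show ?thesis using snoc by simp
      next
        case far: False
        have "(LINT x|M. \<bar>\<phi> (- u + x) - \<phi> x\<bar>) < r / 2" using snoc.prems(1) by (simp add: U_def)
        then have "\<delta> (sum_list vs + u) \<le> r"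
          using overlap_step[OF \<phi>, of "sum_list vs" u] far by (simp add: \<delta>_def)
        moreover have "r / 2 \<le> \<delta> (sum_list vs + u)" using snoc.prems(2) by simp
        moreover have "sum_list vs + u \<in> H" using sumH[OF snoc.prems(1)] by simp
        ultimately show ?thesis by blast
      qed
    qed
    from this[OF us(1)] obtain g where g: "g \<in> H" "r / 2 \<le> \<delta> g" "\<delta> g \<le> r" using us(2) r by auto
    show ?thesis using prod[OF g(2,3)] by (intro bexI[OF _ g(1)])
  qed
qed

definition deficit :: "('a \<Rightarrow> real) \<Rightarrow> real \<Rightarrow> ('a \<Rightarrow> real) \<Rightarrow> real" where
  "deficit \<psi> t \<phi> = (LINT g|M. min ((\<phi> \<star> \<psi>) g) t) - t * mass \<phi>"

text \<open>Pointwise, the convolutions of \<open>h\<close> and of its counterpart with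
  \<open>\<psi>\<close> have the same sum as those of \<open>\<phi>\<close> and its translate, but
  are spread further apart. Concavity of \<open>min _ t\<close> then gives the inequality for the
  truncated parts, and the terms linear in the mass cancel because the masses have equal sums
  too.\<close>

lemma deficit_submodular:
  assumes \<phi>: "unit_L1 \<phi>" and \<psi>: "unit_L1 \<psi>" and t: "0 \<le> t"
    and h: "h \<in> borel_measurable borel"
      "\<And>x. 0 \<le> h x \<and> h x \<le> \<phi> x \<and> h x \<le> \<phi> (- g + x) \<and> \<phi> x + \<phi> (- g + x) - h x \<le> 1"
  shows "unit_L1 h" "unit_L1 (\<lambda>x. \<phi> x + \<phi> (- g + x) - h x)"
    "mass (\<lambda>x. \<phi> x + \<phi> (- g + x) - h x) = 2 * mass \<phi> - mass h"
    "deficit \<psi> t h + deficit \<psi> t (\<lambda>x. \<phi> x + \<phi> (- g + x) - h x) \<le> 2 * deficit \<psi> t \<phi>"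
proof -
  let ?k = "\<lambda>x. \<phi> x + \<phi> (- g + x) - h x"
  let ?g\<phi> = "\<lambda>x. \<phi> (- g + x)"
  have g\<phi>: "unit_L1 ?g\<phi>" by (rule unit_L1_left[OF \<phi>])
  show uh: "unit_L1 h" using h by (intro unit_L1_bounded[OF \<phi>]) auto
  show uk: "unit_L1 ?k"
    unfolding unit_L1_def
  proof (intro conjI allI)
    show "integrable M ?k" using unit_L1D(1)[OF \<phi>] unit_L1D(1)[OF g\<phi>] unit_L1D(1)[OF uh] by simp
    show "0 \<le> ?k x" for x using h(2)[of x] by linarith
    show "?k x \<le> 1" for x using h(2)[of x] by linarith
  qed
  have mg: "mass ?g\<phi> = mass \<phi>" by (rule integral_left[OF unit_L1D(2)[OF \<phi>]])
  show mk: "mass ?k = 2 * mass \<phi> - mass h"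
    using unit_L1D(1)[OF \<phi>] unit_L1D(1)[OF g\<phi>] unit_L1D(1)[OF uh] mg by simp
  have tr: "(?g\<phi> \<star> \<psi>) x = (\<phi> \<star> \<psi>) (- g + x)" for x
    using conv_translate[OF \<phi> \<psi>, of "- g" 0 x] by simp
  have int: "integrable M (\<lambda>y. \<theta> y * \<psi> (- y + x))" if "unit_L1 \<theta>" for \<theta> x
    by (rule unit_L1D(1)[OF conv_integrand[OF that \<psi>]])
  have sum: "(h \<star> \<psi>) x + (?k \<star> \<psi>) x = (\<phi> \<star> \<psi>) x + (\<phi> \<star> \<psi>) (- g + x)" for x
    unfolding tr[symmetric] unfolding group_convolution_def
    using int[OF uh] int[OF \<phi>] int[OF g\<phi>] int[OF uk]
    by (simp add: Bochner_Integration.integral_add[symmetric] del: Bochner_Integration.integral_add)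
      (intro Bochner_Integration.integral_cong; simp add: algebra_simps)
  have le: "(h \<star> \<psi>) x \<le> (\<phi> \<star> \<psi>) x" "(h \<star> \<psi>) x \<le> (\<phi> \<star> \<psi>) (- g + x)" for x
    unfolding tr[symmetric] using h(2) by (intro conv_mono uh \<psi> \<phi> g\<phi>; simp)+
  note m = integrable_min_conv[OF _ \<psi> t]
  have "(LINT x|M. min ((h \<star> \<psi>) x) t) + (LINT x|M. min ((?k \<star> \<psi>) x) t) =
      (LINT x|M. min ((h \<star> \<psi>) x) t + min ((?k \<star> \<psi>) x) t)"
    by (rule Bochner_Integration.integral_add[OF m[OF uh] m[OF uk], symmetric])
  also have "\<dots> \<le> (LINT x|M. min ((\<phi> \<star> \<psi>) x) t + min ((\<phi> \<star> \<psi>) (- g + x)) t)"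
  proof (rule integral_mono)
    show "integrable M (\<lambda>x. min ((\<phi> \<star> \<psi>) x) t + min ((\<phi> \<star> \<psi>) (- g + x)) t)"
      using m[OF \<phi>] integrable_left[OF m[OF \<phi>], of "- g"] by simp
    show "min ((h \<star> \<psi>) x) t + min ((?k \<star> \<psi>) x) t \<le> min ((\<phi> \<star> \<psi>) x) t + min ((\<phi> \<star> \<psi>) (- g + x)) t" for x
      using sum[of x] le[of x] by (auto simp: min_def)
  qed (use m[OF uh] m[OF uk] in simp)
  also have "\<dots> = 2 * (LINT x|M. min ((\<phi> \<star> \<psi>) x) t)"
    using m[OF \<phi>] integrable_left[OF m[OF \<phi>], of "- g"]
      integral_left[where f = "\<lambda>x. min ((\<phi> \<star> \<psi>) x) t" and g = "- g"] borel_measurable_integrable[OF m[OF \<phi>]] by simp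
  finally show "deficit \<psi> t h + deficit \<psi> t ?k \<le> 2 * deficit \<psi> t \<phi>"
    unfolding deficit_def mk by (simp add: algebra_simps)
qed

end

section \<open>Functions supported in a minimal open subgroup\<close>

context unimodular_haar
begin

definition supported :: "('a \<Rightarrow> real) \<Rightarrow> 'a set \<Rightarrow> bool" where
  "supported \<phi> A \<longleftrightarrow> (\<forall>x. x \<notin> A \<longrightarrow> \<phi> x = 0)"

lemma subgroup_translate_iff:
  assumes "open_subgroup H" "g \<in> H"
  shows "- g + x \<in> H \<longleftrightarrow> x \<in> H" "- x + g \<in> H \<longleftrightarrow> x \<in> (H :: 'a set)"
proof -
  have c: "0 \<in> H" "\<And>x y. x \<in> H \<Longrightarrow> y \<in> H \<Longrightarrow> x + y \<in> H" "\<And>x. x \<in> H \<Longrightarrow> - x \<in> H"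
    using assms(1) by (auto simp: open_subgroup_def)
  have "x = g + (- g + x)" "x = g + - (- x + g)" by (simp_all add: minus_add add.assoc[symmetric])
  then show "- g + x \<in> H \<longleftrightarrow> x \<in> H" "- x + g \<in> H \<longleftrightarrow> x \<in> H"
    using c assms(2) by metis+
qed

text \<open>Provides the hypothesis \<open>move\<close> of \<open>chord_principle\<close>. Both new
  functions stay supported in \<open>H\<close> because \<open>g\<close> lies in \<open>H\<close>,
  and minimality of \<open>H\<close> passes the volume bound on to every open subgroup inside
  it.\<close>

lemma exists_split:
  assumes \<phi>: "unit_L1 \<phi>" "supported \<phi> H" and \<psi>: "unit_L1 \<psi>" and t: "0 \<le> t" and H: "open_subgroup H"
    and min: "\<And>K. open_subgroup K \<Longrightarrow> K \<subseteq> H \<Longrightarrow> emeasure M H \<le> emeasure M K"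
    and r: "0 < r" "r \<le> mass \<phi>" and vol: "ennreal ((mass \<phi>)\<^sup>2) < ennreal (mass \<phi> - r) * emeasure M H"
  shows "\<exists>\<delta> \<phi>1 \<phi>2. r / 2 \<le> \<delta> \<and> \<delta> \<le> r \<and> unit_L1 \<phi>1 \<and> supported \<phi>1 H \<and> unit_L1 \<phi>2 \<and> supported \<phi>2 H \<and>
    mass \<phi>1 = mass \<phi> - \<delta> \<and> mass \<phi>2 = mass \<phi> + \<delta> \<and> deficit \<psi> t \<phi>1 + deficit \<psi> t \<phi>2 \<le> 2 * deficit \<psi> t \<phi>"
proof -
  have "ennreal ((mass \<phi>)\<^sup>2) < ennreal (mass \<phi> - r) * emeasure M K" if "open_subgroup K" "K \<subseteq> H" for K
    using vol mult_left_mono[OF min[OF that], of "ennreal (mass \<phi> - r)"] by (rule_tac order_less_le_trans) auto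
  then obtain g h where g: "g \<in> H" and h: "h \<in> borel_measurable borel"
      "\<And>x. 0 \<le> h x \<and> h x \<le> \<phi> x \<and> h x \<le> \<phi> (- g + x) \<and> \<phi> x + \<phi> (- g + x) - h x \<le> 1"
      "r / 2 \<le> mass \<phi> - mass h" "mass \<phi> - mass h \<le> r"
    using exists_intersection[OF \<phi>(1) H r] by blast
  note sm = deficit_submodular[OF \<phi>(1) \<psi> t h(1,2)]
  have "h x = 0 \<and> \<phi> x + \<phi> (- g + x) - h x = 0" if "x \<notin> H" for x
  proof -
    have "\<phi> x = 0" "\<phi> (- g + x) = 0" using \<phi>(2) that subgroup_translate_iff(1)[OF H g] by (auto simp: supported_def)
    then show ?thesis using h(2)[of x] by simp
  qed
  then have "supported h H" "supported (\<lambda>x. \<phi> x + \<phi> (- g + x) - h x) H" by (auto simp: supported_def)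
  then show ?thesis
    using sm h(3,4)
    by (intro exI[of _ "mass \<phi> - mass h"] exI[of _ h] exI[of _ "\<lambda>x. \<phi> x + \<phi> (- g + x) - h x"] conjI) simp_all
qed

text \<open>By concavity \<open>min y t\<close> lies above its chord \<open>t / c * y\<close> on
  \<open>[0, c]\<close>. Taking for \<open>c\<close> the mass of either factor gives the two
  elementary bounds on the deficit.\<close>

lemma scaled_conv_le:
  assumes \<phi>: "unit_L1 \<phi>" and \<psi>: "unit_L1 \<psi>" and t: "0 \<le> t" "t \<le> c" "0 < c" and le: "\<And>g. (\<phi> \<star> \<psi>) g \<le> c"
  shows "t / c * (mass \<phi> * mass \<psi>) \<le> (LINT g|M. min ((\<phi> \<star> \<psi>) g) t)"
proof -
  have "t / c * (mass \<phi> * mass \<psi>) = (LINT g|M. t / c * (\<phi> \<star> \<psi>) g)"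
    using conv_mass[OF \<phi> \<psi>] by simp
  also have "\<dots> \<le> (LINT g|M. min ((\<phi> \<star> \<psi>) g) t)"
  proof (rule integral_mono)
    fix g
    have "t / c * (\<phi> \<star> \<psi>) g \<le> 1 * (\<phi> \<star> \<psi>) g" "t / c * (\<phi> \<star> \<psi>) g \<le> t / c * c"
      using t conv_nonneg[OF \<phi> \<psi>, of g] le[of g] by (intro mult_right_mono mult_left_mono; simp)+
    then show "t / c * (\<phi> \<star> \<psi>) g \<le> min ((\<phi> \<star> \<psi>) g) t" using t by simp
  qed (use conv_mass[OF \<phi> \<psi>] integrable_min_conv[OF \<phi> \<psi> t(1)] in simp_all)
  finally show ?thesis .
qed

text \<open>Inclusion-exclusion: p q \<ge> p + q - 1 for p, q in [0, 1], integrated over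
  \<open>H\<close>, outside of which both factors of the integrand vanish.\<close>

lemma conv_lower_bound:
  assumes \<phi>: "unit_L1 \<phi>" "supported \<phi> H" and \<psi>: "unit_L1 \<psi>" "supported \<psi> H" and H: "open_subgroup H"
    and m: "emeasure M H = ennreal m" "0 \<le> m" and g: "g \<in> H"
  shows "mass \<phi> + mass \<psi> - m \<le> (\<phi> \<star> \<psi>) g"
proof -
  have sH: "H \<in> sets M" using H by (simp add: open_subgroup_def)
  have i: "integrable M (indicator H :: 'a \<Rightarrow> real)" using sH m by (intro integrable_real_indicator) auto
  note a = conv_arg[OF \<psi>(1), of g]
  have "mass \<phi> + mass \<psi> - m = (LINT x|M. \<phi> x + \<psi> (- x + g) - indicator H x)"
    using unit_L1D(1)[OF \<phi>(1)] unit_L1D(1)[OF a(1)] i a(2) sH m by (simp add: measure_def)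
  also have "\<dots> \<le> (\<phi> \<star> \<psi>) g"
    unfolding group_convolution_def
  proof (rule integral_mono)
    show "\<phi> x + \<psi> (- x + g) - indicator H x \<le> \<phi> x * \<psi> (- x + g)" for x
    proof (cases "x \<in> H")
      case True
      have "0 \<le> (1 - \<phi> x) * (1 - \<psi> (- x + g))"
        using unit_L1D(4)[OF \<phi>(1), of x] unit_L1D(4)[OF \<psi>(1), of "- x + g"] by simp
      then show ?thesis using True by (simp add: algebra_simps)
    next
      case False
      then have "- x + g \<notin> H" using subgroup_translate_iff(2)[OF H g] by simp
      then show ?thesis using False \<phi>(2) \<psi>(2) by (simp add: supported_def)
    qed
  qed (use unit_L1D(1)[OF \<phi>(1)] unit_L1D(1)[OF a(1)] i unit_L1D(1)[OF conv_integrand[OF \<phi>(1) \<psi>(1)]] in simp_all)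
  finally show ?thesis .
qed

text \<open>At mass \<open>m - mass \<psi> + t\<close> the convolution is at least \<open>t\<close>
  on all of \<open>H\<close>, which yields \<open>t * (mass \<psi> - t)\<close>. Missing mass lowers
  the pointwise bound by its own amount, over a volume \<open>m\<close>.\<close>

lemma deficit_upper_end:
  assumes \<phi>: "unit_L1 \<phi>" "supported \<phi> H" and \<psi>: "unit_L1 \<psi>" "supported \<psi> H" and H: "open_subgroup H"
    and m: "emeasure M H = ennreal m" "0 \<le> m" and t: "0 \<le> t" "mass \<phi> \<le> m - mass \<psi> + t"
  shows "t * (mass \<psi> - t) - m * (m - mass \<psi> + t - mass \<phi>) \<le> deficit \<psi> t \<phi>"
proof -
  let ?l = "mass \<phi> + mass \<psi> - m"
  have sH: "H \<in> sets M" using H by (simp add: open_subgroup_def)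
  have i: "integrable M (indicator H :: 'a \<Rightarrow> real)" using sH m by (intro integrable_real_indicator) auto
  have "m * ?l = (LINT g|M. ?l * indicator H g)" using sH m by (simp add: measure_def mult.commute)
  also have "\<dots> \<le> (LINT g|M. min ((\<phi> \<star> \<psi>) g) t)"
  proof (rule integral_mono)
    show "?l * indicator H g \<le> min ((\<phi> \<star> \<psi>) g) t" for g
      using conv_lower_bound[OF assms(1-7), of g] conv_nonneg[OF \<phi>(1) \<psi>(1), of g] t
      by (auto simp: indicator_def)
  qed (use i integrable_min_conv[OF \<phi>(1) \<psi>(1) t(1)] in simp_all)
  finally have "m * ?l - t * mass \<phi> \<le> deficit \<psi> t \<phi>" by (simp add: deficit_def)
  moreover have "0 \<le> t * (m - mass \<psi> + t - mass \<phi>)" using t by simp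
  ultimately show ?thesis by (simp add: algebra_simps)
qed

lemma deficit_lower_bound:
  assumes H: "open_subgroup H"
    and min: "\<And>K. open_subgroup K \<Longrightarrow> K \<subseteq> H \<Longrightarrow> emeasure M H \<le> emeasure M K"
    and \<phi>: "unit_L1 \<phi>" "supported \<phi> H" and \<psi>: "unit_L1 \<psi>" "supported \<psi> H"
    and vol: "ennreal (mass \<phi> + mass \<psi>) \<le> emeasure M H"
    and t: "0 < t" "t \<le> mass \<phi>" "t < mass \<psi>"
  shows "t * (mass \<psi> - t) \<le> deficit \<psi> t \<phi>"
proof -
  let ?b = "mass \<psi>"
  let ?\<kappa> = "t * (?b - t)"
  \<comment> \<open>The extra term is linear in the mass and hence respected by splitting. It
    vanishes in the case of finite volume; for infinite volume a positive \<open>\<nu>\<close>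
    supplies the right end of the interval.\<close>
  define X where "X \<nu> = {(mass \<theta>, deficit \<psi> t \<theta> + \<nu> * mass \<theta>) | \<theta>. unit_L1 \<theta> \<and> supported \<theta> H}" for \<nu>
  have XE: "\<exists>\<theta>. unit_L1 \<theta> \<and> supported \<theta> H \<and> s = mass \<theta> \<and> d = deficit \<psi> t \<theta> + \<nu> * mass \<theta>" if "(s, d) \<in> X \<nu>" for s d \<nu>
    using that by (auto simp: X_def)
  \<comment> \<open>A convolution never exceeds the mass of \<open>\<theta>\<close>. At mass
    \<open>t\<close> nothing is truncated and the bound is the full one.\<close>
  have left: "?\<kappa> - t * (mass \<theta> - t) \<le> deficit \<psi> t \<theta>" if \<theta>: "unit_L1 \<theta>" "t \<le> mass \<theta>" for \<theta>
  proof -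
    have "t / mass \<theta> * (mass \<theta> * ?b) \<le> (LINT g|M. min ((\<theta> \<star> \<psi>) g) t)"
      using t \<theta>(2) conv_le_left[OF \<theta>(1) \<psi>(1)] by (intro scaled_conv_le[OF \<theta>(1) \<psi>(1)]) auto
    then have "t * ?b \<le> (LINT g|M. min ((\<theta> \<star> \<psi>) g) t)" using t \<theta>(2) by simp
    then show ?thesis by (simp add: deficit_def algebra_simps)
  qed
  have nonneg: "0 \<le> deficit \<psi> t \<theta>" if \<theta>: "unit_L1 \<theta>" for \<theta>
  proof -
    have "t / ?b * (mass \<theta> * ?b) \<le> (LINT g|M. min ((\<theta> \<star> \<psi>) g) t)"
      using t conv_le_right[OF \<theta> \<psi>(1)] by (intro scaled_conv_le[OF \<theta> \<psi>(1)]) auto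
    then show ?thesis using t by (simp add: deficit_def)
  qed
  have move: "\<exists>\<delta> d1 d2. r / 2 \<le> \<delta> \<and> \<delta> \<le> r \<and> (s - \<delta>, d1) \<in> X \<nu> \<and> (s + \<delta>, d2) \<in> X \<nu> \<and> d1 + d2 \<le> 2 * d"
    if sd: "(s, d) \<in> X \<nu>" and r: "0 < r" "r \<le> s" "ennreal (s\<^sup>2) < ennreal (s - r) * emeasure M H" for s d r \<nu>
  proof -
    obtain \<theta> where \<theta>: "unit_L1 \<theta>" "supported \<theta> H" "s = mass \<theta>" "d = deficit \<psi> t \<theta> + \<nu> * mass \<theta>"
      using XE[OF sd] by blast
    obtain \<delta> \<phi>1 \<phi>2 where *: "r / 2 \<le> \<delta>" "\<delta> \<le> r" "unit_L1 \<phi>1" "supported \<phi>1 H" "unit_L1 \<phi>2" "supported \<phi>2 H"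
      "mass \<phi>1 = mass \<theta> - \<delta>" "mass \<phi>2 = mass \<theta> + \<delta>" "deficit \<psi> t \<phi>1 + deficit \<psi> t \<phi>2 \<le> 2 * deficit \<psi> t \<theta>"
      using exists_split[OF \<theta>(1,2) \<psi>(1) _ H min, of t r] r t unfolding \<theta>(3) by auto
    have "(mass \<phi>1, deficit \<psi> t \<phi>1 + \<nu> * mass \<phi>1) \<in> X \<nu>" "(mass \<phi>2, deficit \<psi> t \<phi>2 + \<nu> * mass \<phi>2) \<in> X \<nu>"
      using *(3-6) unfolding X_def by blast+
    then have "(s - \<delta>, deficit \<psi> t \<phi>1 + \<nu> * mass \<phi>1) \<in> X \<nu>" "(s + \<delta>, deficit \<psi> t \<phi>2 + \<nu> * mass \<phi>2) \<in> X \<nu>"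
      using *(7,8) \<theta>(3) by simp_all
    moreover have "deficit \<psi> t \<phi>1 + \<nu> * mass \<phi>1 + (deficit \<psi> t \<phi>2 + \<nu> * mass \<phi>2) \<le> 2 * d"
    proof -
      have "\<nu> * mass \<phi>1 + \<nu> * mass \<phi>2 = 2 * (\<nu> * mass \<theta>)"
        unfolding *(7,8) by (simp add: algebra_simps)
      then show ?thesis unfolding \<theta>(4) using *(9) by simp
    qed
    ultimately show ?thesis using *(1,2) by blast
  qed
  have mem: "(mass \<phi>, deficit \<psi> t \<phi> + \<nu> * mass \<phi>) \<in> X \<nu>" for \<nu> using \<phi> by (auto simp: X_def)
  show ?thesis
  proof (cases "emeasure M H")
    case top
    have "?\<kappa> \<le> deficit \<psi> t \<phi> + \<nu> * mass \<phi>" if \<nu>: "0 < \<nu>" for \<nu>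
    proof (rule chord_principle[OF _ _ t(1) _ _ _ mem t(2)])
      \<comment> \<open>At mass \<open>hi\<close> the term with \<open>\<nu>\<close> alone reaches
        the bound, the deficit being nonnegative.\<close>
      define hi where "hi = max (mass \<phi>) (?\<kappa> / \<nu>)"
      show "mass \<phi> \<le> hi" by (simp add: hi_def)
      have "?\<kappa> / \<nu> \<le> hi" by (simp add: hi_def)
      then have hi: "?\<kappa> \<le> \<nu> * hi" using \<nu> by (simp add: pos_divide_le_eq mult.commute)
      show "0 \<le> t" "0 \<le> t + \<nu>" using t \<nu> by auto
      fix s d assume sd: "(s, d) \<in> X \<nu>" and s: "t \<le> s"
      obtain \<theta> where \<theta>: "unit_L1 \<theta>" "s = mass \<theta>" "d = deficit \<psi> t \<theta> + \<nu> * mass \<theta>" using XE[OF sd] by blast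
      have "0 \<le> \<nu> * (s - t)" "0 \<le> \<nu> * s" using \<nu> s t by simp_all
      then show "?\<kappa> - (t + \<nu>) * (s - t) \<le> d" using left[OF \<theta>(1)] s \<theta>(2,3) by (simp add: algebra_simps)
      assume "s \<le> hi"
      then have "0 \<le> t * (hi - s)" using t by simp
      then show "?\<kappa> - (t + \<nu>) * (hi - s) \<le> d"
        using nonneg[OF \<theta>(1)] hi \<theta>(2,3) by (simp add: algebra_simps)
    next
      fix s d r assume a: "(s, d) \<in> X \<nu>" "t + r \<le> s" "0 < r"
      have "ennreal (s - r) * emeasure M H = top" using top a t by (simp add: ennreal_mult_top)
      then show "\<exists>\<delta> d1 d2. r / 2 \<le> \<delta> \<and> \<delta> \<le> r \<and> (s - \<delta>, d1) \<in> X \<nu> \<and> (s + \<delta>, d2) \<in> X \<nu> \<and> d1 + d2 \<le> 2 * d"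
        using a t by (intro move) auto
    qed
    then have *: "?\<kappa> \<le> deficit \<psi> t \<phi> + \<nu> * mass \<phi>" if "0 < \<nu>" for \<nu> using that by blast
    show ?thesis
    proof (rule field_le_epsilon)
      fix e :: real assume "0 < e"
      then show "?\<kappa> \<le> deficit \<psi> t \<phi> + e" using *[of "e / mass \<phi>"] t by simp
    qed
  next
    case (real m)
    have sum: "mass \<phi> + ?b \<le> m" using vol real by (simp add: ennreal_le_iff del: ennreal_plus)
    then have m: "0 < m" using t by linarith
    define hi where "hi = m - ?b + t"
    \<comment> \<open>For \<open>s\<close> between \<open>t\<close> and \<open>hi\<close> one has
      \<open>t \<le> s\<close> and \<open>?b - t \<le> m - s\<close>. Thus \<open>r < r0\<close>
      implies \<open>r * m < s * (m - s)\<close>, which rearranges to the volume condition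
      \<open>s\<^sup>2 < (s - r) * m\<close>.\<close>
    define r0 where "r0 = t * (?b - t) / m"
    have "?\<kappa> \<le> deficit \<psi> t \<phi> + 0 * mass \<phi>"
    proof (rule chord_principle[OF _ _ _ _ _ _ mem t(2)])
      show "mass \<phi> \<le> hi" using sum t by (simp add: hi_def)
      show "0 \<le> t" "0 \<le> t + m" "0 < r0" using t m by (auto simp: r0_def)
      fix s d assume sd: "(s, d) \<in> X 0" and s: "t \<le> s" "s \<le> hi"
      obtain \<theta> where \<theta>: "unit_L1 \<theta>" "supported \<theta> H" "s = mass \<theta>" "d = deficit \<psi> t \<theta>"
        using XE[OF sd] by auto
      have "0 \<le> m * (s - t)" "0 \<le> t * (hi - s)" using m s t by simp_all
      moreover have "?\<kappa> - t * (s - t) \<le> d" using left[OF \<theta>(1)] s \<theta>(3,4) by simp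
      moreover have "?\<kappa> - m * (hi - s) \<le> d"
        using deficit_upper_end[OF \<theta>(1,2) \<psi> H real(2) _ _, of t] s \<theta>(3,4) m t by (simp add: hi_def)
      ultimately show "?\<kappa> - (t + m) * (s - t) \<le> d" "?\<kappa> - (t + m) * (hi - s) \<le> d"
        unfolding distrib_right by linarith+
    next
      fix s d r assume a: "(s, d) \<in> X 0" "t + r \<le> s" "s + r \<le> hi" "0 < r" "r < r0"
      have "t * (?b - t) \<le> s * (m - s)"
        using a t by (intro mult_mono) (auto simp: hi_def)
      moreover have "r * m < t * (?b - t)" using a(5) m by (simp add: r0_def pos_less_divide_eq)
      ultimately have "s\<^sup>2 < (s - r) * m" by (simp add: power2_eq_square algebra_simps)
      then have "ennreal (s\<^sup>2) < ennreal ((s - r) * m)" using le_less_trans[OF zero_le_power2] by (intro ennreal_lessI)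
      also have "\<dots> = ennreal (s - r) * emeasure M H" using real a t m by (simp add: ennreal_mult)
      finally show "\<exists>\<delta> d1 d2. r / 2 \<le> \<delta> \<and> \<delta> \<le> r \<and> (s - \<delta>, d1) \<in> X 0 \<and> (s + \<delta>, d2) \<in> X 0 \<and> d1 + d2 \<le> 2 * d"
        using a t by (intro move) auto
    qed
    then show ?thesis by simp
  qed
qed

lemma excess_one_coset:
  assumes H: "open_subgroup H"
    and min: "\<And>K. open_subgroup K \<Longrightarrow> K \<subseteq> H \<Longrightarrow> emeasure M H \<le> emeasure M K"
    and \<phi>: "unit_L1 \<phi>" "supported \<phi> H" and \<psi>: "unit_L1 \<psi>" "supported \<psi> H"
    and vol: "ennreal (mass \<phi> + mass \<psi>) \<le> emeasure M H" and t: "0 \<le> t"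
  shows "(LINT g|M. max 0 ((\<phi> \<star> \<psi>) g - t)) \<le> max 0 (mass \<phi> - t) * max 0 (mass \<psi> - t)"
proof (cases "mass \<phi> \<le> t \<or> mass \<psi> \<le> t")
  case True
  then have "max 0 ((\<phi> \<star> \<psi>) g - t) = 0" for g
    using conv_le_left[OF \<phi>(1) \<psi>(1), of g] conv_le_right[OF \<phi>(1) \<psi>(1), of g] by auto
  then show ?thesis by simp
next
  case False
  note eq = excess_eq[OF \<phi>(1) \<psi>(1) t]
  have "t * (mass \<phi> + mass \<psi> - t) \<le> (LINT g|M. min ((\<phi> \<star> \<psi>) g) t)"
  proof (cases "t = 0")
    case True
    then show ?thesis using conv_nonneg[OF \<phi>(1) \<psi>(1)] by (simp add: min_def)
  next
    case t0: False
    then have "t * (mass \<psi> - t) \<le> deficit \<psi> t \<phi>"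
      using t False by (intro deficit_lower_bound[OF H min \<phi> \<psi> vol]) auto
    then show ?thesis by (simp add: deficit_def algebra_simps)
  qed
  then show ?thesis unfolding eq using False by (simp add: max_def algebra_simps)
qed

end

section \<open>Decomposition into cosets\<close>

lemma exists_level:
  fixes b :: "'j \<Rightarrow> real"
  assumes "finite J" "\<And>j. j \<in> J \<Longrightarrow> 0 \<le> b j" "0 \<le> t" "t \<le> sum b J"
  shows "\<exists>\<eta>\<ge>0. (\<Sum>j\<in>J. min (b j) \<eta>) = t"
proof -
  let ?F = "\<lambda>\<eta>. \<Sum>j\<in>J. min (b j) \<eta>"
  have "\<exists>\<eta>. 0 \<le> \<eta> \<and> \<eta> \<le> sum b J \<and> ?F \<eta> = t"
  proof (rule IVT')
    show "?F 0 \<le> t" using assms by (simp add: min_absorb2)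
    have "?F (sum b J) = sum b J"
      using assms by (intro sum.cong refl min_absorb1 member_le_sum) auto
    then show "t \<le> ?F (sum b J)" using assms by simp
    show "0 \<le> sum b J" using assms by linarith
    show "continuous_on {0..sum b J} ?F" by (intro continuous_intros)
  qed
  then show ?thesis by blast
qed

text \<open>For fixed \<open>j\<close> at most one \<open>P i j\<close> is nonzero, so the column
  sum is a single number p \<le> b j. Its excess over the share \<open>min (b j) \<eta>\<close> is
  at most \<open>max 0 (p - \<eta>)\<close>: if the share is \<open>b j\<close>, there is no excess
  at all.\<close>

lemma excess_sum_le:
  fixes P :: "'i \<Rightarrow> 'j \<Rightarrow> real"
  assumes fin: "finite I" "finite J" and \<eta>: "0 \<le> \<eta>" and t: "(\<Sum>j\<in>J. min (b j) \<eta>) = t"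
    and P: "\<And>i j. i \<in> I \<Longrightarrow> j \<in> J \<Longrightarrow> 0 \<le> P i j \<and> P i j \<le> b j" and b: "\<And>j. j \<in> J \<Longrightarrow> 0 \<le> b j"
    and single: "\<And>i i' j. i \<in> I \<Longrightarrow> i' \<in> I \<Longrightarrow> j \<in> J \<Longrightarrow> P i j \<noteq> 0 \<Longrightarrow> P i' j \<noteq> 0 \<Longrightarrow> i = i'"
  shows "max 0 ((\<Sum>i\<in>I. \<Sum>j\<in>J. P i j) - t) \<le> (\<Sum>i\<in>I. \<Sum>j\<in>J. max 0 (P i j - \<eta>))"
proof -
  have col: "(\<Sum>i\<in>I. P i j) - min (b j) \<eta> \<le> (\<Sum>i\<in>I. max 0 (P i j - \<eta>))" if j: "j \<in> J" for j
  proof (cases "\<exists>i\<in>I. P i j \<noteq> 0")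
    case False
    then have "(\<Sum>i\<in>I. P i j) = 0" by (intro sum.neutral) auto
    moreover have "0 \<le> (\<Sum>i\<in>I. max 0 (P i j - \<eta>))" by (intro sum_nonneg) simp
    moreover have "0 \<le> min (b j) \<eta>" using b[OF j] \<eta> by simp
    ultimately show ?thesis by linarith
  next
    case True
    then obtain k where k: "k \<in> I" "P k j \<noteq> 0" by blast
    have "P i j = 0" if "i \<in> I - {k}" for i
      using single[OF _ k(1) j _ k(2), of i] that by blast
    then have "(\<Sum>i\<in>I. P i j) = (\<Sum>i\<in>{k}. P i j)"
      using fin(1) k(1) by (intro sum.mono_neutral_right) simp_all
    then have "(\<Sum>i\<in>I. P i j) = P k j" by simp
    moreover have "max 0 (P k j - \<eta>) \<le> (\<Sum>i\<in>I. max 0 (P i j - \<eta>))"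
      using fin k by (intro member_le_sum) auto
    moreover have "P k j - min (b j) \<eta> \<le> max 0 (P k j - \<eta>)" using P[OF k(1) j] by (simp add: min_def max_def)
    ultimately show ?thesis by linarith
  qed
  have "(\<Sum>i\<in>I. \<Sum>j\<in>J. P i j) - t = (\<Sum>j\<in>J. \<Sum>i\<in>I. P i j) - (\<Sum>j\<in>J. min (b j) \<eta>)"
    unfolding t by (subst sum.swap) (rule refl)
  also have "\<dots> = (\<Sum>j\<in>J. (\<Sum>i\<in>I. P i j) - min (b j) \<eta>)" by (rule sum_subtractf[symmetric])
  also have "\<dots> \<le> (\<Sum>j\<in>J. \<Sum>i\<in>I. max 0 (P i j - \<eta>))" by (intro sum_mono col)
  also have "\<dots> = (\<Sum>i\<in>I. \<Sum>j\<in>J. max 0 (P i j - \<eta>))" by (rule sum.swap)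
  finally show ?thesis by (simp add: sum_nonneg)
qed

text \<open>The threshold \<open>t\<close> is split as \<open>\<Sum>j. min (b j) \<eta>\<close>. A column \<open>j\<close> with \<open>b j \<le> \<eta>\<close> lies below its share,
  so only the excess over the common level \<open>\<eta>\<close> survives, and the resulting double sum factorises.\<close>
lemma integral_excess_sum_le:
  fixes P :: "'i \<Rightarrow> 'j \<Rightarrow> 'g \<Rightarrow> real"
  assumes fin: "finite I" "finite J" and \<eta>: "0 \<le> \<eta>" and t: "(\<Sum>j\<in>J. min (b j) \<eta>) = t" "t \<le> (\<Sum>i\<in>I. min (a i) \<eta>)"
    and P: "\<And>i j g. i \<in> I \<Longrightarrow> j \<in> J \<Longrightarrow> 0 \<le> P i j g \<and> P i j g \<le> b j" and b: "\<And>j. j \<in> J \<Longrightarrow> 0 \<le> b j"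
    and single: "\<And>i i' j g. i \<in> I \<Longrightarrow> i' \<in> I \<Longrightarrow> j \<in> J \<Longrightarrow> P i j g \<noteq> 0 \<Longrightarrow> P i' j g \<noteq> 0 \<Longrightarrow> i = i'"
    and int: "\<And>i j. i \<in> I \<Longrightarrow> j \<in> J \<Longrightarrow> integrable M (\<lambda>g. max 0 (P i j g - \<eta>))"
    and le: "\<And>i j. i \<in> I \<Longrightarrow> j \<in> J \<Longrightarrow> (LINT g|M. max 0 (P i j g - \<eta>)) \<le> max 0 (a i - \<eta>) * max 0 (b j - \<eta>)"
    and int0: "integrable M (\<lambda>g. max 0 ((\<Sum>i\<in>I. \<Sum>j\<in>J. P i j g) - t))"
  shows "(LINT g|M. max 0 ((\<Sum>i\<in>I. \<Sum>j\<in>J. P i j g) - t)) \<le> (sum a I - t) * (sum b J - t)"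
proof -
  have "(LINT g|M. max 0 ((\<Sum>i\<in>I. \<Sum>j\<in>J. P i j g) - t)) \<le> (LINT g|M. (\<Sum>i\<in>I. \<Sum>j\<in>J. max 0 (P i j g - \<eta>)))"
  proof (rule integral_mono[OF int0])
    show "integrable M (\<lambda>g. \<Sum>i\<in>I. \<Sum>j\<in>J. max 0 (P i j g - \<eta>))"
      using int by (intro Bochner_Integration.integrable_sum)
    show "max 0 ((\<Sum>i\<in>I. \<Sum>j\<in>J. P i j g) - t) \<le> (\<Sum>i\<in>I. \<Sum>j\<in>J. max 0 (P i j g - \<eta>))" for g
      using P single by (intro excess_sum_le[OF fin \<eta> t(1) _ b]) blast+
  qed
  also have "\<dots> = (\<Sum>i\<in>I. LINT g|M. (\<Sum>j\<in>J. max 0 (P i j g - \<eta>)))"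
    using int by (intro Bochner_Integration.integral_sum Bochner_Integration.integrable_sum)
  also have "\<dots> = (\<Sum>i\<in>I. \<Sum>j\<in>J. LINT g|M. max 0 (P i j g - \<eta>))"
    using int by (intro sum.cong refl Bochner_Integration.integral_sum)
  also have "\<dots> \<le> (\<Sum>i\<in>I. \<Sum>j\<in>J. max 0 (a i - \<eta>) * max 0 (b j - \<eta>))"
    by (intro sum_mono le)
  also have "\<dots> = (\<Sum>i\<in>I. max 0 (a i - \<eta>)) * (\<Sum>j\<in>J. max 0 (b j - \<eta>))"
    by (simp add: sum_product)
  also have "(\<Sum>j\<in>J. max 0 (b j - \<eta>)) = sum b J - t"
    unfolding t(1)[symmetric] sum_subtractf[symmetric] by (intro sum.cong) auto
  also have "(\<Sum>i\<in>I. max 0 (a i - \<eta>)) = sum a I - (\<Sum>i\<in>I. min (a i) \<eta>)"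
    unfolding sum_subtractf[symmetric] by (intro sum.cong) auto
  \<comment> \<open>Only the columns split \<open>t\<close> exactly; for the rows it suffices that
    the level \<open>\<eta>\<close> removes at least \<open>t\<close>.\<close>
  also have "(sum a I - (\<Sum>i\<in>I. min (a i) \<eta>)) * (sum b J - t) \<le> (sum a I - t) * (sum b J - t)"
  proof (rule mult_right_mono)
    have "t \<le> sum b J" unfolding t(1)[symmetric] by (intro sum_mono) simp
    then show "0 \<le> sum b J - t" by simp
  qed (use t(2) in simp)
  finally show ?thesis .
qed

context unimodular_haar
begin

text \<open>Left cosets serve for the first factor and right cosets for the second: functions
  supported in x + H and in H + y have a convolution living on x + H + y, a two-sided translate of
  H.\<close>

definition left_coset :: "'a set \<Rightarrow> 'a \<Rightarrow> 'a set" where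
  "left_coset H x = {y. - x + y \<in> H}"

definition right_coset :: "'a set \<Rightarrow> 'a \<Rightarrow> 'a set" where
  "right_coset H y = {z. z + - y \<in> H}"

lemma open_subgroupD:
  fixes H :: "'a set"
  assumes "open_subgroup H"
  shows "open H" "0 \<in> H" "x \<in> H \<Longrightarrow> y \<in> H \<Longrightarrow> x + y \<in> H" "x \<in> H \<Longrightarrow> - x \<in> H"
  using assms by (auto simp: open_subgroup_def)

lemma open_left_coset: "open_subgroup H \<Longrightarrow> open (left_coset H x)"
  unfolding left_coset_def
  using open_vimage[OF open_subgroupD(1), of H "\<lambda>y. - x + y"] by (simp add: vimage_def continuous_intros)

lemma open_right_coset: "open_subgroup H \<Longrightarrow> open (right_coset H x)"
  unfolding right_coset_def
  using open_vimage[OF open_subgroupD(1), of H "\<lambda>y. y + - x"] by (simp add: vimage_def continuous_intros)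

lemma left_coset_eq:
  assumes H: "open_subgroup H" and z: "z \<in> left_coset H x" "z \<in> left_coset H y"
  shows "left_coset H x = left_coset H y"
proof -
  have "left_coset H x \<subseteq> left_coset H y" if "z \<in> left_coset H x" "z \<in> left_coset H y" for x y
  proof
    fix w assume "w \<in> left_coset H x"
    then have "- y + z \<in> H" "- x + z \<in> H" "- x + w \<in> H"
      using that unfolding left_coset_def by blast+
    then have "(- y + z) + (- (- x + z) + (- x + w)) \<in> H"
      by (intro open_subgroupD(3)[OF H _ open_subgroupD(3)[OF H open_subgroupD(4)[OF H]]])
    then show "w \<in> left_coset H y" by (simp add: left_coset_def minus_add add.assoc)
  qed
  from this[OF z] this[OF z(2,1)] show ?thesis by (rule equalityI)
qed

lemma right_coset_eq:
  assumes H: "open_subgroup H" and z: "z \<in> right_coset H x" "z \<in> right_coset H y"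
  shows "right_coset H x = right_coset H y"
proof -
  have "right_coset H x \<subseteq> right_coset H y" if "z \<in> right_coset H x" "z \<in> right_coset H y" for x y
  proof
    fix w assume "w \<in> right_coset H x"
    then have "w + - x \<in> H" "z + - x \<in> H" "z + - y \<in> H"
      using that unfolding right_coset_def by blast+
    then have "((w + - x) + - (z + - x)) + (z + - y) \<in> H"
      by (intro open_subgroupD(3)[OF H open_subgroupD(3)[OF H _ open_subgroupD(4)[OF H]]])
    moreover have "((w + - x) + - (z + - x)) + (z + - y) = w + - y"
      by (simp add: minus_add add.assoc del: add_uminus_conv_diff)
    ultimately show "w \<in> right_coset H y" by (simp add: right_coset_def)
  qed
  from this[OF z] this[OF z(2,1)] show ?thesis by (rule equalityI)
qed

abbreviation restr :: "('a \<Rightarrow> real) \<Rightarrow> 'a set \<Rightarrow> 'a \<Rightarrow> real" where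
  "restr \<phi> A \<equiv> (\<lambda>x. \<phi> x * indicator A x)"

lemma unit_L1_restr:
  assumes "unit_L1 \<phi>" "A \<in> sets borel"
  shows "unit_L1 (restr \<phi> A)"
proof (rule unit_L1_bounded[OF assms(1)])
  note [measurable] = unit_L1D(2)[OF assms(1)] assms(2)
  show "restr \<phi> A \<in> borel_measurable borel" by measurable
qed (auto simp: indicator_def unit_L1D[OF assms(1)])

lemma restr_sum:
  assumes "finite I" "supported \<phi> (\<Union>I)" "\<And>A B. A \<in> I \<Longrightarrow> B \<in> I \<Longrightarrow> A \<inter> B \<noteq> {} \<Longrightarrow> A = B"
  shows "\<phi> x = (\<Sum>A\<in>I. restr \<phi> A x)"
proof (cases "\<exists>A\<in>I. x \<in> A")
  case True
  then obtain A where A: "A \<in> I" "x \<in> A" by blast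
  have "(\<Sum>B\<in>I. restr \<phi> B x) = (\<Sum>B\<in>{A}. restr \<phi> B x)"
    using assms(1,3) A by (intro sum.mono_neutral_right) (auto simp: indicator_def)
  then show ?thesis using A by simp
next
  case False
  then show ?thesis using assms(2) by (auto simp: supported_def)
qed

lemma conv_nonzeroE:
  assumes "(\<phi> \<star> \<psi>) g \<noteq> 0"
  obtains x where "\<phi> x \<noteq> 0" "\<psi> (- x + g) \<noteq> 0"
proof -
  have "\<exists>x. \<phi> x * \<psi> (- x + g) \<noteq> 0"
  proof (rule ccontr)
    assume "\<not> ?thesis"
    then have "\<phi> x * \<psi> (- x + g) = 0" for x by blast
    then have "(\<phi> \<star> \<psi>) g = 0" unfolding group_convolution_def by (simp only: integral_zero)
    then show False using assms by simp
  qed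
  then show thesis using that by auto
qed

text \<open>Translating \<open>\<phi>\<close> on the left and \<open>\<psi>\<close> on the right
  moves both supports into \<open>H\<close>. The convolution is then evaluated at
  \<open>x + g + y\<close>, and left and right invariance together preserve its integral.\<close>

lemma excess_coset_pair:
  assumes H: "open_subgroup H"
    and min: "\<And>K. open_subgroup K \<Longrightarrow> K \<subseteq> H \<Longrightarrow> emeasure M H \<le> emeasure M K"
    and \<phi>: "unit_L1 \<phi>" "supported \<phi> (left_coset H x)" and \<psi>: "unit_L1 \<psi>" "supported \<psi> (right_coset H y)"
    and vol: "ennreal (mass \<phi> + mass \<psi>) \<le> emeasure M H" and t: "0 \<le> t"
  shows "(LINT g|M. max 0 ((\<phi> \<star> \<psi>) g - t)) \<le> max 0 (mass \<phi> - t) * max 0 (mass \<psi> - t)"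
proof -
  let ?\<phi> = "\<lambda>z. \<phi> (x + z)" and ?\<psi> = "\<lambda>z. \<psi> (z + y)"
  let ?F = "\<lambda>g. max 0 ((\<phi> \<star> \<psi>) g - t)"
  have m: "mass ?\<phi> = mass \<phi>" "mass ?\<psi> = mass \<psi>"
    by (rule integral_left[OF unit_L1D(2)[OF \<phi>(1)]], rule integral_right[OF unit_L1D(2)[OF \<psi>(1)]])
  have s: "supported ?\<phi> H" "supported ?\<psi> H"
    using \<phi>(2) \<psi>(2) by (auto simp: supported_def left_coset_def right_coset_def add.assoc)
  have i: "integrable M ?F" by (rule integrable_excess[OF \<phi>(1) \<psi>(1) t])
  have b: "?F \<in> borel_measurable borel" "(\<lambda>z. ?F (z + y)) \<in> borel_measurable borel"
    using borel_measurable_integrable[OF i] borel_measurable_integrable[OF integrable_right[OF i, of y]] by simp_all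
  have "(LINT g|M. max 0 ((?\<phi> \<star> ?\<psi>) g - t)) \<le> max 0 (mass ?\<phi> - t) * max 0 (mass ?\<psi> - t)"
    using vol m by (intro excess_one_coset[OF H min unit_L1_left[OF \<phi>(1)] s(1) unit_L1_right[OF \<psi>(1)] s(2) _ t]) simp_all
  also have "(LINT g|M. max 0 ((?\<phi> \<star> ?\<psi>) g - t)) = (LINT g|M. ?F (x + g + y))"
    by (simp add: conv_translate[OF \<phi>(1) \<psi>(1)])
  also have "\<dots> = (LINT g|M. ?F (g + y))" by (rule integral_left[OF b(2)])
  also have "\<dots> = (LINT g|M. ?F g)" by (rule integral_right[OF b(1)])
  finally show ?thesis unfolding m .
qed

text \<open>Bilinearity splits the convolution into one piece per pair of cosets, and the volume
  condition is inherited because each part has at most the total mass. For given g, either coset of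
  a pair with nonzero piece determines the other, as the double sum estimate demands.\<close>

lemma excess_finite_cosets:
  assumes H: "open_subgroup H"
    and min: "\<And>K. open_subgroup K \<Longrightarrow> K \<subseteq> H \<Longrightarrow> emeasure M H \<le> emeasure M K"
    and \<phi>: "unit_L1 \<phi>" "supported \<phi> (\<Union>I)" and \<psi>: "unit_L1 \<psi>" "supported \<psi> (\<Union>J)"
    and I: "finite I" "I \<subseteq> range (left_coset H)" and J: "finite J" "J \<subseteq> range (right_coset H)"
    and vol: "ennreal (mass \<phi> + mass \<psi>) \<le> emeasure M H" and t: "0 \<le> t"
  shows "(LINT g|M. max 0 ((\<phi> \<star> \<psi>) g - t)) \<le> max 0 (mass \<phi> - t) * max 0 (mass \<psi> - t)"
proof (cases "mass \<phi> \<le> t \<or> mass \<psi> \<le> t")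
  case True
  then have "max 0 ((\<phi> \<star> \<psi>) g - t) = 0" for g
    using conv_le_left[OF \<phi>(1) \<psi>(1), of g] conv_le_right[OF \<phi>(1) \<psi>(1), of g] by auto
  then show ?thesis by simp
next
  case False
  note c = open_subgroupD[OF H]
  have oI: "A \<in> sets borel" if "A \<in> I" for A using I(2) that open_left_coset[OF H] by auto
  have oJ: "B \<in> sets borel" if "B \<in> J" for B using J(2) that open_right_coset[OF H] by auto
  have dI: "A = A'" if "A \<in> I" "A' \<in> I" "A \<inter> A' \<noteq> {}" for A A'
    using I(2) that left_coset_eq[OF H] by blast
  have dJ: "B = B'" if "B \<in> J" "B' \<in> J" "B \<inter> B' \<noteq> {}" for B B'
    using J(2) that right_coset_eq[OF H] by blast
  note ru = unit_L1_restr[OF \<phi>(1) oI] and rv = unit_L1_restr[OF \<psi>(1) oJ]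
  define a where "a A = mass (restr \<phi> A)" for A
  define b where "b B = mass (restr \<psi> B)" for B
  define P where "P A B g = (restr \<phi> A \<star> restr \<psi> B) g" for A B g
  have eq\<phi>: "\<phi> x = (\<Sum>A\<in>I. restr \<phi> A x)" for x
    by (rule restr_sum[OF I(1) \<phi>(2)]) (rule dI)
  have eq\<psi>: "\<psi> x = (\<Sum>B\<in>J. restr \<psi> B x)" for x
    by (rule restr_sum[OF J(1) \<psi>(2)]) (rule dJ)
  have sa: "sum a I = mass \<phi>"
  proof -
    have "mass \<phi> = (LINT x|M. (\<Sum>A\<in>I. restr \<phi> A x))" by (simp only: eq\<phi>[symmetric])
    also have "\<dots> = sum a I" unfolding a_def
      by (intro Bochner_Integration.integral_sum unit_L1D(1) ru)
    finally show ?thesis by simp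
  qed
  have sb: "sum b J = mass \<psi>"
  proof -
    have "mass \<psi> = (LINT x|M. (\<Sum>B\<in>J. restr \<psi> B x))" by (simp only: eq\<psi>[symmetric])
    also have "\<dots> = sum b J" unfolding b_def
      by (intro Bochner_Integration.integral_sum unit_L1D(1) rv)
    finally show ?thesis by simp
  qed
  have a0: "0 \<le> a A" if "A \<in> I" for A unfolding a_def by (rule mass_nonneg[OF ru[OF that]])
  have b0: "0 \<le> b B" if "B \<in> J" for B unfolding b_def by (rule mass_nonneg[OF rv[OF that]])
  have sP: "(\<phi> \<star> \<psi>) g = (\<Sum>A\<in>I. \<Sum>B\<in>J. P A B g)" for g
  proof -
    have "\<phi> x * \<psi> (- x + g) = (\<Sum>A\<in>I. \<Sum>B\<in>J. restr \<phi> A x * restr \<psi> B (- x + g))" for x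
      unfolding sum_product[symmetric] by (simp only: eq\<phi>[symmetric] eq\<psi>[symmetric])
    then have "(\<phi> \<star> \<psi>) g = (LINT x|M. (\<Sum>A\<in>I. \<Sum>B\<in>J. restr \<phi> A x * restr \<psi> B (- x + g)))"
      unfolding group_convolution_def by simp
    also have "\<dots> = (\<Sum>A\<in>I. LINT x|M. (\<Sum>B\<in>J. restr \<phi> A x * restr \<psi> B (- x + g)))"
      by (intro Bochner_Integration.integral_sum Bochner_Integration.integrable_sum unit_L1D(1)[OF conv_integrand] ru rv)
    also have "\<dots> = (\<Sum>A\<in>I. \<Sum>B\<in>J. P A B g)"
      unfolding P_def group_convolution_def
      by (intro sum.cong refl Bochner_Integration.integral_sum unit_L1D(1)[OF conv_integrand] ru rv)
    finally show ?thesis .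
  qed
  have P0: "0 \<le> P A B g" "P A B g \<le> a A" "P A B g \<le> b B" if "A \<in> I" "B \<in> J" for A B g
    unfolding P_def a_def b_def using ru[OF that(1)] rv[OF that(2)]
    by (auto intro: conv_nonneg conv_le_left conv_le_right)
  have intP: "integrable M (\<lambda>g. max 0 (P A B g - \<eta>))" if "A \<in> I" "B \<in> J" "0 \<le> \<eta>" for A B \<eta>
    unfolding P_def by (rule integrable_excess[OF ru rv]) (rule that)+
  have leP: "(LINT g|M. max 0 (P A B g - \<eta>)) \<le> max 0 (a A - \<eta>) * max 0 (b B - \<eta>)"
    if AB: "A \<in> I" "B \<in> J" and \<eta>: "0 \<le> \<eta>" for A B \<eta>
  proof -
    obtain x where x: "A = left_coset H x" using AB(1) I(2) by blast
    obtain y where y: "B = right_coset H y" using AB(2) J(2) by blast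
    have "a A \<le> sum a I" "b B \<le> sum b J" using AB I(1) J(1) a0 b0 by (auto intro: member_le_sum)
    then have "ennreal (mass (restr \<phi> A) + mass (restr \<psi> B)) \<le> emeasure M H"
      unfolding sa sb a_def b_def by (intro order_trans[OF _ vol] ennreal_leI add_mono)
    moreover have "supported (restr \<phi> A) (left_coset H x)" "supported (restr \<psi> B) (right_coset H y)"
      using x y by (auto simp: supported_def)
    ultimately show ?thesis
      unfolding P_def a_def b_def using \<eta> ru[OF AB(1)] rv[OF AB(2)]
      by (intro excess_coset_pair[OF H min])
  qed
  have int0: "integrable M (\<lambda>g. max 0 ((\<Sum>A\<in>I. \<Sum>B\<in>J. P A B g) - t))"
    using integrable_excess[OF \<phi>(1) \<psi>(1) t] unfolding sP .
  have singleA: "A = A'" if AB: "A \<in> I" "A' \<in> I" "B \<in> J" and nz: "P A B g \<noteq> 0" "P A' B g \<noteq> 0" for A A' B g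
  proof -
    obtain x where x: "x \<in> A" "- x + g \<in> B"
      using nz(1) unfolding P_def by (elim conv_nonzeroE) (auto simp: indicator_def split: if_splits)
    obtain x' where x': "x' \<in> A'" "- x' + g \<in> B"
      using nz(2) unfolding P_def by (elim conv_nonzeroE) (auto simp: indicator_def split: if_splits)
    obtain x0 where A': "A = left_coset H x0" using AB(1) I(2) by blast
    obtain y0 where B': "B = right_coset H y0" using AB(3) J(2) by blast
    note AB' = A' B'
    have "- x0 + x \<in> H" "- x + g + - y0 \<in> H" "- x' + g + - y0 \<in> H"
      using x x' unfolding AB' left_coset_def right_coset_def by blast+
    \<comment> \<open>The points - x + g and - x' + g lie in the same right coset, so their quotient
      - x + x' belongs to \<open>H\<close>, and x' lies in the left coset of x.\<close>
    then have "(- x0 + x) + ((- x + g + - y0) + - (- x' + g + - y0)) \<in> H"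
      by (intro c(3)[OF _ c(3)[OF _ c(4)]])
    moreover have "(- x0 + x) + ((- x + g + - y0) + - (- x' + g + - y0)) = - x0 + x'"
      by (simp add: minus_add add.assoc del: add_uminus_conv_diff)
    ultimately have "x' \<in> A" unfolding AB' left_coset_def by simp
    then show ?thesis using dI[OF AB(1,2)] x' by blast
  qed
  have singleB: "B = B'" if AB: "B \<in> J" "B' \<in> J" "A \<in> I" and nz: "P A B g \<noteq> 0" "P A B' g \<noteq> 0" for A B B' g
  proof -
    obtain x where x: "x \<in> A" "- x + g \<in> B"
      using nz(1) unfolding P_def by (elim conv_nonzeroE) (auto simp: indicator_def split: if_splits)
    obtain x' where x': "x' \<in> A" "- x' + g \<in> B'"
      using nz(2) unfolding P_def by (elim conv_nonzeroE) (auto simp: indicator_def split: if_splits)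
    obtain x0 where A': "A = left_coset H x0" using AB(3) I(2) by blast
    obtain y0 where B': "B = right_coset H y0" using AB(1) J(2) by blast
    note AB' = A' B'
    have "- x0 + x' \<in> H" "- x0 + x \<in> H" "- x + g + - y0 \<in> H"
      using x x' unfolding AB' left_coset_def right_coset_def by blast+
    then have "(- (- x0 + x') + (- x0 + x)) + (- x + g + - y0) \<in> H"
      by (rule c(3)[OF c(3)[OF c(4)]])
    moreover have "(- (- x0 + x') + (- x0 + x)) + (- x + g + - y0) = - x' + g + - y0"
      by (simp add: minus_add add.assoc del: add_uminus_conv_diff)
    ultimately have "- x' + g \<in> B" unfolding AB' right_coset_def by simp
    then show ?thesis using dJ[OF AB(1,2)] x' by blast
  qed
  \<comment> \<open>Two candidates for the common level. The family with the larger level takes the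
    role of the columns, because this level then removes at least \<open>t\<close> from the other
    family as well.\<close>
  obtain \<eta> where \<eta>: "0 \<le> \<eta>" "(\<Sum>B\<in>J. min (b B) \<eta>) = t"
    using exists_level[of J b t] J(1) b0 t False sb by auto
  obtain \<zeta> where \<zeta>: "0 \<le> \<zeta>" "(\<Sum>A\<in>I. min (a A) \<zeta>) = t"
    using exists_level[of I a t] I(1) a0 t False sa by auto
  have "(LINT g|M. max 0 ((\<Sum>A\<in>I. \<Sum>B\<in>J. P A B g) - t)) \<le> (sum a I - t) * (sum b J - t)"
  proof (cases "\<zeta> \<le> \<eta>")
    case True
    have "t \<le> (\<Sum>A\<in>I. min (a A) \<eta>)" unfolding \<zeta>(2)[symmetric] using True by (intro sum_mono) auto
    then show ?thesis
      using P0 singleA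
      by (intro integral_excess_sum_le[OF I(1) J(1) \<eta> _ _ b0 _ intP leP int0]) (use \<eta>(1) in blast)+
  next
    case False
    have "t \<le> (\<Sum>B\<in>J. min (b B) \<zeta>)" unfolding \<eta>(2)[symmetric] using False by (intro sum_mono) auto
    moreover have "integrable M (\<lambda>g. max 0 ((\<Sum>B\<in>J. \<Sum>A\<in>I. P A B g) - t))"
      by (subst sum.swap) (rule int0)
    ultimately have "(LINT g|M. max 0 ((\<Sum>B\<in>J. \<Sum>A\<in>I. P A B g) - t)) \<le> (sum b J - t) * (sum a I - t)"
      using P0 singleB leP[OF _ _ \<zeta>(1)] intP[OF _ _ \<zeta>(1)]
      by (intro integral_excess_sum_le[where P = "\<lambda>B A. P A B", OF J(1) I(1) \<zeta> _ _ a0])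
        (auto simp: mult.commute)
    then show ?thesis by (subst sum.swap) (simp add: mult.commute)
  qed
  then show ?thesis using False unfolding sP[symmetric] sa sb by simp
qed


text \<open>If \<open>H\<close> is not contained in an open subgroup \<open>K\<close>, then
  \<open>H \<inter> K\<close> and a translate of it are disjoint subsets of \<open>H\<close>, so
  \<open>H\<close> has at least twice the infimal volume. For a positive finite infimum, any
  subgroup of volume below that lies in every open subgroup and attains the infimum; for an infinite
  one the whole group does.\<close>

lemma minimal_open_subgroup:
  assumes "0 < min_open_subgroup_vol M"
  obtains H where "open_subgroup H" "\<And>K. open_subgroup K \<Longrightarrow> emeasure M H \<le> emeasure M K"
    "emeasure M H = min_open_subgroup_vol M"
proof -
  note obtained = that
  let ?m = "min_open_subgroup_vol M"
  have lower: "?m \<le> emeasure M K" if "open_subgroup K" for K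
    unfolding min_open_subgroup_vol_def using that by (intro INF_lower) simp
  have attained: thesis if H: "open_subgroup H" "emeasure M H \<le> ?m" for H
  proof (rule obtained[OF H(1)])
    show "emeasure M H \<le> emeasure M K" if "open_subgroup K" for K
      by (rule order_trans[OF H(2) lower[OF that]])
    show "emeasure M H = ?m" by (rule antisym[OF H(2) lower[OF H(1)]])
  qed
  show thesis
  proof (cases "?m = \<infinity>")
    case True
    have "open_subgroup (UNIV :: 'a set)" by (simp add: open_subgroup_def)
    then show thesis using True by (intro attained[of UNIV]) auto
  next
    case False
    then have "?m < ?m + ?m" using assms ennreal_add_left_cancel_less[of ?m 0 ?m] by simp
    then obtain H where H: "open_subgroup H" "emeasure M H < ?m + ?m"
      unfolding min_open_subgroup_vol_def INF_less_iff by auto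
    note c = open_subgroupD[OF H(1)]
    have "emeasure M H \<le> emeasure M K" if K: "open_subgroup K" for K
    proof -
      note d = open_subgroupD[OF K]
      have HK: "open_subgroup (H \<inter> K)" using c d by (auto simp: open_subgroup_def)
      have "H \<subseteq> K"
      proof (rule ccontr)
        assume "\<not> H \<subseteq> K"
        then obtain h where h: "h \<in> H" "h \<notin> K" by auto
        let ?T = "{x. - h + x \<in> H \<inter> K}"
        have T: "emeasure M ?T = emeasure M (H \<inter> K)" using c(1) d(1) by (intro emeasure_left) auto
        have "open ((\<lambda>x. - h + x) -` (H \<inter> K))" using c(1) d(1) by (intro open_vimage continuous_intros) auto
        then have sT: "?T \<in> sets M" by (simp add: vimage_def)
        have "(H \<inter> K) \<inter> ?T = {}"
        proof (rule ccontr)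
          assume "(H \<inter> K) \<inter> ?T \<noteq> {}"
          then obtain x where x: "x \<in> K" "- h + x \<in> K" by auto
          have "x + - (- h + x) \<in> K" using d(3)[OF x(1) d(4)[OF x(2)]] .
          then show False using h by (simp add: minus_add add.assoc[symmetric])
        qed
        then have "emeasure M (H \<inter> K) + emeasure M ?T = emeasure M ((H \<inter> K) \<union> ?T)"
          using c(1) d(1) sT by (intro plus_emeasure) auto
        also have "\<dots> \<le> emeasure M H"
        proof (rule emeasure_mono)
          show "(H \<inter> K) \<union> ?T \<subseteq> H"
          proof
            fix x assume "x \<in> (H \<inter> K) \<union> ?T"
            then consider "x \<in> H" | "- h + x \<in> H" by auto
            then show "x \<in> H" using subgroup_translate_iff(1)[OF H(1) h(1)] by cases auto
          qed
        qed (use c in auto)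
        finally have "?m + ?m \<le> emeasure M H"
          unfolding T using lower[OF HK] by (meson add_mono order_trans)
        then show False using H(2) by simp
      qed
      then show ?thesis using d(1) by (intro emeasure_mono) auto
    qed
    then have "emeasure M H \<le> ?m" unfolding min_open_subgroup_vol_def by (intro INF_greatest) auto
    then show thesis by (rule attained[OF H(1)])
  qed
qed

text \<open>Truncated at a small level \<open>d\<close>, the function has small integral, by
  dominated convergence. The set where it is at least \<open>d\<close> has finite measure by
  Markov's inequality; up to small measure it lies in a compact set, which finitely many members of
  the cover contain.\<close>

lemma truncate_to_cover:
  assumes \<phi>: "unit_L1 \<phi>" and e: "0 < e" and C: "\<And>U. U \<in> \<C> \<Longrightarrow> open U" "\<Union>\<C> = UNIV"
  shows "\<exists>F. finite F \<and> F \<subseteq> \<C> \<and> mass \<phi> - e \<le> mass (restr \<phi> (\<Union>F))"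
proof -
  note [measurable] = unit_L1D(2)[OF \<phi>]
  have "(\<lambda>n. LINT x|M. min (\<phi> x) (1 / real (Suc n))) \<longlonglongrightarrow> (LINT x|M. 0)"
  proof (rule integral_dominated_convergence[where w = \<phi>])
    show "AE x in M. (\<lambda>n. min (\<phi> x) (1 / real (Suc n))) \<longlonglongrightarrow> 0"
    proof (rule AE_I2)
      fix x
      have "(\<lambda>n. min (\<phi> x) (1 / real (Suc n))) \<longlonglongrightarrow> min (\<phi> x) 0"
        using LIMSEQ_inverse_real_of_nat by (intro tendsto_intros) (simp add: inverse_eq_divide)
      then show "(\<lambda>n. min (\<phi> x) (1 / real (Suc n))) \<longlonglongrightarrow> 0" using unit_L1D(3)[OF \<phi>, of x] by (simp only: min_absorb2)
    qed
  qed (use unit_L1D[OF \<phi>] in \<open>auto simp: min_def\<close>)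
  then have "eventually (\<lambda>n. (LINT x|M. min (\<phi> x) (1 / real (Suc n))) < e / 2) sequentially"
    using e by (intro order_tendstoD(2)) auto
  then obtain n where n: "(LINT x|M. min (\<phi> x) (1 / real (Suc n))) < e / 2" by (auto simp: eventually_sequentially)
  define d where "d = 1 / real (Suc n)"
  have d: "0 < d" by (simp add: d_def)
  define A where "A = {x. d \<le> \<phi> x}"
  have "{x \<in> space borel. d \<le> \<phi> x} \<in> sets borel" by measurable
  then have A: "A \<in> sets borel" by (simp add: A_def)
  have "ennreal d * emeasure M A = (\<integral>\<^sup>+x. ennreal d * indicator A x \<partial>M)"
    using A by (simp add: nn_integral_cmult_indicator)
  also have "\<dots> \<le> (\<integral>\<^sup>+x. ennreal (\<phi> x) \<partial>M)"
    using unit_L1D(3)[OF \<phi>] by (intro nn_integral_mono) (auto simp: A_def indicator_def intro: ennreal_leI)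
  also have "\<dots> = ennreal (mass \<phi>)" by (rule nn_integral_eq_integral) (auto simp: unit_L1D[OF \<phi>])
  finally have "ennreal d * emeasure M A < \<infinity>" by (rule le_less_trans) simp
  then have fA: "emeasure M A < \<infinity>" using d by (auto simp: ennreal_mult_less_top)
  obtain U where U: "open U" "A \<subseteq> U" "emeasure M U < \<infinity>"
    by (rule radon_outer_diff[OF radon A fA zero_less_one])
  have e2: "0 < e / 2" using e by simp
  obtain K where K: "compact K" "K \<subseteq> U" "emeasure M (U - K) < ennreal (e / 2)"
    by (rule radon_inner_diff[OF radon U(1,3) e2])
  have "K \<subseteq> \<Union>\<C>" using C(2) by simp
  then obtain F where F: "F \<subseteq> \<C>" "finite F" "K \<subseteq> \<Union>F" using compactE[OF K(1) _ C(1)] by metis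
  have oF: "open (\<Union>F)" using F C(1) by auto
  have sets: "\<Union>F \<in> sets borel" "U - K \<in> sets M" using oF U K by (auto simp: borel_compact)
  have i: "integrable M (indicator (U - K) :: 'a \<Rightarrow> real)"
    using sets K(3) order_less_trans[OF K(3) ennreal_less_top] by (intro integrable_real_indicator) auto
  have im: "integrable M (\<lambda>x. min (\<phi> x) d)"
    using d unit_L1D[OF \<phi>] by (intro Bochner_Integration.integrable_bound[OF unit_L1D(1)[OF \<phi>]]) (auto simp: min_def)
  have ir: "integrable M (restr \<phi> (\<Union>F))" by (rule unit_L1D(1)[OF unit_L1_restr[OF \<phi> sets(1)]])
  have "mass \<phi> - mass (restr \<phi> (\<Union>F)) = (LINT x|M. \<phi> x - restr \<phi> (\<Union>F) x)"
    using ir unit_L1D(1)[OF \<phi>] by simp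
  also have "\<dots> \<le> (LINT x|M. min (\<phi> x) d + indicator (U - K) x)"
  proof (rule integral_mono)
    show "\<phi> x - restr \<phi> (\<Union>F) x \<le> min (\<phi> x) d + indicator (U - K) x" for x
    proof (cases "x \<in> \<Union>F")
      case True
      then show ?thesis using unit_L1D(3)[OF \<phi>, of x] d by (simp add: indicator_def)
    next
      case xF: False
      then have "x \<notin> K" using F by auto
      show ?thesis
      proof (cases "d \<le> \<phi> x")
        case True
        then have "x \<in> U - K" using U(2) \<open>x \<notin> K\<close> by (auto simp: A_def)
        then show ?thesis using xF unit_L1D(4)[OF \<phi>, of x] d True by (simp add: indicator_def)
      next
        case False
        then show ?thesis using xF by (simp add: indicator_def)
      qed
    qed
  qed (use ir unit_L1D(1)[OF \<phi>] i im in simp_all)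
  also have "\<dots> = (LINT x|M. min (\<phi> x) d) + measure M (U - K)"
    using i im sets(2) by simp
  also have "measure M (U - K) \<le> e / 2"
    unfolding measure_def using K(3) e by (intro enn2real_leI) auto
  finally have "mass \<phi> - mass (restr \<phi> (\<Union>F)) \<le> e" using n by (simp add: d_def)
  then show ?thesis using F(1,2) by (intro exI[of _ F]) auto
qed

text \<open>Passing to smaller factors \<open>u\<close> and \<open>v\<close> changes the excess by
  at most the loss in the integral of the convolution, a difference of two products of masses, and
  this is small once finitely many cosets carry almost all mass.\<close>

lemma excess_le:
  assumes \<phi>: "unit_L1 \<phi>" and \<psi>: "unit_L1 \<psi>"
    and vol: "ennreal (mass \<phi> + mass \<psi>) \<le> min_open_subgroup_vol M"
    and t: "0 \<le> t" "t \<le> mass \<phi>" "t \<le> mass \<psi>"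
  shows "(LINT g|M. max 0 ((\<phi> \<star> \<psi>) g - t)) \<le> (mass \<phi> - t) * (mass \<psi> - t)"
proof (cases "min_open_subgroup_vol M = 0")
  case True
  then have "mass \<phi> + mass \<psi> \<le> 0" using vol by (simp add: ennreal_eq_0_iff del: ennreal_plus)
  then have z: "mass \<phi> = 0" "mass \<psi> = 0" "t = 0" using mass_nonneg[OF \<phi>] mass_nonneg[OF \<psi>] t by auto
  have "max 0 ((\<phi> \<star> \<psi>) g - t) = 0" for g
    using conv_le_left[OF \<phi> \<psi>, of g] z by simp
  then show ?thesis using z by simp
next
  case False
  then obtain H where H: "open_subgroup H" "\<And>K. open_subgroup K \<Longrightarrow> emeasure M H \<le> emeasure M K"
      "emeasure M H = min_open_subgroup_vol M"
    using minimal_open_subgroup by (metis zero_less_iff_neq_zero)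
  let ?a = "mass \<phi>" and ?b = "mass \<psi>"
  note pos = mass_nonneg[OF \<phi>] mass_nonneg[OF \<psi>]
  show ?thesis
  proof (rule field_le_epsilon)
    fix e' :: real assume e': "0 < e'"
    \<comment> \<open>Lowering each mass by at most \<open>e\<close> lowers the product of the
      masses by at most \<open>e * (?a + ?b)\<close>, which is at most \<open>e'\<close>.\<close>
    define e where "e = e' / (?a + ?b + 1)"
    have e: "0 < e" using e' pos by (simp add: e_def add_nonneg_pos)
    have cov: "\<Union>(range (left_coset H)) = UNIV" "\<Union>(range (right_coset H)) = UNIV"
      using open_subgroupD(2)[OF H(1)] by (auto simp: left_coset_def right_coset_def)
    obtain I where I: "finite I" "I \<subseteq> range (left_coset H)" "?a - e \<le> mass (restr \<phi> (\<Union>I))"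
      using truncate_to_cover[OF \<phi> e _ cov(1)] open_left_coset[OF H(1)] by blast
    obtain J where J: "finite J" "J \<subseteq> range (right_coset H)" "?b - e \<le> mass (restr \<psi> (\<Union>J))"
      using truncate_to_cover[OF \<psi> e _ cov(2)] open_right_coset[OF H(1)] by blast
    define u where "u = restr \<phi> (\<Union>I)"
    define v where "v = restr \<psi> (\<Union>J)"
    have "open (\<Union>I)" "open (\<Union>J)" using I(2) J(2) open_left_coset[OF H(1)] open_right_coset[OF H(1)]
      by - (rule open_Union, blast)+
    then have u: "unit_L1 u" "supported u (\<Union>I)" and v: "unit_L1 v" "supported v (\<Union>J)"
      unfolding u_def v_def using unit_L1_restr[OF \<phi>] unit_L1_restr[OF \<psi>] by (auto simp: supported_def)
    have uv: "u x \<le> \<phi> x" "v x \<le> \<psi> x" for x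
      using unit_L1D(3)[OF \<phi>, of x] unit_L1D(3)[OF \<psi>, of x] by (auto simp: u_def v_def indicator_def)
    have m: "?a - e \<le> mass u" "?b - e \<le> mass v" using I(3) J(3) by (simp_all add: u_def v_def)
    have m': "mass u \<le> ?a" "mass v \<le> ?b"
      using uv by (auto intro!: integral_mono unit_L1D(1) u v \<phi> \<psi>)
    have "ennreal (mass u + mass v) \<le> emeasure M H"
      unfolding H(3) using m' by (intro order_trans[OF ennreal_leI vol]) simp
    then have fin: "(LINT g|M. max 0 ((u \<star> v) g - t)) \<le> max 0 (mass u - t) * max 0 (mass v - t)"
      using H(2) by (intro excess_finite_cosets[OF H(1) _ u v I(1,2) J(1,2) _ t(1)]) auto
    have "(LINT g|M. max 0 ((\<phi> \<star> \<psi>) g - t)) \<le> (LINT g|M. max 0 ((u \<star> v) g - t) + ((\<phi> \<star> \<psi>) g - (u \<star> v) g))"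
    proof (rule integral_mono)
      show "max 0 ((\<phi> \<star> \<psi>) g - t) \<le> max 0 ((u \<star> v) g - t) + ((\<phi> \<star> \<psi>) g - (u \<star> v) g)" for g
        using conv_mono[OF u(1) v(1) \<phi> \<psi> uv, of g] by simp
    qed (use integrable_excess[OF \<phi> \<psi> t(1)] integrable_excess[OF u(1) v(1) t(1)] conv_mass(1)[OF \<phi> \<psi>]
        conv_mass(1)[OF u(1) v(1)] in simp_all)
    also have "\<dots> = (LINT g|M. max 0 ((u \<star> v) g - t)) + (?a * ?b - mass u * mass v)"
      using integrable_excess[OF u(1) v(1) t(1)] conv_mass[OF \<phi> \<psi>] conv_mass[OF u(1) v(1)] by simp
    also have "\<dots> \<le> (?a - t) * (?b - t) + e'"
    proof -
      have "max 0 (mass u - t) * max 0 (mass v - t) \<le> (?a - t) * (?b - t)"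
        using m' t by (intro mult_mono) auto
      moreover have "?a * ?b - mass u * mass v \<le> e'"
      proof -
        have "?a * ?b - mass u * mass v = (?a - mass u) * ?b + mass u * (?b - mass v)" by (simp add: algebra_simps)
        also have "\<dots> \<le> e * ?b + ?a * e"
          using m m' pos mass_nonneg[OF u(1)] by (intro add_mono mult_mono) auto
        also have "\<dots> \<le> e * (?a + ?b + 1)" using e by (simp add: algebra_simps)
        also have "\<dots> = e'" using pos by (simp add: e_def)
        finally show ?thesis .
      qed
      ultimately show ?thesis using fin by linarith
    qed
    finally show "(LINT g|M. max 0 ((\<phi> \<star> \<psi>) g - t)) \<le> (?a - t) * (?b - t) + e'" .
  qed
qed

end

section \<open>Chord interpolation of convex functions\<close>

definition node :: "real \<Rightarrow> nat \<Rightarrow> nat \<Rightarrow> real" where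
  "node a N i = a * real i / real N"

definition slope :: "(real \<Rightarrow> real) \<Rightarrow> real \<Rightarrow> nat \<Rightarrow> nat \<Rightarrow> real" where
  "slope f a N i = (f (node a N (Suc i)) - f (node a N i)) / (a / real N)"

text \<open>On the interval this is the piecewise linear interpolant of \<open>f\<close> at the
  nodes, for \<open>f 0 = 0\<close>, after summation by parts. The coefficients of the hinges are
  differences of successive slopes, nonnegative for convex \<open>f\<close>; the leading slope may
  have either sign.\<close>

definition chords :: "(real \<Rightarrow> real) \<Rightarrow> real \<Rightarrow> nat \<Rightarrow> real \<Rightarrow> real" where
  "chords f a N y = slope f a N 0 * y +
     (\<Sum>i\<in>{1..<N}. (slope f a N i - slope f a N (i - 1)) * max 0 (y - node a N i))"

context
  fixes a :: real and N :: nat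
  assumes a: "0 < a" and N: "0 < N"
begin

lemma node_Suc: "node a N (Suc i) - node a N i = a / real N"
  by (simp add: node_def add_divide_distrib diff_divide_distrib[symmetric] algebra_simps)

lemma node_0 [simp]: "node a N 0 = 0" and node_N [simp]: "node a N N = a"
  using N by (simp_all add: node_def)

lemma node_mono: "i \<le> j \<Longrightarrow> node a N i \<le> node a N j"
  unfolding node_def using a by (intro divide_right_mono mult_left_mono) auto

lemma node_mem: "i \<le> N \<Longrightarrow> node a N i \<in> {0..a}"
  using node_mono[of 0 i] node_mono[of i N] by simp

lemma slope_step: "slope f a N i * (a / real N) = f (node a N (Suc i)) - f (node a N i)"
  using a N by (simp add: slope_def)

lemma slope_mono:
  assumes f: "convex_on {0..a} f" and i: "1 \<le> i" "i < N"
  shows "slope f a N (i - 1) \<le> slope f a N i"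
proof -
  obtain j where j: "i = Suc j" using i by (cases i) auto
  have "(1 - 1 / 2) *\<^sub>R node a N j + (1 / 2) *\<^sub>R node a N (Suc i) = node a N i"
    unfolding node_def j using N by (simp add: field_simps)
  then have "f (node a N i) \<le> (1 - 1 / 2) * f (node a N j) + 1 / 2 * f (node a N (Suc i))"
    using convex_onD[OF f, of "1 / 2" "node a N j" "node a N (Suc i)"] node_mem[of j] node_mem[of "Suc i"] i j by simp
  then have "f (node a N i) - f (node a N j) \<le> f (node a N (Suc i)) - f (node a N i)" by simp
  then have "slope f a N j \<le> slope f a N (Suc j)"
    unfolding slope_def j using a by (intro divide_right_mono) simp_all
  then show ?thesis by (simp add: j)
qed

context
  fixes f :: "real \<Rightarrow> real"
  assumes f0: "f 0 = 0"
begin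

text \<open>Summation by parts: the hinge at a node adjusts the slope there and leaves the value at
  that node unchanged.\<close>

lemma partial_chords:
  "slope f a N 0 * y + (\<Sum>i\<in>{1..k}. (slope f a N i - slope f a N (i - 1)) * (y - node a N i)) =
    f (node a N k) + slope f a N k * (y - node a N k)"
proof (induction k)
  case 0
  then show ?case by (simp add: f0)
next
  case (Suc k)
  have "slope f a N k * (node a N (Suc k) - node a N k) = f (node a N (Suc k)) - f (node a N k)"
    unfolding node_Suc by (rule slope_step)
  then show ?case using Suc by (simp add: algebra_simps)
qed

lemma chords_on_piece:
  assumes k: "k < N" and y: "node a N k \<le> y" "y \<le> node a N (Suc k)"
  shows "chords f a N y = f (node a N k) + slope f a N k * (y - node a N k)"
proof -
  have "(\<Sum>i\<in>{1..<N}. (slope f a N i - slope f a N (i - 1)) * max 0 (y - node a N i)) =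
      (\<Sum>i\<in>{1..k}. (slope f a N i - slope f a N (i - 1)) * max 0 (y - node a N i))"
  proof (rule sum.mono_neutral_right)
    show "\<forall>i\<in>{1..<N} - {1..k}. (slope f a N i - slope f a N (i - 1)) * max 0 (y - node a N i) = 0"
    proof
      fix i assume "i \<in> {1..<N} - {1..k}"
      then have "node a N (Suc k) \<le> node a N i" by (intro node_mono) auto
      then have "max 0 (y - node a N i) = 0" using y by simp
      then show "(slope f a N i - slope f a N (i - 1)) * max 0 (y - node a N i) = 0" by simp
    qed
  qed (use k in auto)
  also have "\<dots> = (\<Sum>i\<in>{1..k}. (slope f a N i - slope f a N (i - 1)) * (y - node a N i))"
  proof (rule sum.cong[OF refl])
    fix i assume "i \<in> {1..k}"
    then have "node a N i \<le> node a N k" by (intro node_mono) simp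
    then have "max 0 (y - node a N i) = y - node a N i" using y by simp
    then show "(slope f a N i - slope f a N (i - 1)) * max 0 (y - node a N i) =
        (slope f a N i - slope f a N (i - 1)) * (y - node a N i)" by simp
  qed
  finally show ?thesis unfolding chords_def partial_chords[symmetric] by simp
qed

lemma chords_convex_combination:
  assumes y: "y \<in> {0..a}"
  obtains k s where "k < N" "0 \<le> s" "s \<le> 1" "y = (1 - s) * node a N k + s * node a N (Suc k)"
    "chords f a N y = (1 - s) * f (node a N k) + s * f (node a N (Suc k))"
proof -
  have "\<exists>k<N. node a N k \<le> y \<and> y \<le> node a N (Suc k)"
  \<comment> \<open>At the right end the floor would give the index \<open>N\<close>, one past the
    last piece.\<close>
  proof (cases "y = a")
    case True
    then show ?thesis using N node_mono[of "N - 1" N] by (intro exI[of _ "N - 1"]) auto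
  next
    case False
    then have ya: "0 \<le> y" "y < a" using y by auto
    define k where "k = nat \<lfloor>y * real N / a\<rfloor>"
    have q: "0 \<le> y * real N / a" using ya a by simp
    then have k: "real k \<le> y * real N / a" "y * real N / a < real k + 1" unfolding k_def by linarith+
    have "y * real N / a < real N" using ya a N by (simp add: pos_divide_less_eq)
    then have "k < N" using k(1) by linarith
    moreover have "node a N k \<le> y" using k(1) a N by (simp add: node_def field_simps)
    moreover have "y \<le> node a N (Suc k)" using k(2) a N by (simp add: node_def field_simps)
    ultimately show ?thesis by blast
  qed
  then obtain k where k: "k < N" "node a N k \<le> y" "y \<le> node a N (Suc k)" by blast
  define s where "s = (y - node a N k) / (a / real N)"
  have h: "0 < a / real N" using a N by simp
  have sh: "s * (a / real N) = y - node a N k"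
    using a N by (intro nonzero_eq_divide_eq[THEN iffD1] s_def) simp
  have "0 \<le> s" unfolding s_def using k(2) h by (intro divide_nonneg_pos) simp_all
  moreover have "s * (a / real N) \<le> 1 * (a / real N)" unfolding sh using k(3) node_Suc[of k] by linarith
  then have "s \<le> 1" using h by (rule mult_right_le_imp_le)
  ultimately have s: "0 \<le> s" "s \<le> 1" by blast+
  have "y = (1 - s) * node a N k + s * node a N (Suc k)"
    using sh unfolding node_Suc[of k, symmetric] by (simp add: algebra_simps)
  moreover have "slope f a N k * (y - node a N k) = s * (f (node a N (Suc k)) - f (node a N k))"
    unfolding sh[symmetric] slope_step[symmetric] by simp
  then have "chords f a N y = (1 - s) * f (node a N k) + s * f (node a N (Suc k))"
    unfolding chords_on_piece[OF k] by (simp add: algebra_simps)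
  ultimately show thesis using that k(1) s by blast
qed

lemma chords_at_end: "chords f a N a = f a"
proof -
  have "chords f a N a = f (node a N (N - 1)) + slope f a N (N - 1) * (a - node a N (N - 1))"
    using N node_mono[of "N - 1" N] by (intro chords_on_piece) auto
  also have "a - node a N (N - 1) = a / real N" using node_Suc[of "N - 1"] N by simp
  finally show ?thesis using N by (simp only: slope_step) simp
qed

lemma f_le_chords:
  assumes f: "convex_on {0..a} f" and y: "y \<in> {0..a}"
  shows "f y \<le> chords f a N y"
proof -
  obtain k s where k: "k < N" "0 \<le> s" "s \<le> 1" "y = (1 - s) * node a N k + s * node a N (Suc k)"
    "chords f a N y = (1 - s) * f (node a N k) + s * f (node a N (Suc k))"
    by (rule chords_convex_combination[OF y])
  show ?thesis using convex_onD[OF f k(2,3), of "node a N k" "node a N (Suc k)"] node_mem[of k] node_mem[of "Suc k"] k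
    by simp
qed

end

end

section \<open>Integrals of hinges and convergence of the chord interpolants\<close>

lemma integral_hinge:
  fixes t a :: real
  assumes "0 \<le> t" "t \<le> a"
  shows "set_integrable lborel {0..a} (\<lambda>y. max 0 (y - t))" "(LINT y:{0..a}|lborel. max 0 (y - t)) = (a - t)\<^sup>2 / 2"
proof -
  have "((\<lambda>y::real. (y - t)\<^sup>2 / 2) has_real_derivative (y - t)) (at y)" for y
    by (auto intro!: derivative_eq_intros)
  then have F: "has_bochner_integral lborel (\<lambda>y. (y - t) * indicator {t..a} y) ((a - t)\<^sup>2 / 2 - (t - t)\<^sup>2 / 2)"
    using assms(2) by (intro has_bochner_integral_FTC_Icc_real) (auto intro!: continuous_intros)
  moreover have "(\<lambda>y. (y - t) * indicator {t..a} y) = (\<lambda>y. indicator {0..a} y *\<^sub>R max 0 (y - t))"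
    using assms by (auto simp: fun_eq_iff indicator_def)
  ultimately show "set_integrable lborel {0..a} (\<lambda>y. max 0 (y - t))" "(LINT y:{0..a}|lborel. max 0 (y - t)) = (a - t)\<^sup>2 / 2"
    unfolding set_integrable_def set_lebesgue_integral_def
    by (auto simp: has_bochner_integral_iff)
qed

lemma chords_integral:
  assumes a: "0 < a" and N: "0 < N"
  shows "set_integrable lborel {0..a} (chords f a N)"
    "(LINT y:{0..a}|lborel. chords f a N y) = slope f a N 0 * (a\<^sup>2 / 2) +
      (\<Sum>i\<in>{1..<N}. (slope f a N i - slope f a N (i - 1)) * ((a - node a N i)\<^sup>2 / 2))"
proof -
  have nd: "0 \<le> node a N i" "node a N i \<le> a" if "i \<in> {1..<N}" for i
    using node_mem[OF a N, of i] that by auto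
  have lin: "set_integrable lborel {0..a} (\<lambda>y. y)" "(LINT y:{0..a}|lborel. y) = a\<^sup>2 / 2"
  proof -
    have "(\<lambda>y. indicator {0..a} y *\<^sub>R y) = (\<lambda>y. indicator {0..a} y *\<^sub>R max 0 (y - 0))"
      by (auto simp: fun_eq_iff indicator_def)
    then show "set_integrable lborel {0..a} (\<lambda>y. y)" "(LINT y:{0..a}|lborel. y) = a\<^sup>2 / 2"
      using integral_hinge[of 0 a] a unfolding set_integrable_def set_lebesgue_integral_def by simp_all
  qed
  have h: "integrable lborel (\<lambda>y. indicator {0..a} y *\<^sub>R max 0 (y - node a N i))"
    "(LINT y|lborel. indicator {0..a} y *\<^sub>R max 0 (y - node a N i)) = (a - node a N i)\<^sup>2 / 2" if "i \<in> {1..<N}" for i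
    using integral_hinge[OF nd[OF that]] unfolding set_integrable_def set_lebesgue_integral_def by auto
  have l: "integrable lborel (\<lambda>y. indicator {0..a} y *\<^sub>R y)" "(LINT y|lborel. indicator {0..a} y *\<^sub>R y) = a\<^sup>2 / 2"
    using lin unfolding set_integrable_def set_lebesgue_integral_def by auto
  have e: "(\<lambda>y. indicator {0..a} y *\<^sub>R chords f a N y) = (\<lambda>y. slope f a N 0 * (indicator {0..a} y *\<^sub>R y) +
      (\<Sum>i\<in>{1..<N}. (slope f a N i - slope f a N (i - 1)) * (indicator {0..a} y *\<^sub>R max 0 (y - node a N i))))"
    unfolding chords_def by (auto simp: fun_eq_iff indicator_def)
  have i: "integrable lborel (\<lambda>y. \<Sum>i\<in>{1..<N}. (slope f a N i - slope f a N (i - 1)) * (indicator {0..a} y *\<^sub>R max 0 (y - node a N i)))"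
    using h(1) by (intro Bochner_Integration.integrable_sum integrable_mult_right)
  show "set_integrable lborel {0..a} (chords f a N)"
    unfolding set_integrable_def e using l(1) i by (intro Bochner_Integration.integrable_add integrable_mult_right)
  show "(LINT y:{0..a}|lborel. chords f a N y) = slope f a N 0 * (a\<^sup>2 / 2) +
      (\<Sum>i\<in>{1..<N}. (slope f a N i - slope f a N (i - 1)) * ((a - node a N i)\<^sup>2 / 2))"
  proof -
    let ?S = "\<lambda>y. \<Sum>i\<in>{1..<N}. (slope f a N i - slope f a N (i - 1)) * (indicator {0..a} y *\<^sub>R max 0 (y - node a N i))"
    have each: "(LINT y|lborel. (slope f a N i - slope f a N (i - 1)) * (indicator {0..a} y *\<^sub>R max 0 (y - node a N i))) =
        (slope f a N i - slope f a N (i - 1)) * ((a - node a N i)\<^sup>2 / 2)" if "i \<in> {1..<N}" for i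
      by (simp only: integral_mult_right_zero h(2)[OF that])
    have "(LINT y|lborel. slope f a N 0 * (indicator {0..a} y *\<^sub>R y) + ?S y) =
        (LINT y|lborel. slope f a N 0 * (indicator {0..a} y *\<^sub>R y)) + (LINT y|lborel. ?S y)"
      by (intro Bochner_Integration.integral_add integrable_mult_right l(1) i)
    moreover have "(LINT y|lborel. slope f a N 0 * (indicator {0..a} y *\<^sub>R y)) = slope f a N 0 * (a\<^sup>2 / 2)"
      by (simp only: integral_mult_right_zero l(2))
    moreover have "(LINT y|lborel. ?S y) = (\<Sum>i\<in>{1..<N}. LINT y|lborel.
        (slope f a N i - slope f a N (i - 1)) * (indicator {0..a} y *\<^sub>R max 0 (y - node a N i)))"
      by (intro Bochner_Integration.integral_sum integrable_mult_right h(1))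
    moreover have "(\<Sum>i\<in>{1..<N}. LINT y|lborel. (slope f a N i - slope f a N (i - 1)) * (indicator {0..a} y *\<^sub>R max 0 (y - node a N i))) =
        (\<Sum>i\<in>{1..<N}. (slope f a N i - slope f a N (i - 1)) * ((a - node a N i)\<^sup>2 / 2))"
      by (rule sum.cong[OF refl each])
    ultimately show ?thesis unfolding set_lebesgue_integral_def e by (simp only:)
  qed
qed

text \<open>The end values bound \<open>f\<close> from above, and the midpoint inequality for y and
  its reflection a - y turns this into a lower bound.\<close>

lemma convex_on_interval_bounded:
  fixes f :: "real \<Rightarrow> real"
  assumes f: "convex_on {0..a} f" and a: "0 < a"
  shows "\<exists>B. \<forall>y\<in>{0..a}. \<bar>f y\<bar> \<le> B"
proof -
  define m where "m = max (f 0) (f a)"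
  have up: "f y \<le> m" if y: "y \<in> {0..a}" for y
  proof -
    have q: "0 \<le> y / a" "y / a \<le> 1" using y a by auto
    have "f y \<le> (1 - y / a) * f 0 + y / a * f a"
      using convex_onD[OF f q, of 0 a] a by simp
    also have "\<dots> \<le> (1 - y / a) * m + y / a * m" using q by (intro add_mono mult_left_mono) (auto simp: m_def)
    finally show ?thesis by (simp add: algebra_simps)
  qed
  have low: "2 * f (a / 2) - m \<le> f y" if y: "y \<in> {0..a}" for y
  proof -
    have eq: "(1 - 1 / 2) *\<^sub>R y + (1 / 2) *\<^sub>R (a - y) = a / 2" by (simp add: field_simps)
    have "f ((1 - 1 / 2) *\<^sub>R y + (1 / 2) *\<^sub>R (a - y)) \<le> (1 - 1 / 2) * f y + 1 / 2 * f (a - y)"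
      using y by (intro convex_onD[OF f]) auto
    then have "f (a / 2) \<le> (1 - 1 / 2) * f y + 1 / 2 * f (a - y)" unfolding eq .
    then show ?thesis using up[of "a - y"] y by simp
  qed
  show ?thesis
    by (rule exI[of _ "\<bar>m\<bar> + \<bar>2 * f (a / 2) - m\<bar>"]) (use up low in fastforce)
qed

lemma chords_bound:
  assumes "0 < a" "0 < N" "f 0 = 0" "\<forall>y\<in>{0..a}. \<bar>f y\<bar> \<le> B" and y: "y \<in> {0..a}"
  shows "\<bar>chords f a N y\<bar> \<le> B"
proof -
  obtain k s where k: "k < N" "0 \<le> s" "s \<le> 1"
    "chords f a N y = (1 - s) * f (node a N k) + s * f (node a N (Suc k))"
    by (rule chords_convex_combination[where f = f, OF assms(1-3) y])
  have b: "\<bar>f (node a N k)\<bar> \<le> B" "\<bar>f (node a N (Suc k))\<bar> \<le> B"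
    using assms(4) node_mem[OF assms(1,2)] k(1) by auto
  have "\<bar>chords f a N y\<bar> \<le> \<bar>(1 - s) * f (node a N k)\<bar> + \<bar>s * f (node a N (Suc k))\<bar>"
    unfolding k(4) by (rule abs_triangle_ineq)
  also have "\<dots> = (1 - s) * \<bar>f (node a N k)\<bar> + s * \<bar>f (node a N (Suc k))\<bar>" using k by (simp add: abs_mult)
  also have "\<dots> \<le> (1 - s) * B + s * B" using b k by (intro add_mono mult_left_mono) auto
  finally show ?thesis by (simp add: algebra_simps)
qed

lemma chords_tendsto:
  assumes a: "0 < a" and f0: "f 0 = 0" and y: "0 < y" "y < a" and cont: "isCont f y"
  shows "(\<lambda>n. chords f a (Suc n) y) \<longlonglongrightarrow> f y"
proof (rule LIMSEQ_I)
  fix e :: real assume "0 < e"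
  then obtain d where d: "0 < d" "\<And>z. \<bar>z - y\<bar> < d \<Longrightarrow> \<bar>f z - f y\<bar> < e / 2"
    using cont[unfolded continuous_at_eps_delta dist_real_def] half_gt_zero[OF \<open>0 < e\<close>] by blast
  obtain n0 where n0: "a / d < real n0" using reals_Archimedean2 by blast
  show "\<exists>no. \<forall>n\<ge>no. norm (chords f a (Suc n) y - f y) < e"
  proof (intro exI[of _ n0] allI impI)
    fix n assume "n0 \<le> n"
    then have "a / d < real (Suc n)" using n0 by simp
    then have h: "a / real (Suc n) < d" using d a by (simp add: field_simps)
    have yy: "y \<in> {0..a}" using y by auto
    obtain k s where k: "k < Suc n" "0 \<le> s" "s \<le> 1"
      "y = (1 - s) * node a (Suc n) k + s * node a (Suc n) (Suc k)"
      "chords f a (Suc n) y = (1 - s) * f (node a (Suc n) k) + s * f (node a (Suc n) (Suc k))"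
      by (rule chords_convex_combination[where f = f, OF a zero_less_Suc f0 yy])
    have st: "node a (Suc n) (Suc k) - node a (Suc n) k = a / real (Suc n)" by (rule node_Suc[OF a zero_less_Suc])
    have "y - node a (Suc n) k = s * (a / real (Suc n))"
      unfolding st[symmetric] by (subst k(4)) (simp add: algebra_simps)
    moreover have "node a (Suc n) (Suc k) - y = (1 - s) * (a / real (Suc n))"
      unfolding st[symmetric] by (subst k(4)) (simp add: algebra_simps)
    moreover have "0 \<le> s * (a / real (Suc n))" "s * (a / real (Suc n)) \<le> 1 * (a / real (Suc n))"
      "0 \<le> (1 - s) * (a / real (Suc n))" "(1 - s) * (a / real (Suc n)) \<le> 1 * (a / real (Suc n))"
      using k a by (intro mult_nonneg_nonneg mult_right_mono; simp)+
    moreover have "\<bar>p - y\<bar> < d" "\<bar>q - y\<bar> < d"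
      if "y - p = u" "q - y = v" "0 \<le> u" "u \<le> 1 * w" "0 \<le> v" "v \<le> 1 * w" "w < d" for p q u v w :: real
      using that by (simp_all add: abs_less_iff)
    ultimately have nb: "\<bar>node a (Suc n) k - y\<bar> < d \<and> \<bar>node a (Suc n) (Suc k) - y\<bar> < d"
      using h by blast
    then have b: "\<bar>f (node a (Suc n) k) - f y\<bar> \<le> e / 2" "\<bar>f (node a (Suc n) (Suc k)) - f y\<bar> \<le> e / 2"
      using d(2) less_imp_le by blast+
    have "chords f a (Suc n) y - f y = (1 - s) * (f (node a (Suc n) k) - f y) + s * (f (node a (Suc n) (Suc k)) - f y)"
      unfolding k(5) by (simp add: algebra_simps)
    also have "\<bar>\<dots>\<bar> \<le> \<bar>(1 - s) * (f (node a (Suc n) k) - f y)\<bar> + \<bar>s * (f (node a (Suc n) (Suc k)) - f y)\<bar>"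
      by (rule abs_triangle_ineq)
    also have "\<dots> = (1 - s) * \<bar>f (node a (Suc n) k) - f y\<bar> + s * \<bar>f (node a (Suc n) (Suc k)) - f y\<bar>"
      using k by (simp add: abs_mult)
    also have "\<dots> \<le> (1 - s) * (e / 2) + s * (e / 2)" using b k by (intro add_mono mult_left_mono) auto
    also have "(1 - s) * x + s * x = x" for x by (simp add: algebra_simps)
    also have "e / 2 < e" using \<open>0 < e\<close> by simp
    finally show "norm (chords f a (Suc n) y - f y) < e" by simp
  qed
qed

lemma isCont_convex_interior:
  fixes f :: "real \<Rightarrow> real"
  assumes f: "convex_on {0..a} f" and y: "0 < y" "y < a"
  shows "isCont f y"
proof -
  have "convex_on {0<..<a} f" using f by (rule convex_on_subset) auto
  then have "continuous_on {0<..<a} f" by (intro convex_on_continuous) auto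
  then show ?thesis using y by (simp add: continuous_on_eq_continuous_at)
qed

text \<open>\<open>f\<close> is continuous in the interior; possible jumps at the ends concern two
  single points.\<close>

lemma convex_interval_measurable:
  fixes f :: "real \<Rightarrow> real"
  assumes f: "convex_on {0..a} f" and a: "0 < a"
  shows "(\<lambda>y. indicator {0..a} y * f y) \<in> borel_measurable borel"
proof -
  have "continuous_on {0<..<a} f"
    using isCont_convex_interior[OF f] by (intro continuous_at_imp_continuous_on) auto
  then have "(\<lambda>y. indicator {0<..<a} y *\<^sub>R f y) \<in> borel_measurable borel"
    by (intro borel_measurable_continuous_on_indicator) auto
  then have "(\<lambda>y. indicator {0<..<a} y *\<^sub>R f y + indicator {0} y * f 0 + indicator {a} y * f a) \<in> borel_measurable borel"
    by simp
  moreover have "indicator {0<..<a} y *\<^sub>R f y + indicator {0} y * f 0 + indicator {a} y * f a = indicator {0..a} y * f y" for y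
    using a by (auto simp: indicator_def)
  ultimately show ?thesis by simp
qed

text \<open>The chords inherit the bound of \<open>f\<close> and converge wherever \<open>f\<close>
  is continuous, hence on the open interval; the two end points form a null set.\<close>

lemma chords_integral_tendsto:
  assumes f: "convex_on {0..a} f" and a: "0 < a" and f0: "f 0 = 0"
  shows "(\<lambda>n. LINT y:{0..a}|lborel. chords f a (Suc n) y) \<longlonglongrightarrow> (LINT y:{0..a}|lborel. f y)"
proof -
  obtain B where B: "\<forall>y\<in>{0..a}. \<bar>f y\<bar> \<le> B" using convex_on_interval_bounded[OF f a] by blast
  show ?thesis
    unfolding set_lebesgue_integral_def
  proof (rule integral_dominated_convergence[where w = "\<lambda>y. B * indicator {0..a} y"])
    show "(\<lambda>y. indicator {0..a} y *\<^sub>R f y) \<in> borel_measurable lborel"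
      using convex_interval_measurable[OF f a] by simp
    show "(\<lambda>y. indicator {0..a} y *\<^sub>R chords f a (Suc n) y) \<in> borel_measurable lborel" for n
      using chords_integral(1)[OF a, of "Suc n" f] unfolding set_integrable_def by (auto dest: borel_measurable_integrable)
    show "integrable lborel (\<lambda>y. B * indicator {0..a} y)"
      using a by (intro integrable_mult_right integrable_real_indicator) (auto simp: emeasure_lborel_Icc_eq)
    show "AE y in lborel. norm (indicator {0..a} y *\<^sub>R chords f a (Suc n) y) \<le> B * indicator {0..a} y" for n
      using chords_bound[where f = f, OF a zero_less_Suc f0 B] by (intro AE_I2) (auto simp: indicator_def)
    have "AE y in lborel. y \<notin> {0, a}" by (intro AE_not_in) (auto intro!: null_sets.insert_in_sets finite_imp_null_set_lborel)
    then show "AE y in lborel. (\<lambda>n. indicator {0..a} y *\<^sub>R chords f a (Suc n) y) \<longlonglongrightarrow> indicator {0..a} y *\<^sub>R f y"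
    proof eventually_elim
      case (elim y)
      show ?case
      proof (cases "y \<in> {0..a}")
        case True
        then have y: "0 < y" "y < a" using elim by auto
        then show ?thesis using chords_tendsto[where f = f, OF a f0 y isCont_convex_interior[OF f y]] True by simp
      qed simp
    qed
  qed
qed

text \<open>If the negative part of \<open>h\<close> has infinite integral, the extended integral is
  -\<infinity>; otherwise \<open>h\<close> is integrable and monotonicity applies.\<close>

lemma extended_integral_le:
  assumes h: "h \<in> borel_measurable M" and G: "integrable M G" "\<And>x. h x \<le> G x"
  shows "upper_integrable M h" "extended_integral M h \<le> ereal (integral\<^sup>L M G)"
proof -
  have "(\<integral>\<^sup>+x. ennreal (h x) \<partial>M) \<le> (\<integral>\<^sup>+x. ennreal (norm (G x)) \<partial>M)"
    using G(2) by (intro nn_integral_mono ennreal_leI) (auto intro: order_trans[OF _ abs_ge_self])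
  also have "\<dots> < \<infinity>" using G(1) by (simp add: integrable_iff_bounded)
  finally have P: "(\<integral>\<^sup>+x. ennreal (h x) \<partial>M) < \<infinity>" .
  then show "upper_integrable M h" using h by (simp add: upper_integrable_def)
  obtain p where p: "(\<integral>\<^sup>+x. ennreal (h x) \<partial>M) = ennreal p" "0 \<le> p"
    using P by (cases "\<integral>\<^sup>+x. ennreal (h x) \<partial>M") auto
  show "extended_integral M h \<le> ereal (integral\<^sup>L M G)"
  proof (cases "\<integral>\<^sup>+x. ennreal (- h x) \<partial>M")
    case top
    then show ?thesis by (simp add: extended_integral_def p enn2ereal_ennreal)
  next
    case (real q)
    have i: "integrable M h" using h p real by (simp add: real_integrable_def)
    have "integral\<^sup>L M h = p - q" using p real by (simp add: real_lebesgue_integral_def[OF i])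
    moreover have "integral\<^sup>L M h \<le> integral\<^sup>L M G" using i G by (intro integral_mono) auto
    ultimately show ?thesis using p real by (simp add: extended_integral_def enn2ereal_ennreal)
  qed
qed

section \<open>The inequality for chord interpolants and the passage to the limit\<close>

context unimodular_haar
begin

lemma integral_chords_conv:
  assumes \<phi>: "unit_L1 \<phi>" and \<psi>: "unit_L1 \<psi>"
    and vol: "ennreal (mass \<phi> + mass \<psi>) \<le> min_open_subgroup_vol M"
    and le: "mass \<phi> \<le> mass \<psi>" and a: "0 < mass \<phi>" and N: "0 < N"
    and f: "convex_on {0..mass \<phi>} f" "f 0 = 0"
  shows "integrable M (\<lambda>g. chords f (mass \<phi>) N ((\<phi> \<star> \<psi>) g))"
    "(LINT g|M. chords f (mass \<phi>) N ((\<phi> \<star> \<psi>) g)) \<le>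
      2 * (LINT y:{0..mass \<phi>}|lborel. chords f (mass \<phi>) N y) + (mass \<psi> - mass \<phi>) * f (mass \<phi>)"
proof -
  let ?a = "mass \<phi>" and ?b = "mass \<psi>"
  let ?w = "\<lambda>i. slope f ?a N i - slope f ?a N (i - 1)"
  let ?t = "node ?a N"
  let ?ex = "\<lambda>i g. max 0 ((\<phi> \<star> \<psi>) g - ?t i)"
  have t: "0 \<le> ?t i" "?t i \<le> ?a" if "i \<in> {1..<N}" for i using node_mem[OF a N, of i] that by auto
  have i: "integrable M (?ex i)" if "i \<in> {1..<N}" for i by (rule integrable_excess[OF \<phi> \<psi> t(1)[OF that]])
  have s: "integrable M (\<lambda>g. \<Sum>i\<in>{1..<N}. ?w i * ?ex i g)"
    using i by (intro Bochner_Integration.integrable_sum integrable_mult_right)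
  show "integrable M (\<lambda>g. chords f ?a N ((\<phi> \<star> \<psi>) g))"
    unfolding chords_def using s conv_mass(1)[OF \<phi> \<psi>]
    by (intro Bochner_Integration.integrable_add integrable_mult_right)
  let ?L = "LINT g|M. chords f ?a N ((\<phi> \<star> \<psi>) g)"
  have "?L = slope f ?a N 0 * (?a * ?b) + (LINT g|M. (\<Sum>i\<in>{1..<N}. ?w i * ?ex i g))"
    unfolding chords_def using s conv_mass[OF \<phi> \<psi>] by simp
  moreover have "(LINT g|M. (\<Sum>i\<in>{1..<N}. ?w i * ?ex i g)) = (\<Sum>i\<in>{1..<N}. LINT g|M. ?w i * ?ex i g)"
    using i by (intro Bochner_Integration.integral_sum integrable_mult_right)
  moreover have "(\<Sum>i\<in>{1..<N}. LINT g|M. ?w i * ?ex i g) \<le> (\<Sum>i\<in>{1..<N}. ?w i * ((?a - ?t i) * (?b - ?t i)))"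
  proof (intro sum_mono)
    fix i assume iN: "i \<in> {1..<N}"
    have "(LINT g|M. ?ex i g) \<le> (?a - ?t i) * (?b - ?t i)"
      using t[OF iN] le by (intro excess_le[OF \<phi> \<psi> vol]) auto
    \<comment> \<open>The estimate of a hinge may be multiplied by its coefficient because convexity
      makes the latter nonnegative. The linear term was evaluated exactly, so its sign is
      immaterial.\<close>
    moreover have "0 \<le> ?w i" using slope_mono[OF a N f(1), of i] iN by simp
    ultimately have "?w i * (LINT g|M. ?ex i g) \<le> ?w i * ((?a - ?t i) * (?b - ?t i))" by (rule mult_left_mono)
    then show "(LINT g|M. ?w i * ?ex i g) \<le> ?w i * ((?a - ?t i) * (?b - ?t i))" by simp
  qed
  ultimately have L: "?L \<le> slope f ?a N 0 * (?a * ?b) + (\<Sum>i\<in>{1..<N}. ?w i * ((?a - ?t i) * (?b - ?t i)))"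
    by linarith
  have "slope f ?a N 0 * (?a * ?b) + (\<Sum>i\<in>{1..<N}. ?w i * ((?a - ?t i) * (?b - ?t i))) =
      2 * (LINT y:{0..?a}|lborel. chords f ?a N y) + (?b - ?a) * chords f ?a N ?a"
  proof -
    \<comment> \<open>Origin of the shape of the right-hand side:
      \<open>(?a - ?t i) * (?b - ?t i)\<close> is twice the integral of the hinge over
      \<open>{0..?a}\<close> plus \<open>?b - ?a\<close> times its value at
      \<open>?a\<close>.\<close>
    have "?w i * ((?a - ?t i) * (?b - ?t i)) = 2 * (?w i * ((?a - ?t i)\<^sup>2 / 2)) + (?b - ?a) * (?w i * max 0 (?a - ?t i))"
      if "i \<in> {1..<N}" for i
    proof -
      have m: "max 0 (?a - ?t i) = ?a - ?t i" using t[OF that] by simp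
      have "w * ((p - r) * (q - r)) = 2 * (w * ((p - r)\<^sup>2 / 2)) + (q - p) * (w * (p - r))" for w p q r :: real
        by (simp add: power2_eq_square field_simps)
      then show ?thesis unfolding m .
    qed
    then have "(\<Sum>i\<in>{1..<N}. ?w i * ((?a - ?t i) * (?b - ?t i))) =
        2 * (\<Sum>i\<in>{1..<N}. ?w i * ((?a - ?t i)\<^sup>2 / 2)) + (?b - ?a) * (\<Sum>i\<in>{1..<N}. ?w i * max 0 (?a - ?t i))"
      unfolding sum_distrib_left sum.distrib[symmetric] by (intro sum.cong refl)
    moreover have "slope f ?a N 0 * (?a * ?b) = 2 * (slope f ?a N 0 * (?a\<^sup>2 / 2)) + (?b - ?a) * (slope f ?a N 0 * ?a)"
      by (simp add: power2_eq_square algebra_simps)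
    ultimately show ?thesis unfolding chords_integral(2)[OF a N] unfolding chords_def by (simp add: distrib_left)
  qed
  with L show "?L \<le> 2 * (LINT y:{0..?a}|lborel. chords f ?a N y) + (?b - ?a) * f ?a"
    unfolding chords_at_end[where f = f, OF a N f(2)] by linarith
qed

end

theorem theorem1p1:
  fixes M :: "'a::{topological_group_add, t2_space} measure"
    and \<phi>\<^sub>1 \<phi>\<^sub>2 :: "'a \<Rightarrow> real"
    and f :: "real \<Rightarrow> real"
  assumes "locally_compact_space (euclidean :: 'a topology)"
    and "haar_measure M"
    and "unimodular M"
    and "\<And>g. \<phi>\<^sub>1 g \<in> {0..1}"
    and "\<And>g. \<phi>\<^sub>2 g \<in> {0..1}"
    and "integrable M \<phi>\<^sub>1"
    and "integrable M \<phi>\<^sub>2"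
    and "L1_norm M \<phi>\<^sub>1 \<le> L1_norm M \<phi>\<^sub>2"
    and "ennreal (L1_norm M \<phi>\<^sub>1 + L1_norm M \<phi>\<^sub>2) \<le> min_open_subgroup_vol M"
    and "convex_on {0..L1_norm M \<phi>\<^sub>1} f"
    and "f 0 = 0"
  shows "upper_integrable M (f \<circ> group_convolution M \<phi>\<^sub>1 \<phi>\<^sub>2) \<and>
    extended_integral M (f \<circ> group_convolution M \<phi>\<^sub>1 \<phi>\<^sub>2)
      \<le> ereal (2 * (LINT y:{0..L1_norm M \<phi>\<^sub>1}|lborel. f y)
          + (L1_norm M \<phi>\<^sub>2 - L1_norm M \<phi>\<^sub>1) * f (L1_norm M \<phi>\<^sub>1))"
proof -
  interpret unimodular_haar M using assms(2,3) by unfold_locales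
  have u: "unit_L1 \<phi>\<^sub>1" "unit_L1 \<phi>\<^sub>2" using assms(4-7) by (auto simp: unit_L1_def)
  have n: "L1_norm M \<phi>\<^sub>1 = mass \<phi>\<^sub>1" "L1_norm M \<phi>\<^sub>2 = mass \<phi>\<^sub>2"
    using u by (simp_all add: L1_norm_def unit_L1D)
  note vol = assms(9)[unfolded n] and le = assms(8)[unfolded n] and f = assms(10)[unfolded n]
  define a where "a = mass \<phi>\<^sub>1"
  have p: "0 \<le> (\<phi>\<^sub>1 \<star> \<phi>\<^sub>2) g" "(\<phi>\<^sub>1 \<star> \<phi>\<^sub>2) g \<le> a" for g
    unfolding a_def by (rule conv_nonneg[OF u], rule conv_le_left[OF u])
  show ?thesis
  \<comment> \<open>For \<open>a = 0\<close> all nodes coincide and slopes would be quotients by 0;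
    here the convolution vanishes identically.\<close>
  proof (cases "a = 0")
    case True
    then have "(\<phi>\<^sub>1 \<star> \<phi>\<^sub>2) g = 0" for g using p[of g] by (intro antisym) simp_all
    then have "f \<circ> (\<phi>\<^sub>1 \<star> \<phi>\<^sub>2) = (\<lambda>_. 0)" using assms(11) by (simp add: fun_eq_iff)
    moreover have "(LINT y:{0..0}|lborel. f y) = 0"
    proof -
      have "(\<lambda>y. indicator {0..0} y *\<^sub>R f y) = (\<lambda>_. 0)" using assms(11) by (auto simp: fun_eq_iff indicator_def)
      then show ?thesis by (simp add: set_lebesgue_integral_def)
    qed
    ultimately show ?thesis
      using True assms(11) unfolding n a_def by (simp add: upper_integrable_def extended_integral_def)
  next
    case False
    then have a: "0 < a" using mass_nonneg[OF u(1)] by (simp add: a_def)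
    \<comment> \<open>Outside \<open>{0..a}\<close> the function \<open>f\<close> is arbitrary and
      perhaps not measurable; the indicator confines it to the values that the convolution
      takes.\<close>
    have "(\<lambda>g. indicator {0..a} ((\<phi>\<^sub>1 \<star> \<phi>\<^sub>2) g) * f ((\<phi>\<^sub>1 \<star> \<phi>\<^sub>2) g)) \<in> borel_measurable M"
      using measurable_compose[OF conv_measurable[OF u] convex_interval_measurable[OF f[folded a_def] a]] by simp
    moreover have "indicator {0..a} ((\<phi>\<^sub>1 \<star> \<phi>\<^sub>2) g) * f ((\<phi>\<^sub>1 \<star> \<phi>\<^sub>2) g) = (f \<circ> (\<phi>\<^sub>1 \<star> \<phi>\<^sub>2)) g" for g
      using p[of g] by simp
    ultimately have meas: "f \<circ> (\<phi>\<^sub>1 \<star> \<phi>\<^sub>2) \<in> borel_measurable M" by (simp only: fun_eq_iff eta_contract_eq)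
    \<comment> \<open>The left-hand side is bounded by \<open>?R n\<close> for every
      \<open>n\<close>, so only the integral over the bounded interval has to pass to the limit, and
      no convergence on the group is involved.\<close>
    let ?R = "\<lambda>n. 2 * (LINT y:{0..a}|lborel. chords f a (Suc n) y) + (mass \<phi>\<^sub>2 - a) * f a"
    have dom: "(f \<circ> (\<phi>\<^sub>1 \<star> \<phi>\<^sub>2)) g \<le> chords f a (Suc n) ((\<phi>\<^sub>1 \<star> \<phi>\<^sub>2) g)" for n g
      using f_le_chords[where f = f, OF a zero_less_Suc assms(11) f[folded a_def], of "(\<phi>\<^sub>1 \<star> \<phi>\<^sub>2) g" n] p[of g] by simp
    note ch = integral_chords_conv[OF u vol le a[unfolded a_def] zero_less_Suc f assms(11), folded a_def]
    have up: "upper_integrable M (f \<circ> (\<phi>\<^sub>1 \<star> \<phi>\<^sub>2))"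
      by (rule extended_integral_le(1)[OF meas ch(1) dom])
    have bound: "extended_integral M (f \<circ> (\<phi>\<^sub>1 \<star> \<phi>\<^sub>2)) \<le> ereal (?R n)" for n
      using extended_integral_le(2)[OF meas ch(1) dom] ch(2)[of n] by (meson ereal_less_eq(3) order_trans)
    have "?R \<longlonglongrightarrow> 2 * (LINT y:{0..a}|lborel. f y) + (mass \<phi>\<^sub>2 - a) * f a"
      using chords_integral_tendsto[OF f[folded a_def] a assms(11)] by (intro tendsto_intros)
    then have "(\<lambda>n. ereal (?R n)) \<longlonglongrightarrow> ereal (2 * (LINT y:{0..a}|lborel. f y) + (mass \<phi>\<^sub>2 - a) * f a)"
      by (simp add: tendsto_ereal)
    then have "extended_integral M (f \<circ> (\<phi>\<^sub>1 \<star> \<phi>\<^sub>2)) \<le> ereal (2 * (LINT y:{0..a}|lborel. f y) + (mass \<phi>\<^sub>2 - a) * f a)"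
      by (rule LIMSEQ_le_const) (use bound in blast)
    then show ?thesis using up unfolding n a_def by blast
  qed
qed

end
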